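(* Let $n\ge2$, let $\Omega\subset\mathbb{R}^n$ be a bounded open set with smooth boundary such that $m=\inf_{x\in\Omega}|x|$ and $M=\sup_{x\in\Omega}|x|$ satisfy $0\le m<M<+\infty$, let $b\in L^\infty(\partial\Omega)$ be real valued, and let $\mathcal{D}_S=(1+|x|^2)\sum_{i=1}^ne_i\partial_{x_i}-nx$ be the Dirac operator on the spherical space, where $x=\sum_{i=1}^nx_ie_i$. Let $s\in\mathbb{R}^{n+1}$ (a paravector with real part $s_0$) be such that $$|s|^2+n^2-2|s_0|nM+(1+m^2)^2-2^{\frac n2+1}\|b\|_{L^\infty(\partial\Omega)}\|\tau_D\|^2>0$$ and $$\begin{aligned}&|s|^2\Big((1+m^2)^2-2^{\frac n2}\|b\|_{L^\infty(\partial\Omega)}\|\tau_D\|^2\Big)-n(1+M^2)^2s_0^2\\&-2|s_0|nM\Big((1+m^2)^2+(3+n)(1+M^2)^2-2^{\frac n2}\|b\|_{L^\infty(\partial\Omega)}\|\tau_D\|^2\Big)\\&>n(1+M^2)^2(3+n)^2M^2+(1+m^2)^2\,2^{\frac n2}\|b\|_{L^\infty(\partial\Omega)}\|\tau_D\|^2\\&\quad-n^2\Big((1+m^2)^2-2^{\frac n2}\|b\|_{L^\infty(\partial\Omega)}\|\tau_D\|^2\Big)-2^n\|b\|_{L^\infty(\partial\Omega)}^2\|\tau_D\|^4.\end{aligned}$$ Then for every $f\in L^2(\Omega,\mathbb{R}_n)$ there exists a unique $F_f\in H^1(\Omega,\mathbb{R}_n)$ such that $$q_s^R(F_f,G)=\langle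 f,G\rangle_2\qquad\text{for all }G\in H^1(\Omega,\mathbb{R}_n).$$ Moreover, writing $Q_s(\mathcal{D}_S)^{-1}f:=F_f$, this solution satisfies $$\|Q_s(\mathcal{D}_S)^{-1}f\|_2\le\frac{1}{H^R_{n,m,M}(s)}\|f\|_2\qquad\text{and}\qquad\|Q_s(\mathcal{D}_S)^{-1}f\|_D\le\frac{1}{H^R_{n,m,M}(s)}\|f\|_2,$$ where $$\begin{aligned}H^R_{n,m,M}(s)=\;&\tfrac12\big(|s|^2+n^2-2|s_0|nM\big)+\tfrac12(1+m^2)^2-2^{\frac n2}\|b\|_{L^\infty(\partial\Omega)}\|\tau_D\|^2\\&-\tfrac12\sqrt{\Big(|s|^2+n^2-2|s_0|nM-(1+m^2)^2\Big)^2+4\Big(\sqrt n(1+M^2)\big((3+n)M+|s_0|\big)\Big)^2}.\end{aligned}$$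
   Context: $\mathbb{R}_n$ is the real Clifford algebra generated by $e_1,\dots,e_n$ with $e_i^2=-1$, $e_ie_j=-e_je_i$ for $i\ne j$, with basis $e_A=e_{i_1}\cdots e_{i_r}$, $A=(i_1<\dots<i_r)$, $e_\emptyset=1$. For $x=\sum_Ax_Ae_A$: $\mathrm{Sc}(x)=x_\emptyset$, conjugation is $\overline x=\sum_Ax_A\overline{e_A}$ with $\overline{e_A}=\overline{e_{i_r}}\cdots\overline{e_{i_1}}$, $\overline{e_i}=-e_i$, and $|x|=(\sum_A|x_A|^2)^{1/2}$. $\mathbb{R}^{n+1}$ is identified with the paravectors $s=s_0+s_1e_1+\dots+s_ne_n$, $s_i\in\mathbb{R}$. A point $x=(x_1,\dots,x_n)\in\mathbb{R}^n$ is identified with $x=\sum_{i=1}^nx_ie_i\in\mathbb{R}_n$, acting by left multiplication on functions, as do the $e_i$. Functions take values in $\mathbb{R}_n$; $L^2(\Omega,\mathbb{R}_n)=L^2(\Omega,\mathbb{R})\otimes\mathbb{R}_n$ and $H^1(\Omega,\mathbb{R}_n)=H^1(\Omega,\mathbb{R})\otimes\mathbb{R}_n$ (Lebesgue measure), conjugation and derivatives being applied pointwise/componentwise. $\langle F,G\rangle_2=\int_\Omega\overline FG\,dx\in\mathbb{R}_n$, $\|F\|_2^2=\mathrm{Sc}\langle F,F\rangle_2$, $\|F\|_D^2=\sum_{i=1}^n\|\partial_{x_i}F\|_2^2$, $\|F\|_{H^1}^2=\|F\|_2^2+\|F\|_D^2$. $\tau_D:H^1(\Omega,\mathbb{R}_n)\to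 L^2(\partial\Omega,\mathbb{R}_n)$ is the bounded Dirichlet trace operator and $\|\tau_D\|$ its operator norm; $\langle F,G\rangle_{L^2(\partial\Omega)}=\int_{\partial\Omega}\overline FG\,d\Gamma$. Let $\mathcal{D}_e=\sum_{i=1}^ne_i\partial_{x_i}$ and $E=\sum_{i=1}^nx_i\partial_{x_i}$. The Robin sesquilinear form, defined on $H^1(\Omega,\mathbb{R}_n)\times H^1(\Omega,\mathbb{R}_n)$, is $$\begin{aligned}q_s^R(F,G)=\;&\sum_{i=1}^n\langle(1+|x|^2)^2\partial_{x_i}F,\partial_{x_i}G\rangle_2+2(2+n)\langle(1+|x|^2)EF,G\rangle_2+2\langle(1+|x|^2)x\mathcal{D}_eF,G\rangle_2\\&-2s_0\langle\mathcal{D}_SF,G\rangle_2+(|s|^2+n^2)\langle F,G\rangle_2+\langle b\,\tau_DF,\tau_DG\rangle_{L^2(\partial\Omega)}.\end{aligned}$$ It is the weak form of $Q_s(\mathcal{D}_S)F=f$ in $\Omega$ with $(1+|x|^2)^2\sum_{i=1}^n\nu_i\partial_{x_i}F+bF=0$ on $\partial\Omega$, where $Q_s(\mathcal{D}_S)=\mathcal{D}_S^2-2s_0\mathcal{D}_S+|s|^2$ and $\nu$ is the outer unit normal; $Q_s(\mathcal{D}_S)^{-1}f$ denotes the weak solution $F_f$. *)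

theory Defs
  imports "HOL-Analysis.Analysis" "HOL-Probability.Essential_Supremum"
begin

section \<open>The real Clifford algebra\<close>

text \<open>The index type \<open>'n\<close> plays the role of \<open>{1, \<dots>, n}\<close>, with \<open>n = CARD('n)\<close>. An element
  \<open>\<Sum>\<^sub>A x\<^sub>A e\<^sub>A\<close> is the vector of its coefficients, indexed by the subsets \<open>A\<close> of \<open>'n\<close>, so that
  the Euclidean \<open>norm\<close> of the type is \<open>(\<Sum>\<^sub>A \<bar>x\<^sub>A\<bar>\<^sup>2)\<^sup>1\<^sup>/\<^sup>2\<close>.\<close>

type_synonym 'n clifford = "(real, 'n set) vec"

type_synonym 'n rn = "(real, 'n) vec"

text \<open>Sign of \<open>e\<^sub>A e\<^sub>B\<close>: sorting the concatenated word costs a factor \<open>-1\<close> for each pair \<open>b < a\<close>,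
  and each pair \<open>b = a\<close> contributes \<open>e\<^sub>a\<^sup>2 = -1\<close>.\<close>

definition cl_sign :: "'n::{finite,linorder} set \<Rightarrow> 'n set \<Rightarrow> real" where
  "cl_sign A B = (\<Prod>a\<in>A. \<Prod>b\<in>B. if b \<le> a then -1 else 1)"

definition cl_mult :: "'n::{finite,linorder} clifford \<Rightarrow> 'n clifford \<Rightarrow> 'n clifford"
    (infixl "\<odot>" 70) where
  "x \<odot> y = (\<Sum>A\<in>UNIV. \<Sum>B\<in>UNIV. (x $ A * y $ B * cl_sign A B) *\<^sub>R axis (sym_diff A B) 1)"

definition cl_one :: "'n::{finite,linorder} clifford" where
  "cl_one = axis {} 1"

definition cl_gen :: "'n::{finite,linorder} \<Rightarrow> 'n clifford" where
  "cl_gen i = axis {i} 1"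

definition cl_prod :: "'n::{finite,linorder} clifford list \<Rightarrow> 'n clifford" where
  "cl_prod xs = foldr (\<odot>) xs cl_one"

definition Sc :: "'n::{finite,linorder} clifford \<Rightarrow> real" where
  "Sc x = x $ {}"

definition cl_conj :: "'n::{finite,linorder} clifford \<Rightarrow> 'n clifford" where
  "cl_conj x =
     (\<Sum>A\<in>UNIV. x $ A *\<^sub>R cl_prod (map (\<lambda>i. - cl_gen i) (rev (sorted_list_of_set A))))"

definition cl_vec :: "'n::{finite,linorder} rn \<Rightarrow> 'n clifford" where
  "cl_vec x = (\<Sum>i\<in>UNIV. x $ i *\<^sub>R cl_gen i)"

definition paravectors :: "'n::{finite,linorder} clifford set" where
  "paravectors = {s0 *\<^sub>R cl_one + cl_vec v | s0 v. True}"

text \<open>The following lemmas check that \<open>\<odot>\<close> is the multiplication of the Clifford algebra.\<close>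

lemma cl_mult_add_left: "(x + y) \<odot> z = x \<odot> z + y \<odot> z"
  by (simp add: cl_mult_def algebra_simps sum.distrib)

lemma cl_mult_add_right: "x \<odot> (y + z) = x \<odot> y + x \<odot> z"
  by (simp add: cl_mult_def algebra_simps sum.distrib)

lemma cl_mult_scaleR_left: "(c *\<^sub>R x) \<odot> y = c *\<^sub>R (x \<odot> y)"
  by (simp add: cl_mult_def scaleR_sum_right mult.assoc)

lemma cl_mult_scaleR_right: "x \<odot> (c *\<^sub>R y) = c *\<^sub>R (x \<odot> y)"
  by (simp add: cl_mult_def scaleR_sum_right mult_ac)

lemma cl_mult_sum_left: "(\<Sum>i\<in>I. f i) \<odot> y = (\<Sum>i\<in>I. f i \<odot> y)"
proof -
  have "0 \<odot> y = 0" by (simp add: cl_mult_def)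
  then show ?thesis
    by (induction I rule: infinite_finite_induct) (simp_all add: cl_mult_add_left)
qed

lemma cl_mult_sum_right: "x \<odot> (\<Sum>i\<in>I. f i) = (\<Sum>i\<in>I. x \<odot> f i)"
proof -
  have "x \<odot> 0 = 0" by (simp add: cl_mult_def)
  then show ?thesis
    by (induction I rule: infinite_finite_induct) (simp_all add: cl_mult_add_right)
qed

lemma cl_mult_axis: "axis A 1 \<odot> axis B 1 = cl_sign A B *\<^sub>R axis (sym_diff A B) 1"
proof -
  have eq: "(axis A 1 $ A' * axis B 1 $ B' * cl_sign A' B') *\<^sub>R axis (sym_diff A' B') 1 =
     (if A' = A then if B' = B then cl_sign A B *\<^sub>R axis (sym_diff A B) 1 else 0 else 0)"
    for A' B' :: "'a set"
    by (auto simp: axis_def)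
  show ?thesis
    unfolding cl_mult_def eq by (subst sum.swap) simp
qed

lemma clifford_expand: "(x :: 'n::{finite,linorder} clifford) = (\<Sum>A\<in>UNIV. x $ A *\<^sub>R axis A 1)"
  by (simp add: vec_eq_iff axis_def if_distrib cong: if_cong)

lemma prod_sym_diff:
  fixes g :: "'a::finite \<Rightarrow> real"
  assumes "\<And>a. g a * g a = 1"
  shows "prod g (sym_diff A B) = prod g A * prod g B"
proof -
  have 1: "prod g (A \<inter> B) * prod g (A \<inter> B) = 1"
    using assms by (simp flip: prod.distrib)
  have "prod g A = prod g (A - B) * prod g (A \<inter> B)" "prod g B = prod g (B - A) * prod g (A \<inter> B)"
    by (subst prod.union_disjoint[symmetric]; auto intro: arg_cong[where f = "prod g"])+
  moreover have "prod g (sym_diff A B) = prod g (A - B) * prod g (B - A)"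
    by (rule prod.union_disjoint) auto
  ultimately show ?thesis
    using 1 by simp
qed

lemma cl_sign_square: "cl_sign A B * cl_sign A B = 1"
  unfolding cl_sign_def by (simp flip: prod.distrib) (simp add: if_distrib cong: if_cong)

lemma cl_sign_sym_diff_left: "cl_sign (sym_diff A B) C = cl_sign A C * cl_sign B C"
  unfolding cl_sign_def
  by (rule prod_sym_diff) (simp flip: prod.distrib, simp add: if_distrib cong: if_cong)

lemma cl_sign_sym_diff_right: "cl_sign A (sym_diff B C) = cl_sign A B * cl_sign A C"
proof -
  have "(\<Prod>b\<in>sym_diff B C. if b \<le> a then -1 else 1) =
     (\<Prod>b\<in>B. if b \<le> a then -1 else 1 :: real) * (\<Prod>b\<in>C. if b \<le> a then -1 else 1)" for a
    by (rule prod_sym_diff) auto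
  then show ?thesis
    unfolding cl_sign_def by (simp add: prod.distrib)
qed

lemma cl_mult_axis_assoc:
  "(axis A 1 \<odot> axis B 1) \<odot> axis C 1 = axis A 1 \<odot> (axis B 1 \<odot> axis C 1)"
proof -
  have "sym_diff (sym_diff A B) C = sym_diff A (sym_diff B C)"
    by auto
  then show ?thesis
    by (simp only: cl_mult_axis cl_mult_scaleR_left cl_mult_scaleR_right
        cl_sign_sym_diff_left cl_sign_sym_diff_right scaleR_scaleR mult_ac)
qed

lemma cl_mult_assoc: "(x \<odot> y) \<odot> z = x \<odot> (y \<odot> z)"
  apply (subst (1 2) clifford_expand[of x], subst (1 2) clifford_expand[of y],
         subst (1 2) clifford_expand[of z])
  apply (simp only: cl_mult_sum_left cl_mult_sum_right cl_mult_scaleR_left cl_mult_scaleR_right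
      cl_mult_axis_assoc)
  done

lemma cl_mult_one_left: "cl_one \<odot> x = x"
proof -
  have "axis {} 1 \<odot> axis A 1 = axis A 1" for A :: "'a set"
    by (simp add: cl_mult_axis cl_sign_def)
  then show ?thesis
    unfolding cl_one_def
    by (subst (1 2) clifford_expand[of x])
      (simp only: cl_mult_sum_right cl_mult_scaleR_right)
qed

lemma cl_mult_one_right: "x \<odot> cl_one = x"
proof -
  have "axis A 1 \<odot> axis {} 1 = axis A 1" for A :: "'a set"
    by (simp add: cl_mult_axis cl_sign_def)
  then show ?thesis
    unfolding cl_one_def
    by (subst (1 2) clifford_expand[of x])
      (simp only: cl_mult_sum_left cl_mult_scaleR_left)
qed

lemma cl_gen_square: "cl_gen i \<odot> cl_gen i = - cl_one"
  by (simp add: cl_gen_def cl_one_def cl_mult_axis cl_sign_def)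

lemma cl_gen_anticommute: "i \<noteq> j \<Longrightarrow> cl_gen i \<odot> cl_gen j = - (cl_gen j \<odot> cl_gen i)"
  by (auto simp: cl_gen_def cl_mult_axis cl_sign_def insert_Diff_if Un_commute)

lemma cl_prod_sorted: "cl_prod (map cl_gen (sorted_list_of_set A)) = axis A 1"
proof -
  have "cl_prod (map cl_gen xs) = axis (set xs) 1" if "sorted xs" "distinct xs" for xs :: "'a list"
    using that
  proof (induction xs)
    case (Cons a xs)
    then have "cl_sign {a} (set xs) = 1"
      by (auto simp: cl_sign_def intro!: prod.neutral)
    with Cons show ?case
      by (simp add: cl_prod_def cl_gen_def cl_mult_axis)
  qed (simp add: cl_prod_def cl_one_def)
  from this[of "sorted_list_of_set A"] show ?thesis
    by simp
qed

section \<open>Smooth functions and domains\<close>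

definition partial :: "'n \<Rightarrow> (real ^ 'n \<Rightarrow> real) \<Rightarrow> real ^ 'n \<Rightarrow> real" where
  "partial i f x = frechet_derivative f (at x) (axis i 1)"

text \<open>Only used for open \<open>S\<close>.\<close>

primrec Ck_on :: "nat \<Rightarrow> (real ^ 'n) set \<Rightarrow> (real ^ 'n \<Rightarrow> real) \<Rightarrow> bool" where
  "Ck_on 0 S f \<longleftrightarrow> continuous_on S f"
| "Ck_on (Suc k) S f \<longleftrightarrow> (\<forall>x\<in>S. f differentiable at x) \<and> (\<forall>i. Ck_on k S (partial i f))"

definition smooth_on :: "(real ^ 'n) set \<Rightarrow> (real ^ 'n \<Rightarrow> real) \<Rightarrow> bool" where
  "smooth_on S f \<longleftrightarrow> (\<forall>k. Ck_on k S f)"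

definition test_functions :: "(real ^ 'n) set \<Rightarrow> (real ^ 'n \<Rightarrow> real) set" where
  "test_functions \<Omega> = {\<phi>. smooth_on UNIV \<phi> \<and>
     compact (closure {x. \<phi> x \<noteq> 0}) \<and> closure {x. \<phi> x \<noteq> 0} \<subseteq> \<Omega>}"

text \<open>\<open>\<Omega>\<close> lies locally on one side of its boundary, and the boundary is locally the zero set of a
  smooth function without critical points.\<close>

definition smooth_boundary :: "(real ^ 'n) set \<Rightarrow> bool" where
  "smooth_boundary \<Omega> \<longleftrightarrow> (\<forall>p\<in>frontier \<Omega>. \<exists>U \<rho>. open U \<and> p \<in> U \<and> smooth_on U \<rho> \<and>
     (\<forall>x\<in>U. \<exists>i. partial i \<rho> x \<noteq> 0) \<and>
     \<Omega> \<inter> U = {x\<in>U. \<rho> x < 0} \<and> frontier \<Omega> \<inter> U = {x\<in>U. \<rho> x = 0})"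

section \<open>Surface measure\<close>

text \<open>Hausdorff measure of dimension \<open>d \<ge> 1\<close>, normalised so that it agrees with Lebesgue measure on
  \<open>d\<close>-dimensional planes. Boundedness of the covering sets is required because \<open>diameter\<close> is
  meaningless for unbounded sets.\<close>

definition hausdorff_pre :: "nat \<Rightarrow> real \<Rightarrow> 'a::metric_space set \<Rightarrow> ennreal" where
  "hausdorff_pre d \<delta> A =
     (INF C \<in> {C :: nat \<Rightarrow> 'a set. A \<subseteq> (\<Union>k. C k) \<and> (\<forall>k. bounded (C k) \<and> diameter (C k) \<le> \<delta>)}.
        \<Sum>k. ennreal (unit_ball_vol (real d) * (diameter (C k) / 2) ^ d))"

definition hausdorff_outer :: "nat \<Rightarrow> 'a::metric_space set \<Rightarrow> ennreal" where
  "hausdorff_outer d A = (SUP \<delta> \<in> {0<..}. hausdorff_pre d \<delta> A)"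

definition hausdorff_measure :: "nat \<Rightarrow> 'a::metric_space measure" where
  "hausdorff_measure d = measure_of UNIV (sets borel) (hausdorff_outer d)"

definition surface_measure :: "(real ^ 'n) set \<Rightarrow> (real ^ 'n) measure" where
  "surface_measure \<Omega> = completion (restrict_space (hausdorff_measure (CARD('n) - 1)) (frontier \<Omega>))"

definition Linfty :: "'a measure \<Rightarrow> ('a \<Rightarrow> real) set" where
  "Linfty M = {b \<in> borel_measurable M. esssup M (\<lambda>x. ereal \<bar>b x\<bar>) < \<infinity>}"

definition Linfty_norm :: "'a measure \<Rightarrow> ('a \<Rightarrow> real) \<Rightarrow> real" where
  "Linfty_norm M b = real_of_ereal (esssup M (\<lambda>x. ereal \<bar>b x\<bar>))"

section \<open>Scalar Sobolev space and Dirichlet trace\<close>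

text \<open>Elements of \<open>L\<^sup>2\<close> and \<open>H\<^sup>1\<close> are represented by functions; equality in these spaces is equality
  almost everywhere. Values outside the domain are irrelevant.\<close>

definition L2 :: "'a measure \<Rightarrow> ('a \<Rightarrow> real) set" where
  "L2 M = {u \<in> borel_measurable M. integrable M (\<lambda>x. (u x)\<^sup>2)}"

definition L2_norm :: "'a measure \<Rightarrow> ('a \<Rightarrow> real) \<Rightarrow> real" where
  "L2_norm M u = sqrt (LINT x|M. (u x)\<^sup>2)"

definition is_weak_partial ::
    "(real ^ 'n) set \<Rightarrow> 'n \<Rightarrow> (real ^ 'n \<Rightarrow> real) \<Rightarrow> (real ^ 'n \<Rightarrow> real) \<Rightarrow> bool" where
  "is_weak_partial \<Omega> i u g \<longleftrightarrow> (\<forall>\<phi>\<in>test_functions \<Omega>.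
     (LINT x|lebesgue_on \<Omega>. u x * partial i \<phi> x) = - (LINT x|lebesgue_on \<Omega>. g x * \<phi> x))"

definition H1 :: "(real ^ 'n) set \<Rightarrow> (real ^ 'n \<Rightarrow> real) set" where
  "H1 \<Omega> = {u \<in> L2 (lebesgue_on \<Omega>). \<forall>i. \<exists>g\<in>L2 (lebesgue_on \<Omega>). is_weak_partial \<Omega> i u g}"

text \<open>The weak derivative is determined almost everywhere on \<open>\<Omega>\<close>.\<close>

definition weak_partial ::
    "(real ^ 'n) set \<Rightarrow> 'n \<Rightarrow> (real ^ 'n \<Rightarrow> real) \<Rightarrow> real ^ 'n \<Rightarrow> real" where
  "weak_partial \<Omega> i u = (SOME g. g \<in> L2 (lebesgue_on \<Omega>) \<and> is_weak_partial \<Omega> i u g)"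

definition H1_norm :: "(real ^ 'n) set \<Rightarrow> (real ^ 'n \<Rightarrow> real) \<Rightarrow> real" where
  "H1_norm \<Omega> u = sqrt ((L2_norm (lebesgue_on \<Omega>) u)\<^sup>2 +
     (\<Sum>i\<in>UNIV. (L2_norm (lebesgue_on \<Omega>) (weak_partial \<Omega> i u))\<^sup>2))"

text \<open>\<open>\<tau>\<close> is the bounded linear extension of the restriction \<open>u \<mapsto> u|\<^bsub>\<partial>\<Omega>\<^esub>\<close> of functions smooth up to the
  boundary. As these are dense in \<open>H\<^sup>1(\<Omega>)\<close> for smooth bounded \<open>\<Omega>\<close>, this determines \<open>\<tau> u\<close>
  almost everywhere on the boundary; existence is the classical trace theorem.\<close>

definition dirichlet_trace ::
    "(real ^ 'n) set \<Rightarrow> ((real ^ 'n \<Rightarrow> real) \<Rightarrow> (real ^ 'n \<Rightarrow> real)) \<Rightarrow> bool" where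
  "dirichlet_trace \<Omega> \<tau> \<longleftrightarrow>
     (\<forall>u\<in>H1 \<Omega>. \<tau> u \<in> L2 (surface_measure \<Omega>)) \<and>
     (\<forall>u\<in>H1 \<Omega>. \<forall>v\<in>H1 \<Omega>. \<forall>\<alpha> \<beta>. AE x in surface_measure \<Omega>.
        \<tau> (\<lambda>y. \<alpha> * u y + \<beta> * v y) x = \<alpha> * \<tau> u x + \<beta> * \<tau> v x) \<and>
     (\<exists>C. \<forall>u\<in>H1 \<Omega>. L2_norm (surface_measure \<Omega>) (\<tau> u) \<le> C * H1_norm \<Omega> u) \<and>
     (\<forall>u. smooth_on UNIV u \<longrightarrow> (AE x in surface_measure \<Omega>. \<tau> u x = u x))"

section \<open>Clifford-valued spaces\<close>

text \<open>The tensor product of a real function space with the Clifford algebra consists of the functions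
  whose components lie in that space; operators act componentwise.\<close>

definition L2_cl :: "'a measure \<Rightarrow> ('a \<Rightarrow> 'n::{finite,linorder} clifford) set" where
  "L2_cl M = {F. \<forall>A. (\<lambda>x. F x $ A) \<in> L2 M}"

definition H1_cl ::
    "'n rn set \<Rightarrow> ('n rn \<Rightarrow> 'n::{finite,linorder} clifford) set" where
  "H1_cl \<Omega> = {F. \<forall>A. (\<lambda>x. F x $ A) \<in> H1 \<Omega>}"

definition weak_partial_cl :: "'n rn set \<Rightarrow> 'n \<Rightarrow>
    ('n rn \<Rightarrow> 'n::{finite,linorder} clifford) \<Rightarrow> 'n rn \<Rightarrow> 'n clifford" where
  "weak_partial_cl \<Omega> i F x = (\<chi> A. weak_partial \<Omega> i (\<lambda>y. F y $ A) x)"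

definition trace_cl :: "(('n rn \<Rightarrow> real) \<Rightarrow> ('n rn \<Rightarrow> real)) \<Rightarrow>
    ('n rn \<Rightarrow> 'n::{finite,linorder} clifford) \<Rightarrow> 'n rn \<Rightarrow> 'n clifford" where
  "trace_cl \<tau> F x = (\<chi> A. \<tau> (\<lambda>y. F y $ A) x)"

definition inner_cl :: "'a measure \<Rightarrow> ('a \<Rightarrow> 'n::{finite,linorder} clifford) \<Rightarrow>
    ('a \<Rightarrow> 'n clifford) \<Rightarrow> 'n clifford" where
  "inner_cl M F G = (LINT x|M. cl_conj (F x) \<odot> G x)"

definition norm2_cl :: "'a measure \<Rightarrow> ('a \<Rightarrow> 'n::{finite,linorder} clifford) \<Rightarrow> real" where
  "norm2_cl M F = sqrt (Sc (inner_cl M F F))"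

definition normD_cl ::
    "'n rn set \<Rightarrow> ('n rn \<Rightarrow> 'n::{finite,linorder} clifford) \<Rightarrow> real" where
  "normD_cl \<Omega> F = sqrt (\<Sum>i\<in>UNIV. (norm2_cl (lebesgue_on \<Omega>) (weak_partial_cl \<Omega> i F))\<^sup>2)"

definition normH1_cl ::
    "'n rn set \<Rightarrow> ('n rn \<Rightarrow> 'n::{finite,linorder} clifford) \<Rightarrow> real" where
  "normH1_cl \<Omega> F = sqrt ((norm2_cl (lebesgue_on \<Omega>) F)\<^sup>2 + (normD_cl \<Omega> F)\<^sup>2)"

definition trace_norm :: "('n::{finite,linorder} rn) set \<Rightarrow>
    (('n rn \<Rightarrow> real) \<Rightarrow> ('n rn \<Rightarrow> real)) \<Rightarrow> real" where
  "trace_norm \<Omega> \<tau> = (SUP F \<in> {F \<in> H1_cl \<Omega>. normH1_cl \<Omega> F \<le> 1}.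
     norm2_cl (surface_measure \<Omega>) (trace_cl \<tau> F))"

section \<open>The Robin form of the spherical Dirac operator\<close>

definition dirac_e :: "'n rn set \<Rightarrow>
    ('n rn \<Rightarrow> 'n::{finite,linorder} clifford) \<Rightarrow> 'n rn \<Rightarrow> 'n clifford" where
  "dirac_e \<Omega> F x = (\<Sum>i\<in>UNIV. cl_gen i \<odot> weak_partial_cl \<Omega> i F x)"

definition euler :: "'n rn set \<Rightarrow>
    ('n rn \<Rightarrow> 'n::{finite,linorder} clifford) \<Rightarrow> 'n rn \<Rightarrow> 'n clifford" where
  "euler \<Omega> F x = (\<Sum>i\<in>UNIV. x $ i *\<^sub>R weak_partial_cl \<Omega> i F x)"

definition dirac_S :: "'n rn set \<Rightarrow>
    ('n rn \<Rightarrow> 'n::{finite,linorder} clifford) \<Rightarrow> 'n rn \<Rightarrow> 'n clifford" where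
  "dirac_S \<Omega> F x = (1 + (norm x)\<^sup>2) *\<^sub>R dirac_e \<Omega> F x - real CARD('n) *\<^sub>R (cl_vec x \<odot> F x)"

definition robin_form :: "'n rn set \<Rightarrow> ('n rn \<Rightarrow> real) \<Rightarrow>
    (('n rn \<Rightarrow> real) \<Rightarrow> ('n rn \<Rightarrow> real)) \<Rightarrow> 'n clifford \<Rightarrow>
    ('n rn \<Rightarrow> 'n clifford) \<Rightarrow> ('n rn \<Rightarrow> 'n clifford) \<Rightarrow>
    'n::{finite,linorder} clifford" where
  "robin_form \<Omega> b \<tau> s F G =
     (\<Sum>i\<in>UNIV. inner_cl (lebesgue_on \<Omega>)
        (\<lambda>x. (1 + (norm x)\<^sup>2)\<^sup>2 *\<^sub>R weak_partial_cl \<Omega> i F x) (weak_partial_cl \<Omega> i G))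
   + (2 * (2 + real CARD('n))) *\<^sub>R
        inner_cl (lebesgue_on \<Omega>) (\<lambda>x. (1 + (norm x)\<^sup>2) *\<^sub>R euler \<Omega> F x) G
   + 2 *\<^sub>R inner_cl (lebesgue_on \<Omega>) (\<lambda>x. (1 + (norm x)\<^sup>2) *\<^sub>R (cl_vec x \<odot> dirac_e \<Omega> F x)) G
   - (2 * Sc s) *\<^sub>R inner_cl (lebesgue_on \<Omega>) (dirac_S \<Omega> F) G
   + ((norm s)\<^sup>2 + (real CARD('n))\<^sup>2) *\<^sub>R inner_cl (lebesgue_on \<Omega>) F G
   + inner_cl (surface_measure \<Omega>) (\<lambda>x. b x *\<^sub>R trace_cl \<tau> F x) (trace_cl \<tau> G)"

definition robin_solution :: "'n rn set \<Rightarrow> ('n rn \<Rightarrow> real) \<Rightarrow>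
    (('n rn \<Rightarrow> real) \<Rightarrow> ('n rn \<Rightarrow> real)) \<Rightarrow> 'n clifford \<Rightarrow>
    ('n rn \<Rightarrow> 'n clifford) \<Rightarrow> ('n rn \<Rightarrow> 'n::{finite,linorder} clifford) \<Rightarrow> bool" where
  "robin_solution \<Omega> b \<tau> s f F \<longleftrightarrow> F \<in> H1_cl \<Omega> \<and>
     (\<forall>G\<in>H1_cl \<Omega>. robin_form \<Omega> b \<tau> s F G = inner_cl (lebesgue_on \<Omega>) f G)"

end

theory Submission
  imports Defs
begin

text \<open>The equation is solved by the Lax-Milgram theorem in \<open>H\<^sup>1\<close>, applied to the scalar part of the
  Robin form; the constant \<open>H\<close> is the coercivity constant of that form.

  Pointwise, \<open>\<bar>x F\<bar> = \<bar>x\<bar> \<bar>F\<bar>\<close> for vectors \<open>x\<close>, \<open>\<bar>E F\<bar> \<le> \<bar>x\<bar> \<bar>\<nabla>F\<bar>\<close> and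
  \<open>\<bar>D\<^sub>e F\<bar> \<le> \<surd>n \<bar>\<nabla>F\<bar>\<close> (\<open>robin_low_bound\<close>). With \<open>p = \<parallel>F\<parallel>\<^sub>D\<close> and \<open>q = \<parallel>F\<parallel>\<^sub>2\<close> the Cauchy-Schwarz inequality gives
  \<open>Sc q(F, F) \<ge> a p\<^sup>2 - 2 c p q + d q\<^sup>2\<close>, where
  \<open>a = (1 + m\<^sup>2)\<^sup>2 - K\<close>, \<open>d = \<bar>s\<bar>\<^sup>2 + n\<^sup>2 - 2 \<bar>s\<^sub>0\<bar> n M - K\<close>,
  \<open>c = \<surd>n (1 + M\<^sup>2) ((3 + n) M + \<bar>s\<^sub>0\<bar>)\<close> and \<open>K = 2\<^sup>n\<^sup>/\<^sup>2 \<beta> T\<^sup>2\<close>; the term \<open>- K (p\<^sup>2 + q\<^sup>2)\<close> absorbs the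
  boundary integral by the trace inequality (\<open>robin_scalar_form_lower_bound\<close>). The two numerical
  hypotheses say that the symmetric matrix with diagonal \<open>a, d\<close> and off-diagonal entry \<open>-c\<close> has
  positive trace and determinant, and \<open>H\<close> is its smallest eigenvalue
  (\<open>symmetric_matrix_lower_bound\<close>). Testing the equation with its solution yields
  \<open>H (p\<^sup>2 + q\<^sup>2) \<le> \<parallel>f\<parallel>\<^sub>2 q\<close>, which contains both norm estimates.

  The scalar equation suffices: replacing \<open>G\<close> by \<open>G e\<^sub>C\<close> multiplies both sides of the Clifford-valued
  equation by \<open>e\<^sub>C\<close> from the right, and the scalar parts of the products \<open>z e\<^sub>C\<close> determine \<open>z\<close>
  (\<open>robin_solution_exists\<close>).

  Functions that agree almost everywhere are not identified, and weak derivatives are chosen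
  representatives. Linearity of the form and completeness of \<open>H\<^sup>1\<close> (\<open>H1_complete\<close>) therefore rest on
  the almost everywhere uniqueness of weak derivatives, that is, on the fundamental lemma of the
  calculus of variations (\<open>weak_partial_unique\<close>). The test functions used there are products of
  functions \<open>exp (-1/(k t))\<close> of one coordinate, which converge to indicators of boxes as \<open>k\<close> grows.\<close>

section \<open>The Lax-Milgram theorem\<close>

lemma quadratic_nonneg_imp_discriminant:
  fixes a b c :: real
  assumes "\<And>t. 0 \<le> a * t\<^sup>2 + 2 * b * t + c" and "0 \<le> a"
  shows "b\<^sup>2 \<le> a * c"
proof (cases "a = 0")
  case True
  have "b = 0"
  proof (rule ccontr)
    assume "b \<noteq> 0"
    with assms(1)[of "- (c + 1) / (2 * b)"] True show False
      by simp
  qed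
  with True show ?thesis
    by simp
next
  case False
  with assms(2) have "0 < a" by simp
  with mult_left_mono[OF assms(1)[of "- b / a"], of a] show ?thesis
    by (simp add: field_simps power2_eq_square)
qed

text \<open>A set \<open>V\<close> of vectors on which \<open>lin u c v\<close> plays the role of \<open>u + c v\<close>, with a complete
  positive semidefinite form \<open>ip\<close>. No vector space axioms are required of \<open>lin\<close>: every argument is
  about the values of bilinear forms only. Neither is definiteness, so that \<open>V\<close> may consist of
  functions that are identified only almost everywhere.\<close>

locale semi_hilbert =
  fixes V :: "'v set" and lin :: "'v \<Rightarrow> real \<Rightarrow> 'v \<Rightarrow> 'v" and ip :: "'v \<Rightarrow> 'v \<Rightarrow> real"
  assumes V_nonempty: "V \<noteq> {}"
    and lin_in_V: "\<lbrakk>u \<in> V; v \<in> V\<rbrakk> \<Longrightarrow> lin u c v \<in> V"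
    and ip_commute: "\<lbrakk>u \<in> V; v \<in> V\<rbrakk> \<Longrightarrow> ip u v = ip v u"
    and ip_lin_left: "\<lbrakk>u \<in> V; v \<in> V; w \<in> V\<rbrakk> \<Longrightarrow> ip (lin u c v) w = ip u w + c * ip v w"
    and ip_nonneg: "u \<in> V \<Longrightarrow> 0 \<le> ip u u"
    and complete: "\<lbrakk>\<And>k. U k \<in> V;
        \<And>e. 0 < e \<Longrightarrow> \<exists>N. \<forall>j\<ge>N. \<forall>k\<ge>N. ip (lin (U j) (-1) (U k)) (lin (U j) (-1) (U k)) < e\<rbrakk>
      \<Longrightarrow> \<exists>w\<in>V. (\<lambda>k. ip (lin (U k) (-1) w) (lin (U k) (-1) w)) \<longlonglongrightarrow> 0"
begin

lemma ip_lin_right: "\<lbrakk>u \<in> V; v \<in> V; w \<in> V\<rbrakk> \<Longrightarrow> ip w (lin u c v) = ip w u + c * ip w v"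
  by (simp add: ip_commute[of w] lin_in_V ip_lin_left)

lemma ip_lin_lin:
  "\<lbrakk>u \<in> V; v \<in> V\<rbrakk> \<Longrightarrow> ip (lin u c v) (lin u c v) = ip u u + 2 * c * ip u v + c\<^sup>2 * ip v v"
  by (simp add: ip_lin_left ip_lin_right lin_in_V ip_commute[of v u] algebra_simps power2_eq_square)

lemma Cauchy_Schwarz:
  assumes "u \<in> V" "v \<in> V"
  shows "(ip u v)\<^sup>2 \<le> ip u u * ip v v"
proof -
  have "0 \<le> ip v v * t\<^sup>2 + 2 * ip u v * t + ip u u" for t
    using ip_nonneg[OF lin_in_V[OF assms, of t]] assms by (simp add: ip_lin_lin algebra_simps)
  from quadratic_nonneg_imp_discriminant[OF this ip_nonneg[OF assms(2)]] show ?thesis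
    by (simp add: mult.commute)
qed

text \<open>Convergence in the seminorm implies weak convergence.\<close>

lemma ip_tendsto:
  assumes "\<And>k. U k \<in> V" "w \<in> V" "v \<in> V"
    and "(\<lambda>k. ip (lin (U k) (-1) w) (lin (U k) (-1) w)) \<longlonglongrightarrow> 0"
  shows "(\<lambda>k. ip (U k) v) \<longlonglongrightarrow> ip w v"
proof -
  have "(\<lambda>k. (ip (U k) v - ip w v)\<^sup>2) \<longlonglongrightarrow> 0"
  proof (rule tendsto_sandwich[where f = "\<lambda>_. 0"])
    show "(\<lambda>k. ip (lin (U k) (-1) w) (lin (U k) (-1) w) * ip v v) \<longlonglongrightarrow> 0"
      using tendsto_mult_right[OF assms(4), of "ip v v"] by simp
    show "\<forall>\<^sub>F k in sequentially. (ip (U k) v - ip w v)\<^sup>2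
        \<le> ip (lin (U k) (-1) w) (lin (U k) (-1) w) * ip v v"
      using Cauchy_Schwarz[OF lin_in_V[OF assms(1,2)] assms(3), of _ "-1"]
      by (simp add: ip_lin_left assms)
  qed auto
  from tendsto_real_sqrt[OF this] have "(\<lambda>k. ip (U k) v - ip w v) \<longlonglongrightarrow> 0"
    by (simp add: tendsto_rabs_zero_iff)
  then show ?thesis
    by (simp add: LIM_zero_iff)
qed

text \<open>The Riesz representation theorem: a minimizing sequence of \<open>u \<mapsto> ip u u - 2 l u\<close> is Cauchy by
  the parallelogram identity, and its limit represents \<open>l\<close>.\<close>

lemma Riesz_representation:
  assumes l_lin: "\<And>u v c. \<lbrakk>u \<in> V; v \<in> V\<rbrakk> \<Longrightarrow> l (lin u c v) = l u + c * l v"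
    and l_bounded: "\<And>v. v \<in> V \<Longrightarrow> \<bar>l v\<bar> \<le> C * sqrt (ip v v)"
  obtains r where "r \<in> V" "\<And>v. v \<in> V \<Longrightarrow> ip r v = l v"
proof -
  define J where "J u = ip u u - 2 * l u" for u
  have J_ge: "- C\<^sup>2 \<le> J u" if "u \<in> V" for u
  proof -
    have "0 \<le> (sqrt (ip u u) - C)\<^sup>2" by simp
    with l_bounded[OF that] ip_nonneg[OF that] show ?thesis
      by (simp add: J_def power2_diff algebra_simps)
  qed
  define d where "d = (INF u\<in>V. J u)"
  have bdd: "bdd_below (J ` V)"
    using J_ge by (auto simp: bdd_below_def)
  have d_le: "d \<le> J u" if "u \<in> V" for u
    unfolding d_def using bdd that by (rule cINF_lower)
  have "\<exists>u\<in>V. J u < d + 1 / real (Suc k)" for k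
  proof -
    have "(INF u\<in>V. J u) < d + 1 / real (Suc k)"
      by (simp add: d_def)
    then show ?thesis
      using bdd V_nonempty by (simp add: cINF_less_iff)
  qed
  then obtain U where UV: "\<And>k. U k \<in> V" and UJ: "\<And>k. J (U k) < d + 1 / real (Suc k)"
    by metis
  have par: "ip (lin u (-1) v) (lin u (-1) v) \<le> 2 * (J u - d) + 2 * (J v - d)"
    if "u \<in> V" "v \<in> V" for u v
  proof -
    \<comment> \<open>the midpoint \<open>(u + v) / 2\<close>\<close>
    let ?w = "lin (lin u (-1/2) u) (1/2) v"
    have "J ?w = (J u + J v) / 2 - ip (lin u (-1) v) (lin u (-1) v) / 4"
      using that by (simp add: J_def ip_lin_left ip_lin_right lin_in_V l_lin ip_commute[of v u]
          field_simps)
    moreover have "d \<le> J ?w"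
      using that by (intro d_le lin_in_V)
    ultimately show ?thesis by (simp add: field_simps)
  qed
  have "\<exists>N. \<forall>j\<ge>N. \<forall>k\<ge>N. ip (lin (U j) (-1) (U k)) (lin (U j) (-1) (U k)) < e" if "0 < e" for e
  proof -
    have "0 < e / 4"
      using that by simp
    then obtain N where N: "1 / real (Suc N) < e / 4"
      by (rule nat_approx_posE)
    have near: "J (U k) - d < e / 4" if "N \<le> k" for k
    proof -
      have "1 / real (Suc k) \<le> 1 / real (Suc N)"
        using that by (intro divide_left_mono) auto
      with UJ[of k] N show ?thesis by linarith
    qed
    have "2 * (J (U j) - d) + 2 * (J (U k) - d) < e" if "N \<le> j" "N \<le> k" for j k
      using add_strict_mono[OF near[OF that(1)] near[OF that(2)]] by (simp add: field_simps)
    then show ?thesis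
      by (intro exI[of _ N] allI impI le_less_trans[OF par[OF UV UV]])
  qed
  from complete[OF UV this] obtain r where r: "r \<in> V"
    and lim: "(\<lambda>k. ip (lin (U k) (-1) r) (lin (U k) (-1) r)) \<longlonglongrightarrow> 0"
    by blast
  have "ip r v = l v" if v: "v \<in> V" for v
  proof -
    have bound: "(ip (U k) v - l v)\<^sup>2 \<le> ip v v * (1 / real (Suc k))" for k
    proof (rule quadratic_nonneg_imp_discriminant)
      fix t
      have "J (lin (U k) t v) = J (U k) + 2 * t * (ip (U k) v - l v) + t\<^sup>2 * ip v v"
        using UV v by (simp add: J_def ip_lin_lin l_lin algebra_simps)
      moreover have "d \<le> J (lin (U k) t v)"
        by (intro d_le lin_in_V UV v)
      ultimately show "0 \<le> ip v v * t\<^sup>2 + 2 * (ip (U k) v - l v) * t + 1 / real (Suc k)"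
        using UJ[of k] by (simp add: algebra_simps)
    qed (rule ip_nonneg[OF v])
    have "(\<lambda>k. (ip (U k) v - l v)\<^sup>2) \<longlonglongrightarrow> (ip r v - l v)\<^sup>2"
      by (intro tendsto_intros ip_tendsto[OF UV r v lim])
    moreover have "(\<lambda>k. (ip (U k) v - l v)\<^sup>2) \<longlonglongrightarrow> 0"
    proof (rule tendsto_sandwich[where f = "\<lambda>_. 0"])
      show "(\<lambda>k. ip v v * (1 / real (Suc k))) \<longlonglongrightarrow> 0"
        using tendsto_mult_right_zero[OF LIMSEQ_Suc[OF lim_1_over_n], of "ip v v"] by simp
    qed (use bound in auto)
    ultimately have "(ip r v - l v)\<^sup>2 = 0"
      by (rule LIMSEQ_unique)
    then show ?thesis by simp
  qed
  with r show ?thesis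
    by (rule that)
qed

text \<open>The solution is the fixed point of \<open>u \<mapsto> u + \<rho> (w - R u)\<close>, where \<open>w\<close> represents \<open>l\<close> and \<open>R u\<close>
  represents \<open>B u\<close>; the choice \<open>\<rho> = \<alpha> / D\<^sup>2\<close>, with
  \<open>D\<close> the larger of \<open>C\<close> and \<open>\<alpha>\<close>, makes this map a contraction.\<close>

theorem Lax_Milgram:
  assumes B_lin_left: "\<And>u v w c. \<lbrakk>u \<in> V; v \<in> V; w \<in> V\<rbrakk> \<Longrightarrow> B (lin u c v) w = B u w + c * B v w"
    and B_lin_right: "\<And>u v w c. \<lbrakk>u \<in> V; v \<in> V; w \<in> V\<rbrakk> \<Longrightarrow> B w (lin u c v) = B w u + c * B w v"
    and B_bounded: "\<And>u v. \<lbrakk>u \<in> V; v \<in> V\<rbrakk> \<Longrightarrow> \<bar>B u v\<bar> \<le> C * sqrt (ip u u) * sqrt (ip v v)"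
    and B_coercive: "\<And>u. u \<in> V \<Longrightarrow> \<alpha> * ip u u \<le> B u u" and "0 < \<alpha>"
    and l_lin: "\<And>u v c. \<lbrakk>u \<in> V; v \<in> V\<rbrakk> \<Longrightarrow> l (lin u c v) = l u + c * l v"
    and l_bounded: "\<And>v. v \<in> V \<Longrightarrow> \<bar>l v\<bar> \<le> K * sqrt (ip v v)"
  obtains u where "u \<in> V" "\<And>v. v \<in> V \<Longrightarrow> B u v = l v"
proof -
  \<comment> \<open>nothing is assumed about the sign of \<open>C\<close>; moreover \<open>\<alpha> \<le> D\<close> makes the contraction factor nonnegative\<close>
  define D where "D = max C \<alpha>"
  have D: "0 < D" "\<alpha> \<le> D"
    using \<open>0 < \<alpha>\<close> by (auto simp: D_def)
  have B_bounded': "\<bar>B u v\<bar> \<le> D * sqrt (ip u u) * sqrt (ip v v)" if "u \<in> V" "v \<in> V" for u v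
  proof -
    have "C * (sqrt (ip u u) * sqrt (ip v v)) \<le> D * (sqrt (ip u u) * sqrt (ip v v))"
      using that by (intro mult_right_mono) (auto simp: D_def ip_nonneg)
    with B_bounded[OF that] show ?thesis by (simp add: mult.assoc)
  qed
  have "\<exists>r\<in>V. \<forall>v\<in>V. ip r v = B u v" if "u \<in> V" for u
    using Riesz_representation[of "B u" "D * sqrt (ip u u)"] B_bounded'[OF that] that
    by (metis B_lin_right)
  then obtain R where RV: "\<And>u. u \<in> V \<Longrightarrow> R u \<in> V" and R: "\<And>u v. \<lbrakk>u \<in> V; v \<in> V\<rbrakk> \<Longrightarrow> ip (R u) v = B u v"
    by metis
  obtain w where wV: "w \<in> V" and w: "\<And>v. v \<in> V \<Longrightarrow> ip w v = l v"
    using Riesz_representation[OF l_lin l_bounded] by metis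
  define \<rho> where "\<rho> = \<alpha> / D\<^sup>2"
  define q where "q = 1 - \<alpha>\<^sup>2 / D\<^sup>2"
  have "\<alpha>\<^sup>2 \<le> D\<^sup>2"
    using \<open>0 < \<alpha>\<close> D by (intro power_mono) auto
  then have q: "0 \<le> q" "q < 1"
    using D \<open>0 < \<alpha>\<close> by (auto simp: q_def)
  define P where "P u = lin u \<rho> (lin w (-1) (R u))" for u
  have PV: "P u \<in> V" if "u \<in> V" for u
    unfolding P_def using that by (intro lin_in_V wV RV)
  have P_ip: "ip (P u) v = ip u v + \<rho> * (l v - B u v)" if "u \<in> V" "v \<in> V" for u v
    using that by (simp add: P_def ip_lin_left lin_in_V wV RV w R algebra_simps)
  define N where "N u v = ip (lin u (-1) v) (lin u (-1) v)" for u v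
  have N_nonneg: "0 \<le> N u v" if "u \<in> V" "v \<in> V" for u v
    unfolding N_def using that by (intro ip_nonneg lin_in_V)
  have contr: "N (P u) (P v) \<le> q * N u v" if u: "u \<in> V" and v: "v \<in> V" for u v
  proof -
    let ?d = "lin u (-1) v" let ?r = "lin (R u) (-1) (R v)"
    have dV: "?d \<in> V" "?r \<in> V"
      using u v by (auto intro: lin_in_V RV)
    have r_ip: "ip ?r x = B ?d x" if "x \<in> V" for x
      using that u v by (simp add: ip_lin_left RV R B_lin_left)
    have diff: "ip (lin (P u) (-1) (P v)) x = ip ?d x - \<rho> * ip ?r x" if "x \<in> V" for x
      using that u v by (simp add: ip_lin_left PV P_ip r_ip B_lin_left algebra_simps)
    have "N (P u) (P v) = ip ?d (lin (P u) (-1) (P v)) - \<rho> * ip ?r (lin (P u) (-1) (P v))"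
      unfolding N_def by (rule diff) (intro lin_in_V PV u v)
    also have "\<dots> = ip (lin (P u) (-1) (P v)) ?d - \<rho> * ip (lin (P u) (-1) (P v)) ?r"
      using dV by (simp add: ip_commute lin_in_V PV u v)
    also have "\<dots> = ip ?d ?d - 2 * \<rho> * ip ?r ?d + \<rho>\<^sup>2 * ip ?r ?r"
      by (simp only: diff dV ip_commute[OF dV(1) dV(2)]) (simp add: algebra_simps power2_eq_square)
    finally have eq: "N (P u) (P v) = ip ?d ?d - 2 * \<rho> * ip ?r ?d + \<rho>\<^sup>2 * ip ?r ?r" .
    have "\<alpha> * ip ?d ?d \<le> ip ?r ?d"
      using B_coercive[OF dV(1)] r_ip[OF dV(1)] by simp
    then have 1: "2 * \<rho> * (\<alpha> * ip ?d ?d) \<le> 2 * \<rho> * ip ?r ?d"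
      using \<open>0 < \<alpha>\<close> D by (intro mult_left_mono) (auto simp: \<rho>_def)
    have "ip ?r ?r \<le> D * sqrt (ip ?d ?d) * sqrt (ip ?r ?r)"
      using B_bounded'[OF dV] r_ip[OF dV(2)] by simp
    then have *: "sqrt (ip ?r ?r) * sqrt (ip ?r ?r) \<le> (D * sqrt (ip ?d ?d)) * sqrt (ip ?r ?r)"
      using ip_nonneg[OF dV(2)] by simp
    have "sqrt (ip ?r ?r) \<le> D * sqrt (ip ?d ?d)"
    proof (cases "sqrt (ip ?r ?r) = 0")
      case True
      then show ?thesis
        using D ip_nonneg[OF dV(1)] by simp
    next
      case False
      then have "0 < sqrt (ip ?r ?r)"
        using ip_nonneg[OF dV(2)] by simp
      with * show ?thesis
        by (rule mult_right_le_imp_le)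
    qed
    then have "(sqrt (ip ?r ?r))\<^sup>2 \<le> (D * sqrt (ip ?d ?d))\<^sup>2"
      by (intro power_mono) (auto simp: ip_nonneg dV)
    then have "ip ?r ?r \<le> D\<^sup>2 * ip ?d ?d"
      by (simp add: power_mult_distrib ip_nonneg dV)
    then have 2: "\<rho>\<^sup>2 * ip ?r ?r \<le> \<rho>\<^sup>2 * (D\<^sup>2 * ip ?d ?d)"
      by (intro mult_left_mono) auto
    have 3: "\<rho>\<^sup>2 * (D\<^sup>2 * ip ?d ?d) = \<rho> * (\<alpha> * ip ?d ?d)" "\<rho> * (\<alpha> * ip ?d ?d) = (1 - q) * ip ?d ?d"
      using D by (simp_all add: \<rho>_def q_def power2_eq_square)
    have "N (P u) (P v) \<le> ip ?d ?d - (1 - q) * ip ?d ?d"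
      using 1 2 unfolding eq 3 by (simp add: mult.assoc 3)
    then show ?thesis
      by (simp add: N_def algebra_simps)
  qed
  obtain u0 where u0: "u0 \<in> V"
    using V_nonempty by blast
  define U where "U k = (P ^^ k) u0" for k
  have UV: "U k \<in> V" for k
    by (induction k) (auto simp: U_def u0 PV)
  have step: "N (U k) (U (k + j)) \<le> q ^ k * N u0 (U j)" for k j
  proof (induction k)
    case 0 then show ?case by (simp add: U_def)
  next
    case (Suc k)
    have "N (U (Suc k)) (U (Suc k + j)) \<le> q * N (U k) (U (k + j))"
      using contr[OF UV UV] by (simp add: U_def)
    also have "\<dots> \<le> q * (q ^ k * N u0 (U j))"
      using Suc q by (intro mult_left_mono)
    finally show ?case by simp
  qed
  \<comment> \<open>\<open>N\<close> is a squared distance, hence the square root in the triangle inequality\<close>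
  have tri: "sqrt (N x z) \<le> sqrt (N x y) + sqrt (N y z)" if "x \<in> V" "y \<in> V" "z \<in> V" for x y z
  proof -
    let ?a = "lin x (-1) y" let ?b = "lin y (-1) z"
    have ab: "?a \<in> V" "?b \<in> V" using that by (auto intro: lin_in_V)
    have "N x z = N x y + 2 * ip ?a ?b + N y z"
      using that by (simp add: N_def ip_lin_left ip_lin_right lin_in_V ip_commute[of y x]
          ip_commute[of z x] ip_commute[of z y])
    moreover have "ip ?a ?b \<le> sqrt (N x y) * sqrt (N y z)"
      using Cauchy_Schwarz[OF ab] by (simp add: N_def real_le_rsqrt flip: real_sqrt_mult)
    ultimately have "N x z \<le> (sqrt (N x y) + sqrt (N y z))\<^sup>2"
      using that by (simp add: power2_sum N_nonneg)
    then show ?thesis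
      using that by (intro real_le_lsqrt) (auto simp: N_nonneg)
  qed
  have sq1: "sqrt q < 1" "0 \<le> sqrt q"
    using q by auto
  \<comment> \<open>all iterates stay within distance \<open>E\<close> of \<open>u0\<close>, by the geometric series\<close>
  define E where "E = sqrt (N u0 (U 1)) / (1 - sqrt q)"
  have E0: "sqrt (N u0 (U j)) \<le> E" for j
  proof (induction j)
    case 0
    have "N u0 u0 = 0" using u0 by (simp add: N_def ip_lin_left ip_lin_right lin_in_V)
    then show ?case
      using sq1 by (simp add: U_def E_def N_nonneg u0 PV)
  next
    case (Suc j)
    have "N (U 1) (U (Suc j)) \<le> q * N u0 (U j)"
      using contr[OF u0 UV] by (simp add: U_def)
    then have "sqrt (N (U 1) (U (Suc j))) \<le> sqrt q * sqrt (N u0 (U j))"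
      by (simp flip: real_sqrt_mult)
    also have "\<dots> \<le> sqrt q * E"
      using Suc sq1 by (intro mult_left_mono) auto
    finally have "sqrt (N u0 (U (Suc j))) \<le> sqrt (N u0 (U 1)) + sqrt q * E"
      using tri[OF u0 UV UV, of "Suc j" 1] by linarith
    also have "\<dots> = E"
      using sq1 by (simp add: E_def field_simps)
    finally show ?case .
  qed
  have E: "N u0 (U j) \<le> E\<^sup>2" for j
    using E0[of j] by (rule sqrt_le_D)
  have cauchy: "\<exists>L. \<forall>j\<ge>L. \<forall>k\<ge>L. ip (lin (U j) (-1) (U k)) (lin (U j) (-1) (U k)) < e" if "0 < e" for e
  proof -
    have "(\<lambda>k. q ^ k * E\<^sup>2) \<longlonglongrightarrow> 0"
      using tendsto_mult_left_zero[OF LIMSEQ_realpow_zero[OF q]] by simp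
    from order_tendstoD(2)[OF this that] obtain L where L: "\<And>k. L \<le> k \<Longrightarrow> q ^ k * E\<^sup>2 < e"
      by (auto simp: eventually_sequentially)
    have one: "N (U k) (U j) < e" if "L \<le> k" "k \<le> j" for k j
    proof -
      have "N (U k) (U j) \<le> q ^ k * N u0 (U (j - k))"
        using step[of k "j - k"] that by simp
      also have "\<dots> \<le> q ^ k * E\<^sup>2"
        using q by (intro mult_left_mono E) auto
      finally show ?thesis using L[OF that(1)] by simp
    qed
    have sym: "N (U k) (U j) = N (U j) (U k)" for j k
      by (simp add: N_def ip_lin_lin UV ip_commute[OF UV UV, of j k])
    show ?thesis
      unfolding N_def[symmetric] by (metis one sym linear)
  qed
  from complete[OF UV this] obtain u where u: "u \<in> V"
    and lim: "(\<lambda>k. ip (lin (U k) (-1) u) (lin (U k) (-1) u)) \<longlonglongrightarrow> 0"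
    by blast
  have "B u v = l v" if v: "v \<in> V" for v
  proof -
    have "(\<lambda>k. N (P (U k)) (P u)) \<longlonglongrightarrow> 0"
    proof (rule tendsto_sandwich[where f = "\<lambda>_. 0"])
      show "(\<lambda>k. q * N (U k) u) \<longlonglongrightarrow> 0"
        using tendsto_mult_right_zero[OF lim, of q] by (simp add: N_def)
    qed (use contr UV u N_nonneg PV in auto)
    then have "(\<lambda>k. ip (U (Suc k)) v) \<longlonglongrightarrow> ip (P u) v"
      using ip_tendsto[of "\<lambda>k. P (U k)" "P u" v] u v UV PV by (simp add: N_def U_def)
    moreover have "(\<lambda>k. ip (U (Suc k)) v) \<longlonglongrightarrow> ip u v"
      using ip_tendsto[OF UV u v lim] by (rule LIMSEQ_Suc)
    ultimately have "ip (P u) v = ip u v"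
      by (rule LIMSEQ_unique)
    then show ?thesis
      using P_ip[OF u v] \<open>0 < \<alpha>\<close> D by (simp add: \<rho>_def)
  qed
  with u show ?thesis
    by (rule that)
qed

end

section \<open>Square integrable functions\<close>

text \<open>The space \<open>L\<^sup>2\<close> for functions with values in a Euclidean space.\<close>

definition square_integrable :: "'a measure \<Rightarrow> ('a \<Rightarrow> 'b::euclidean_space) \<Rightarrow> bool" where
  "square_integrable M F \<longleftrightarrow> F \<in> borel_measurable M \<and> integrable M (\<lambda>x. (norm (F x))\<^sup>2)"

lemma square_integrable_measurable [measurable_dest]:
  "square_integrable M F \<Longrightarrow> F \<in> borel_measurable M"
  by (simp add: square_integrable_def)

lemma L2_iff_square_integrable: "u \<in> L2 M \<longleftrightarrow> square_integrable M u"
  by (simp add: L2_def square_integrable_def)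

lemma square_integrableI_bound:
  fixes F :: "'a \<Rightarrow> 'b::euclidean_space"
  assumes "F \<in> borel_measurable M" "integrable M h" "AE x in M. (norm (F x))\<^sup>2 \<le> h x"
  shows "square_integrable M F"
  unfolding square_integrable_def
proof
  show "integrable M (\<lambda>x. (norm (F x))\<^sup>2)"
  proof (rule Bochner_Integration.integrable_bound[OF assms(2)])
    show "AE x in M. norm ((norm (F x))\<^sup>2) \<le> norm (h x)"
      using assms(3) by eventually_elim simp
  qed (use assms(1) in measurable)
qed (rule assms(1))

lemma square_integrable_dominated:
  assumes "square_integrable M F" "G \<in> borel_measurable M"
    and "AE x in M. norm (G x) \<le> K * norm (F x)"
  shows "square_integrable M G"
proof -
  have "AE x in M. (norm (G x))\<^sup>2 \<le> K\<^sup>2 * (norm (F x))\<^sup>2"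
    using assms(3)
  proof eventually_elim
    case (elim x)
    then have "(norm (G x))\<^sup>2 \<le> (K * norm (F x))\<^sup>2"
      by (intro power_mono) auto
    then show ?case by (simp add: power_mult_distrib)
  qed
  moreover have "integrable M (\<lambda>x. K\<^sup>2 * (norm (F x))\<^sup>2)"
    using assms(1) by (simp add: square_integrable_def)
  ultimately show ?thesis
    using square_integrableI_bound[OF assms(2)] by blast
qed

lemma square_integrable_scaleR:
  assumes "square_integrable M F"
  shows "square_integrable M (\<lambda>x. c *\<^sub>R F x)"
  using assms by (intro square_integrable_dominated[OF assms, where K = "\<bar>c\<bar>"])
    (auto simp: square_integrable_def)

lemma square_integrable_add:
  assumes "square_integrable M F" "square_integrable M G"
  shows "square_integrable M (\<lambda>x. F x + G x)"
proof -
  have "(norm (F x + G x))\<^sup>2 \<le> 2 * (norm (F x))\<^sup>2 + 2 * (norm (G x))\<^sup>2" for x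
  proof -
    have "(norm (F x + G x))\<^sup>2 \<le> (norm (F x) + norm (G x))\<^sup>2"
      by (intro power_mono norm_triangle_ineq) auto
    also have "\<dots> \<le> 2 * (norm (F x))\<^sup>2 + 2 * (norm (G x))\<^sup>2"
      using zero_le_power2[of "norm (F x) - norm (G x)"] by (simp add: power2_sum power2_diff)
    finally show ?thesis .
  qed
  moreover have "integrable M (\<lambda>x. 2 * (norm (F x))\<^sup>2 + 2 * (norm (G x))\<^sup>2)"
    using assms by (simp add: square_integrable_def)
  ultimately show ?thesis
    using assms by (intro square_integrableI_bound[of _ M "\<lambda>x. 2 * (norm (F x))\<^sup>2 + 2 * (norm (G x))\<^sup>2"])
      (auto simp: square_integrable_def)
qed

lemma square_integrable_lin:
  "\<lbrakk>square_integrable M F; square_integrable M G\<rbrakk> \<Longrightarrow> square_integrable M (\<lambda>x. F x + c *\<^sub>R G x)"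
  by (intro square_integrable_add square_integrable_scaleR)

lemma square_integrable_diff:
  assumes "square_integrable M F" "square_integrable M G"
  shows "square_integrable M (\<lambda>x. F x - G x)"
  using square_integrable_lin[OF assms, of "-1"] by simp

lemma L2_lin:
  "\<lbrakk>u \<in> L2 M; v \<in> L2 M\<rbrakk> \<Longrightarrow> (\<lambda>x. u x + c * v x) \<in> L2 M"
  using square_integrable_lin[of M u v c] by (simp add: L2_iff_square_integrable)

lemma square_integrable_sum:
  assumes "finite I" "\<And>i. i \<in> I \<Longrightarrow> square_integrable M (F i)"
  shows "square_integrable M (\<lambda>x. \<Sum>i\<in>I. F i x)"
  using assms
proof (induction I)
  case empty
  then show ?case by (simp add: square_integrable_def)
qed (auto intro: square_integrable_add)

lemma square_integrable_norm:
  "square_integrable M F \<Longrightarrow> square_integrable M (\<lambda>x. norm (F x))"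
  by (auto simp: square_integrable_def)

lemma square_integrable_bilinear:
  fixes pr :: "'b::euclidean_space \<Rightarrow> 'c::euclidean_space \<Rightarrow> 'd::euclidean_space"
  assumes "bounded_bilinear pr" "square_integrable M F" "square_integrable M G"
  shows "integrable M (\<lambda>x. pr (F x) (G x))"
proof -
  obtain K where K: "\<And>x y. norm (pr x y) \<le> norm x * norm y * K" "0 \<le> K"
    using bounded_bilinear.nonneg_bounded[OF assms(1)] by blast
  have bound: "norm (pr (F x) (G x)) \<le> K * (norm (F x))\<^sup>2 + K * (norm (G x))\<^sup>2" for x
  proof -
    have "norm (F x) * norm (G x) \<le> (norm (F x))\<^sup>2 + (norm (G x))\<^sup>2"
      using sum_squares_bound[of "norm (F x)" "norm (G x)"]
        mult_nonneg_nonneg[OF norm_ge_zero[of "F x"] norm_ge_zero[of "G x"]] by linarith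
    from mult_left_mono[OF this K(2)] K(1)[of "F x" "G x"] show ?thesis
      by (simp add: algebra_simps)
  qed
  have "continuous_on UNIV (\<lambda>x. pr (fst x) (snd x))"
    by (rule bounded_bilinear.continuous_on[OF assms(1)]) (auto intro: continuous_intros)
  then have "(\<lambda>x. pr (F x) (G x)) \<in> borel_measurable M"
    using assms(2,3) by (intro borel_measurable_continuous_Pair[where H = pr]) (auto simp: square_integrable_def)
  moreover have "integrable M (\<lambda>x. K * (norm (F x))\<^sup>2 + K * (norm (G x))\<^sup>2)"
    using assms by (simp add: square_integrable_def)
  moreover have "norm (pr (F x) (G x)) \<le> norm (K * (norm (F x))\<^sup>2 + K * (norm (G x))\<^sup>2)" for x
    using bound[of x] by (simp add: abs_le_iff)
  ultimately show ?thesis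
    by (blast intro: Bochner_Integration.integrable_bound)
qed

lemmas square_integrable_inner = square_integrable_bilinear[OF bounded_bilinear_inner]
lemmas square_integrable_mult = square_integrable_bilinear[OF bounded_bilinear_mult]

lemma integral_Cauchy_Schwarz:
  assumes "square_integrable M F" "square_integrable M G"
  shows "\<bar>LINT x|M. F x \<bullet> G x\<bar>
    \<le> sqrt (LINT x|M. (norm (F x))\<^sup>2) * sqrt (LINT x|M. (norm (G x))\<^sup>2)"
proof -
  have int: "integrable M (\<lambda>x. (norm (F x))\<^sup>2)" "integrable M (\<lambda>x. (norm (G x))\<^sup>2)"
    "integrable M (\<lambda>x. F x \<bullet> G x)"
    using assms square_integrable_inner[OF assms] by (auto simp: square_integrable_def)
  have "0 \<le> (LINT x|M. (norm (F x))\<^sup>2) * t\<^sup>2 + 2 * (LINT x|M. F x \<bullet> G x) * t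
      + (LINT x|M. (norm (G x))\<^sup>2)" for t
  proof -
    have "0 \<le> (LINT x|M. (norm (t *\<^sub>R F x + G x))\<^sup>2)"
      by simp
    also have "(\<lambda>x. (norm (t *\<^sub>R F x + G x))\<^sup>2)
        = (\<lambda>x. t\<^sup>2 * (norm (F x))\<^sup>2 + 2 * t * (F x \<bullet> G x) + (norm (G x))\<^sup>2)"
      by (rule ext) (simp only: power2_norm_eq_inner inner_add_left inner_add_right inner_scaleR_left
          inner_scaleR_right, simp add: inner_commute algebra_simps power2_eq_square)
    finally show ?thesis
      using int by (simp add: algebra_simps)
  qed
  from quadratic_nonneg_imp_discriminant[OF this] show ?thesis
    by (simp add: real_sqrt_mult[symmetric] real_le_rsqrt)
qed

lemma integral_inner_lin:
  assumes "square_integrable M X" "square_integrable M Y" "square_integrable M Z" "square_integrable M W"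
    and "AE x in M. Z x = X x + c *\<^sub>R Y x"
  shows "(LINT x|M. Z x \<bullet> W x) = (LINT x|M. X x \<bullet> W x) + c * (LINT x|M. Y x \<bullet> W x)"
proof -
  note int = square_integrable_inner[OF assms(1,4)] square_integrable_inner[OF assms(2,4)]
    square_integrable_inner[OF assms(3,4)]
  have "(LINT x|M. Z x \<bullet> W x) = (LINT x|M. X x \<bullet> W x + c * (Y x \<bullet> W x))"
  proof (rule integral_cong_AE)
    show "AE x in M. Z x \<bullet> W x = X x \<bullet> W x + c * (Y x \<bullet> W x)"
      using assms(5) by eventually_elim (simp add: inner_add_left)
  qed (use int in auto)
  with int show ?thesis by simp
qed

lemma integral_inner_lin_right:
  assumes "square_integrable M X" "square_integrable M Y" "square_integrable M Z" "square_integrable M W"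
    and "AE x in M. Z x = X x + c *\<^sub>R Y x"
  shows "(LINT x|M. W x \<bullet> Z x) = (LINT x|M. W x \<bullet> X x) + c * (LINT x|M. W x \<bullet> Y x)"
  using integral_inner_lin[OF assms] by (simp only: inner_commute)

text \<open>The Riesz-Fischer theorem. Along a subsequence with \<open>\<parallel>u\<^bsub>r (i+1)\<^esub> - u\<^bsub>r i\<^esub>\<parallel>\<^sup>2 < 4\<^sup>-\<^sup>i\<close> the series
  \<open>\<Sum>\<^sub>i 2\<^sup>i \<bar>u\<^bsub>r (i+1)\<^esub> - u\<^bsub>r i\<^esub>\<bar>\<^sup>2\<close> has finite integral, which forces almost everywhere convergence;
  Fatou's lemma then gives convergence in the mean.\<close>

lemma L2_complete:
  assumes u: "\<And>k. u k \<in> L2 M"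
    and cauchy: "\<And>e. 0 < e \<Longrightarrow> \<exists>N. \<forall>j\<ge>N. \<forall>k\<ge>N. (LINT x|M. (u j x - u k x)\<^sup>2) < e"
  obtains w where "w \<in> L2 M" "(\<lambda>k. LINT x|M. (u k x - w x)\<^sup>2) \<longlonglongrightarrow> 0"
proof -
  have um [measurable]: "u k \<in> borel_measurable M" for k
    using u by (simp add: L2_def)
  have diff_int: "integrable M (\<lambda>x. (u j x - u k x)\<^sup>2)" for j k
    using square_integrable_lin[of M "u j" "u k" "-1"] u
    by (simp add: L2_iff_square_integrable square_integrable_def)
  have "\<exists>N. \<forall>i. \<forall>j\<ge>N i. \<forall>k\<ge>N i. (LINT x|M. (u j x - u k x)\<^sup>2) < (1 / 4) ^ i"
    using cauchy by (intro choice allI) simp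
  then obtain N where N: "\<And>i j k. \<lbrakk>N i \<le> j; N i \<le> k\<rbrakk> \<Longrightarrow> (LINT x|M. (u j x - u k x)\<^sup>2) < (1 / 4) ^ i"
    by blast
  define r where "r i = (\<Sum>j\<le>i. N j) + i" for i
  have r_N: "N i \<le> r i" "N i \<le> r (Suc i)" for i
    using member_le_sum[of i "{..i}" N] by (auto simp: r_def)
  define d where "d i x = u (r (Suc i)) x - u (r i) x" for i x
  have dm [measurable]: "d i \<in> borel_measurable M" for i
    unfolding d_def by measurable
  have d_int: "integrable M (\<lambda>x. (d i x)\<^sup>2)" "(LINT x|M. (d i x)\<^sup>2) \<le> (1 / 4) ^ i" for i
    unfolding d_def using diff_int N[OF r_N(2,1), of i] by (auto intro: less_imp_le)
  have "(\<integral>\<^sup>+ x. (\<Sum>i. ennreal (2 ^ i * (d i x)\<^sup>2)) \<partial>M) = (\<Sum>i. \<integral>\<^sup>+ x. ennreal (2 ^ i * (d i x)\<^sup>2) \<partial>M)"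
    by (rule nn_integral_suminf) measurable
  also have "\<dots> \<le> (\<Sum>i. ennreal ((1 / 2) ^ i))"
  proof (intro suminf_le allI)
    fix i
    have "(\<integral>\<^sup>+ x. ennreal (2 ^ i * (d i x)\<^sup>2) \<partial>M) = ennreal (LINT x|M. 2 ^ i * (d i x)\<^sup>2)"
      using d_int(1) by (intro nn_integral_eq_integral) auto
    also have "\<dots> \<le> ennreal (2 ^ i * (1 / 4) ^ i)"
      using d_int by (intro ennreal_leI) (simp add: mult_left_mono)
    also have "2 ^ i * (1 / 4) ^ i = (1 / 2 :: real) ^ i"
      by (simp flip: power_mult_distrib)
    finally show "(\<integral>\<^sup>+ x. ennreal (2 ^ i * (d i x)\<^sup>2) \<partial>M) \<le> ennreal ((1 / 2) ^ i)" .
  qed auto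
  also have "\<dots> < \<infinity>"
    by (simp add: suminf_ennreal_eq[OF _ geometric_sums])
  finally have "AE x in M. (\<Sum>i. ennreal (2 ^ i * (d i x)\<^sup>2)) \<noteq> \<infinity>"
    by (intro nn_integral_noteq_infinite) auto
  then have conv: "AE x in M. convergent (\<lambda>i. u (r i) x)"
  proof eventually_elim
    case (elim x)
    then have "summable (\<lambda>i. 2 ^ i * (d i x)\<^sup>2)"
      by (intro summable_suminf_not_top) auto
    then have "summable (\<lambda>i. 2 ^ i * (d i x)\<^sup>2 + (1 / 2) ^ i)"
      by (intro summable_add summable_geometric) auto
    then have "summable (\<lambda>i. d i x)"
    proof (rule summable_comparison_test')
      fix i
      \<comment> \<open>the arithmetic-geometric mean inequality\<close>
      have "0 \<le> 2 ^ i * (\<bar>d i x\<bar> - (1 / 2) ^ i)\<^sup>2"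
        by simp
      then have "2 * \<bar>d i x\<bar> \<le> 2 ^ i * (d i x)\<^sup>2 + (1 / 2) ^ i"
        by (simp add: power2_diff algebra_simps power_one_over) (simp add: power2_eq_square field_simps)
      then show "norm (d i x) \<le> 2 ^ i * (d i x)\<^sup>2 + (1 / 2) ^ i"
        by simp
    qed
    then show ?case
      using summable_iff_convergent[of "\<lambda>i. d i x"] sum_lessThan_telescope[of "\<lambda>i. u (r i) x"]
      by (simp add: d_def convergent_diff_const_right_iff)
  qed
  define w where "w x = lim (\<lambda>i. u (r i) x)" for x
  have wm [measurable]: "w \<in> borel_measurable M"
    unfolding w_def by measurable
  have w_lim: "AE x in M. (\<lambda>i. u (r i) x) \<longlonglongrightarrow> w x"
    using conv by eventually_elim (simp add: w_def convergent_LIMSEQ_iff)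
  have fatou: "integrable M (\<lambda>x. (u k x - w x)\<^sup>2) \<and> (LINT x|M. (u k x - w x)\<^sup>2) \<le> (1 / 4) ^ i"
    if "N i \<le> k" for i k
  proof -
    have "(\<integral>\<^sup>+ x. ennreal ((u k x - w x)\<^sup>2) \<partial>M) = (\<integral>\<^sup>+ x. liminf (\<lambda>j. ennreal ((u k x - u (r j) x)\<^sup>2)) \<partial>M)"
    proof (intro nn_integral_cong_AE, use w_lim in eventually_elim)
      case (elim x)
      then have "(\<lambda>j. ennreal ((u k x - u (r j) x)\<^sup>2)) \<longlonglongrightarrow> ennreal ((u k x - w x)\<^sup>2)"
        by (intro tendsto_ennrealI tendsto_intros)
      from lim_imp_Liminf[OF _ this] show ?case
        by simp
    qed
    also have "\<dots> \<le> liminf (\<lambda>j. \<integral>\<^sup>+ x. ennreal ((u k x - u (r j) x)\<^sup>2) \<partial>M)"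
      by (intro nn_integral_liminf) measurable
    also have "\<dots> \<le> limsup (\<lambda>j. \<integral>\<^sup>+ x. ennreal ((u k x - u (r j) x)\<^sup>2) \<partial>M)"
      by (intro Liminf_le_Limsup) auto
    also have "\<dots> \<le> ennreal ((1 / 4) ^ i)"
    proof (intro Limsup_bounded, unfold eventually_sequentially, intro exI allI impI)
      fix j assume "i \<le> j"
      then have "N i \<le> r j"
        by (auto simp: r_def intro!: trans_le_add1 member_le_sum)
      with N[OF that] show "(\<integral>\<^sup>+ x. ennreal ((u k x - u (r j) x)\<^sup>2) \<partial>M) \<le> ennreal ((1 / 4) ^ i)"
        by (subst nn_integral_eq_integral[OF diff_int]) (auto intro!: ennreal_leI less_imp_le)
    qed
    finally have *: "(\<integral>\<^sup>+ x. ennreal ((u k x - w x)\<^sup>2) \<partial>M) \<le> ennreal ((1 / 4) ^ i)" .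
    then have int: "integrable M (\<lambda>x. (u k x - w x)\<^sup>2)"
      by (intro integrableI_nonneg) (auto simp: le_less_trans)
    with * show ?thesis
      by (subst (asm) nn_integral_eq_integral[OF int]) auto
  qed
  have "square_integrable M (\<lambda>x. u (N 0) x + (-1) *\<^sub>R (u (N 0) x - w x))"
    using fatou[of 0 "N 0"] u
    by (intro square_integrable_lin) (auto simp: L2_iff_square_integrable square_integrable_def)
  then have "w \<in> L2 M"
    by (simp add: L2_iff_square_integrable)
  moreover have "(\<lambda>k. LINT x|M. (u k x - w x)\<^sup>2) \<longlonglongrightarrow> 0"
  proof (rule LIMSEQ_I)
    fix e :: real assume "0 < e"
    then obtain i where i: "(1 / 4) ^ i < e"
      using real_arch_pow_inv[of e "1 / 4"] by auto
    have "norm ((LINT x|M. (u k x - w x)\<^sup>2) - 0) < e" if "N i \<le> k" for k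
      using fatou[OF that] i by simp
    then show "\<exists>n0. \<forall>k\<ge>n0. norm ((LINT x|M. (u k x - w x)\<^sup>2) - 0) < e"
      by blast
  qed
  ultimately show ?thesis
    by (rule that)
qed

section \<open>The fundamental lemma of the calculus of variations\<close>

text \<open>The functions \<open>t \<mapsto> t\<^sup>-\<^sup>j exp (-1/t)\<close>, extended by zero to \<open>t \<le> 0\<close>. The factor \<open>t\<^sup>-\<^sup>j\<close> makes the
  family closed under differentiation, up to linear combinations.\<close>

definition flat :: "nat \<Rightarrow> real \<Rightarrow> real" where
  "flat j t = (if 0 < t then exp (- 1 / t) / t ^ j else 0)"

lemma flat_tendsto_0: "(flat j \<longlongrightarrow> 0) (at 0)"
proof -
  have "filterlim (\<lambda>t::real. inverse t) at_top (at_right 0)"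
    by (rule filterlim_inverse_at_top_right)
  from filterlim_compose[OF tendsto_power_div_exp_0[of j] this]
  have "((\<lambda>t::real. inverse t ^ j / exp (inverse t)) \<longlongrightarrow> 0) (at_right 0)" .
  moreover have "\<forall>\<^sub>F t in at_right 0. inverse t ^ j / exp (inverse t) = flat j t"
    unfolding eventually_at_right_field
    by (intro exI[of _ 1]) (auto simp: flat_def field_simps exp_minus simp flip: exp_add)
  ultimately have "(flat j \<longlongrightarrow> 0) (at_right 0)"
    by (rule Lim_transform_eventually)
  moreover have "(flat j \<longlongrightarrow> 0) (at_left 0)"
    by (rule tendsto_eventually) (auto simp: eventually_at_left_field flat_def intro!: exI[of _ "-1"])
  ultimately show ?thesis
    by (simp add: filterlim_split_at)
qed

lemma flat_has_derivative:
  "(flat j has_real_derivative flat (j + 2) t - real j * flat (j + 1) t) (at t)"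
proof (cases t "0 :: real" rule: linorder_cases)
  case less
  then have "flat (j + 2) t - real j * flat (j + 1) t = 0"
    by (simp add: flat_def)
  moreover have "(flat j has_real_derivative 0) (at t)"
    by (rule has_field_derivative_transform_within_open[of "\<lambda>_. 0" _ _ "{..<0}"])
      (use less in \<open>auto simp: flat_def\<close>)
  ultimately show ?thesis
    by simp
next
  case equal
  have "((\<lambda>h. (flat j (0 + h) - flat j 0) / h) \<longlongrightarrow> 0) (at 0)"
  proof (rule Lim_transform_eventually[OF flat_tendsto_0[of "Suc j"]])
    show "\<forall>\<^sub>F h in at 0. flat (Suc j) h = (flat j (0 + h) - flat j 0) / h"
      by (auto simp: eventually_at_filter flat_def)
  qed
  with equal show ?thesis
    by (simp add: DERIV_def flat_def)
next
  case greater
  have "((\<lambda>s. exp (- 1 / s) / s ^ j) has_real_derivative flat (j + 2) t - real j * flat (j + 1) t) (at t)"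
  proof (cases j)
    case 0
    then show ?thesis
      using greater by (auto intro!: derivative_eq_intros simp: flat_def field_simps power2_eq_square)
  next
    case (Suc i)
    then show ?thesis
      using greater by (auto intro!: derivative_eq_intros simp: flat_def divide_simps power2_eq_square)
         (cases i; simp add: algebra_simps power_add power2_eq_square)
  qed
  then show ?thesis
    by (rule has_field_derivative_transform_within_open[of _ _ _ "{0<..}"])
      (use greater in \<open>auto simp: flat_def\<close>)
qed

text \<open>The algebra generated by the functions \<open>flat\<close> of one coordinate. It is closed under partial
  derivatives, hence consists of smooth functions.\<close>

inductive flat_algebra :: "(real ^ 'n \<Rightarrow> real) \<Rightarrow> bool" where
  const: "flat_algebra (\<lambda>x. c)"
| add: "\<lbrakk>flat_algebra f; flat_algebra g\<rbrakk> \<Longrightarrow> flat_algebra (\<lambda>x. f x + g x)"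
| mult: "\<lbrakk>flat_algebra f; flat_algebra g\<rbrakk> \<Longrightarrow> flat_algebra (\<lambda>x. f x * g x)"
| flat: "flat_algebra (\<lambda>x. flat j (a * x $ i + c))"

lemma flat_algebra_has_derivative:
  assumes "flat_algebra (f :: real ^ 'n::finite \<Rightarrow> real)"
  shows "\<exists>D. (\<forall>x. (f has_derivative D x) (at x)) \<and> (\<forall>v. flat_algebra (\<lambda>x. D x v))"
  using assms
proof induction
  case (const c)
  show ?case
    by (rule exI[of _ "\<lambda>_ _. 0"]) (auto intro: flat_algebra.const)
next
  case (add f g)
  then obtain D E where "\<forall>x. (f has_derivative D x) (at x)" "\<forall>v. flat_algebra (\<lambda>x. D x v)"
    "\<forall>x. (g has_derivative E x) (at x)" "\<forall>v. flat_algebra (\<lambda>x. E x v)"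
    by blast
  then show ?case
    by (intro exI[of _ "\<lambda>x v. D x v + E x v"]) (auto intro: flat_algebra.add has_derivative_add)
next
  case (mult f g)
  then obtain D E where "\<forall>x. (f has_derivative D x) (at x)" "\<forall>v. flat_algebra (\<lambda>x. D x v)"
    "\<forall>x. (g has_derivative E x) (at x)" "\<forall>v. flat_algebra (\<lambda>x. E x v)"
    by blast
  with mult.hyps show ?case
    by (intro exI[of _ "\<lambda>x v. f x * E x v + D x v * g x"] conjI allI has_derivative_mult
        flat_algebra.add flat_algebra.mult) blast+
next
  case (flat j a i c)
  define D where "D x v = (a * v $ i) * (flat (j + 2) (a * x $ i + c) + (- real j) * flat (j + 1) (a * x $ i + c))"
    for x v :: "real ^ 'n"
  have "((\<lambda>x. flat j (a * x $ i + c)) has_derivative D x) (at x)" for x :: "real ^ 'n"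
  proof -
    have inner: "((\<lambda>x. a * x $ i + c) has_derivative (\<lambda>v. a * v $ i)) (at x)"
      by (auto intro!: derivative_eq_intros bounded_linear_imp_has_derivative bounded_linear_vec_nth)
    from has_derivative_compose[OF inner
        flat_has_derivative[of j "a * x $ i + c", unfolded has_field_derivative_def]]
    show ?thesis
      unfolding D_def by (rule has_derivative_eq_rhs) (simp add: fun_eq_iff algebra_simps)
  qed
  moreover have "flat_algebra (\<lambda>x. D x v)" for v
    unfolding D_def by (intro flat_algebra.intros)
  ultimately show ?case
    by blast
qed

lemma flat_algebra_Ck_on: "flat_algebra (f :: real ^ 'n::finite \<Rightarrow> real) \<Longrightarrow> Ck_on k S f"
proof (induction k arbitrary: f)
  case 0
  from flat_algebra_has_derivative[OF this] show ?case
    by (auto intro!: continuous_at_imp_continuous_on dest: has_derivative_continuous)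
next
  case (Suc k)
  from flat_algebra_has_derivative[OF Suc.prems] obtain D where
    D: "\<And>x. (f has_derivative D x) (at x)" "\<And>v. flat_algebra (\<lambda>x. D x v)"
    by blast
  have "partial i f = (\<lambda>x. D x (axis i 1))" for i
    using frechet_derivative_at[OF D(1)] by (simp add: fun_eq_iff partial_def)
  with D Suc.IH show ?case
    by (auto simp: differentiable_def)
qed

text \<open>A smooth function that is nonzero exactly on the open box between \<open>a\<close> and \<open>b\<close>. As \<open>k\<close> grows
  it increases to the indicator of the box, since \<open>exp (-1/(k t)) \<longlonglongrightarrow> 1\<close> for \<open>t > 0\<close>.\<close>

definition box_bump :: "real \<Rightarrow> real ^ 'n \<Rightarrow> real ^ 'n \<Rightarrow> real ^ 'n \<Rightarrow> real" where
  "box_bump k a b x = (\<Prod>i\<in>UNIV. flat 0 (k * x $ i + - k * a $ i) * flat 0 (- k * x $ i + k * b $ i))"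

lemma flat_algebra_prod:
  "\<lbrakk>finite I; \<And>i. i \<in> I \<Longrightarrow> flat_algebra (f i)\<rbrakk> \<Longrightarrow> flat_algebra (\<lambda>x. \<Prod>i\<in>I. f i x)"
  by (induction I rule: finite_induct) (auto intro: flat_algebra.intros)

lemma box_bump_smooth: "smooth_on S (box_bump k a b :: real ^ 'n::finite \<Rightarrow> real)"
  unfolding smooth_on_def box_bump_def
  by (intro allI flat_algebra_Ck_on flat_algebra_prod flat_algebra.mult flat_algebra.flat) simp

lemma box_bump_support:
  assumes "0 < k"
  shows "box_bump k a b x \<noteq> 0 \<longleftrightarrow> x \<in> box a (b :: real ^ 'n::finite)"
proof -
  have "k * x $ i + - k * a $ i = k * (x $ i - a $ i)" "- k * x $ i + k * b $ i = k * (b $ i - x $ i)" for i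
    by (simp_all add: algebra_simps)
  with assms show ?thesis
    by (auto simp: box_bump_def flat_def mem_box_cart zero_less_mult_iff)
qed

lemma box_bump_test_function:
  assumes "0 < k" "cbox a b \<subseteq> \<Omega>"
  shows "box_bump k a b \<in> test_functions (\<Omega> :: (real ^ 'n::finite) set)"
proof -
  have "closure {x. box_bump k a b x \<noteq> 0} \<subseteq> cbox a b"
    using box_bump_support[OF assms(1), of a b] box_subset_cbox[of a b]
    by (intro closure_minimal) auto
  with assms(2) show ?thesis
    by (auto simp: test_functions_def box_bump_smooth intro: bounded_subset[OF bounded_cbox]
        simp: compact_eq_bounded_closed)
qed

lemma box_bump_le_1:
  assumes "0 < k"
  shows "0 \<le> box_bump k a b x" "box_bump k a b x \<le> 1"
proof -
  have "0 \<le> flat 0 t" "flat 0 t \<le> 1" for t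
    by (auto simp: flat_def)
  then show "0 \<le> box_bump k a b x" "box_bump k a b x \<le> 1"
    unfolding box_bump_def by (auto intro!: prod_nonneg prod_le_1 mult_le_one)
qed

lemma box_bump_tendsto_indicator:
  "(\<lambda>k. box_bump (real (Suc k)) a b x) \<longlonglongrightarrow> indicator (box a b) (x :: real ^ 'n::finite)"
proof (cases "x \<in> box a b")
  case False
  then have "box_bump (real (Suc k)) a b x = 0" for k
    using box_bump_support[of "real (Suc k)" a b x] by simp
  with False show ?thesis by simp
next
  case True
  have lim: "(\<lambda>k. flat 0 (real (Suc k) * t)) \<longlonglongrightarrow> 1" if "0 < t" for t
  proof -
    have "(\<lambda>k. exp (- (1 / t) * (1 / real (Suc k)))) \<longlonglongrightarrow> exp (- (1 / t) * 0)"
      by (intro tendsto_intros LIMSEQ_Suc[OF lim_1_over_n])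
    then show ?thesis
      using that by (simp add: flat_def field_simps del: of_nat_Suc)
  qed
  have "k * x $ i + - k * a $ i = k * (x $ i - a $ i)" "- k * x $ i + k * b $ i = k * (b $ i - x $ i)" for i k
    by (simp_all add: algebra_simps)
  then have "(\<lambda>k. box_bump (real (Suc k)) a b x) \<longlonglongrightarrow> (\<Prod>i\<in>(UNIV :: 'n set). 1 * 1)"
    using True unfolding box_bump_def
    by (simp only:) (intro tendsto_prod tendsto_mult lim; simp add: mem_box_cart)
  with True show ?thesis by simp
qed

text \<open>The integrals of \<open>g\<close> over small cubes vanish, so \<open>g\<close> vanishes at almost every point by Lebesgue's
  differentiation theorem.\<close>

theorem fundamental_lemma_calculus_of_variations:
  fixes g :: "real ^ 'n::finite \<Rightarrow> real"
  assumes "open \<Omega>" and g: "integrable (lebesgue_on \<Omega>) g"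
    and orth: "\<And>\<phi>. \<phi> \<in> test_functions \<Omega> \<Longrightarrow> (LINT x|lebesgue_on \<Omega>. g x * \<phi> x) = 0"
  shows "AE x in lebesgue_on \<Omega>. g x = 0"
proof -
  have [measurable]: "\<Omega> \<in> sets lebesgue"
    using \<open>open \<Omega>\<close> by (intro lmeasurable_open borel_open sets_completionI_sets) simp
  have [measurable]: "g \<in> borel_measurable (lebesgue_on \<Omega>)"
    using g by auto
  have cont_meas: "\<phi> \<in> borel_measurable (lebesgue_on \<Omega>)" if "continuous_on UNIV \<phi>" for \<phi> :: "real ^ 'n \<Rightarrow> real"
    using continuous_imp_measurable_on_sets_lebesgue[OF continuous_on_subset[OF that]] by simp
  have bump_meas [measurable]: "box_bump k a b \<in> borel_measurable (lebesgue_on \<Omega>)" for k a b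
  proof (rule cont_meas)
    show "continuous_on UNIV (box_bump k a b)"
      using box_bump_smooth[of UNIV k a b] unfolding smooth_on_def by (metis Ck_on.simps(1))
  qed
  define f where "f x = indicator \<Omega> x *\<^sub>R g x" for x
  have f_int: "integrable lebesgue f"
    using g unfolding f_def by (subst (asm) integrable_restrict_space) auto
  have f_abs: "f absolutely_integrable_on S" if "S \<in> sets lebesgue" for S
    using integrable_mult_indicator[OF that f_int] by (simp add: set_integrable_def)
  have [measurable]: "(\<lambda>x. indicator (box a b) x :: real) \<in> borel_measurable (lebesgue_on \<Omega>)" for a b
    by (intro measurable_restrict_space1 borel_measurable_indicator) simp
  have box_zero: "integral (cbox a b) f = 0" if "cbox a b \<subseteq> \<Omega>" for a b
  proof -
    have "(\<lambda>k. LINT x|lebesgue_on \<Omega>. g x * box_bump (real (Suc k)) a b x)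
        \<longlonglongrightarrow> (LINT x|lebesgue_on \<Omega>. g x * indicator (box a b) x)"
    proof (rule integral_dominated_convergence[where w = "\<lambda>x. \<bar>g x\<bar>"])
      show "AE x in lebesgue_on \<Omega>. (\<lambda>k. g x * box_bump (real (Suc k)) a b x) \<longlonglongrightarrow> g x * indicator (box a b) x"
        by (intro AE_I2 tendsto_intros box_bump_tendsto_indicator)
      show "AE x in lebesgue_on \<Omega>. norm (g x * box_bump (real (Suc k)) a b x) \<le> \<bar>g x\<bar>" for k
        using box_bump_le_1[of "real (Suc k)" a b] by (intro AE_I2) (auto simp: abs_mult intro!: mult_left_le)
    qed (use g in auto)
    moreover have "(LINT x|lebesgue_on \<Omega>. g x * box_bump (real (Suc k)) a b x) = 0" for k
      by (intro orth box_bump_test_function that) simp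
    ultimately have "(LINT x|lebesgue_on \<Omega>. g x * indicator (box a b) x) = 0"
      by (simp add: LIMSEQ_const_iff)
    also have "(LINT x|lebesgue_on \<Omega>. g x * indicator (box a b) x) = (LINT x:box a b|lebesgue. f x)"
      by (subst integral_restrict_space) (auto simp: set_lebesgue_integral_def f_def mult_ac)
    also have "\<dots> = integral (box a b) f"
      by (intro set_lebesgue_integral_eq_integral f_abs) simp
    finally show ?thesis
      by (simp add: integral_open_interval)
  qed
  have "f integrable_on cbox a b" for a b
    using f_abs[of "cbox a b"] set_lebesgue_integral_eq_integral(1) by auto
  then obtain N where N: "negligible N" and diff: "\<And>x e. \<lbrakk>x \<notin> N; 0 < e\<rbrakk> \<Longrightarrow>
      \<exists>d>0. \<forall>h. 0 < h \<and> h < d \<longrightarrow>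
        norm (integral (cbox x (x + h *\<^sub>R One)) f /\<^sub>R h ^ DIM(real ^ 'n) - f x) < e"
    using integrable_ccontinuous_explicit by metis
  have zero: "g x = 0" if "x \<in> \<Omega>" "x \<notin> N" for x
  proof (rule ccontr)
    assume "g x \<noteq> 0"
    with diff[of x "\<bar>g x\<bar>"] that obtain d where d: "0 < d"
      and d': "\<And>h. \<lbrakk>0 < h; h < d\<rbrakk> \<Longrightarrow>
        norm (integral (cbox x (x + h *\<^sub>R One)) f /\<^sub>R h ^ DIM(real ^ 'n) - f x) < \<bar>g x\<bar>"
      by (metis zero_less_abs_iff)
    obtain e where e: "0 < e" "ball x e \<subseteq> \<Omega>"
      using \<open>open \<Omega>\<close> \<open>x \<in> \<Omega>\<close> by (meson openE)
    define c where "c = norm (One :: real ^ 'n) + 1"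
    define h where "h = min (d / 2) (e / (2 * c))"
    have c: "0 < c" by (simp add: c_def add_nonneg_pos)
    then have h: "0 < h" "h < d" "h * c < e"
      using d e by (auto simp: h_def min_def field_simps)
    have "cbox x (x + h *\<^sub>R One) \<subseteq> \<Omega>"
    proof
      fix y assume y: "y \<in> cbox x (x + h *\<^sub>R One)"
      have "norm (y - x) \<le> norm (h *\<^sub>R (One :: real ^ 'n))"
        using y by (intro norm_le_componentwise) (auto simp: mem_box inner_diff_left inner_add_left)
      also have "\<dots> \<le> h * c"
        using h by (simp add: c_def)
      finally show "y \<in> \<Omega>"
        using e h by (auto simp: dist_norm norm_minus_commute)
    qed
    from box_zero[OF this] d'[OF h(1,2)] that show False
      by (simp add: f_def)
  qed
  have "AE x in lebesgue. x \<notin> N"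
    using N by (simp add: negligible_iff_null_sets AE_not_in)
  then show ?thesis
    by (subst AE_restrict_space_iff) (auto elim!: eventually_mono simp: zero)
qed

section \<open>The Sobolev space on a bounded open set\<close>

locale bounded_open =
  fixes \<Omega> :: "(real ^ 'n::finite) set"
  assumes open_domain: "open \<Omega>" and bounded_domain: "bounded \<Omega>"
begin

lemma domain_sets [measurable]: "\<Omega> \<in> sets lebesgue"
  using open_domain by (intro lmeasurable_open borel_open sets_completionI_sets) simp

lemma domain_finite_measure: "finite_measure (lebesgue_on \<Omega>)"
  by (intro finite_measure_lebesgue_on bounded_set_imp_lmeasurable bounded_domain domain_sets)

text \<open>Boundedness of the domain enters here: functions that are continuous on the whole space are
  bounded on it.\<close>

lemma continuous_square_integrable:
  fixes h :: "real ^ 'n \<Rightarrow> 'b::euclidean_space"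
  assumes "continuous_on UNIV h"
  shows "square_integrable (lebesgue_on \<Omega>) h"
proof -
  have "compact (h ` closure \<Omega>)"
    using bounded_domain assms
    by (intro compact_continuous_image) (auto simp: compact_closure intro: continuous_on_subset)
  then obtain C where C: "\<And>x. x \<in> \<Omega> \<Longrightarrow> norm (h x) \<le> C"
    using closure_subset[of \<Omega>] by (force dest!: compact_imp_bounded simp: bounded_iff)
  interpret finite_measure "lebesgue_on \<Omega>"
    by (rule domain_finite_measure)
  have "h \<in> borel_measurable (lebesgue_on \<Omega>)"
    using continuous_imp_measurable_on_sets_lebesgue[OF continuous_on_subset[OF assms]] by simp
  moreover have "AE x in lebesgue_on \<Omega>. (norm (h x))\<^sup>2 \<le> C\<^sup>2"
    using C by (auto intro!: AE_I2 power_mono)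
  ultimately show ?thesis
    by (intro square_integrableI_bound[where h = "\<lambda>_. C\<^sup>2"]) auto
qed

lemma square_integrable_imp_integrable:
  fixes u :: "real ^ 'n \<Rightarrow> real"
  assumes "square_integrable (lebesgue_on \<Omega>) u"
  shows "integrable (lebesgue_on \<Omega>) u"
  using square_integrable_mult[OF assms continuous_square_integrable[of "\<lambda>_. 1"]] by simp

lemma test_function_square_integrable:
  assumes "\<phi> \<in> test_functions \<Omega>"
  shows "square_integrable (lebesgue_on \<Omega>) \<phi>" "square_integrable (lebesgue_on \<Omega>) (partial i \<phi>)"
proof -
  have "Ck_on 0 UNIV \<phi>" "Ck_on (Suc 0) UNIV \<phi>"
    using assms unfolding test_functions_def smooth_on_def by blast+
  then show "square_integrable (lebesgue_on \<Omega>) \<phi>" "square_integrable (lebesgue_on \<Omega>) (partial i \<phi>)"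
    by (auto intro: continuous_square_integrable)
qed

lemma weak_partial_unique:
  assumes "g \<in> L2 (lebesgue_on \<Omega>)" "is_weak_partial \<Omega> i u g"
    and "h \<in> L2 (lebesgue_on \<Omega>)" "is_weak_partial \<Omega> i u h"
  shows "AE x in lebesgue_on \<Omega>. g x = h x"
proof -
  have sq: "square_integrable (lebesgue_on \<Omega>) g" "square_integrable (lebesgue_on \<Omega>) h"
    using assms by (auto simp: L2_iff_square_integrable)
  have "AE x in lebesgue_on \<Omega>. g x - h x = 0"
  proof (rule fundamental_lemma_calculus_of_variations[OF open_domain])
    show "integrable (lebesgue_on \<Omega>) (\<lambda>x. g x - h x)"
      using sq by (intro Bochner_Integration.integrable_diff square_integrable_imp_integrable)
    fix \<phi> assume \<phi>: "\<phi> \<in> test_functions \<Omega>"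
    then have "(LINT x|lebesgue_on \<Omega>. g x * \<phi> x) = (LINT x|lebesgue_on \<Omega>. h x * \<phi> x)"
      using assms(2,4) by (simp add: is_weak_partial_def)
    then show "(LINT x|lebesgue_on \<Omega>. (g x - h x) * \<phi> x) = 0"
      using sq test_function_square_integrable(1)[OF \<phi>]
      by (simp add: left_diff_distrib square_integrable_mult)
  qed
  then show ?thesis
    by eventually_elim simp
qed

lemma weak_partial:
  assumes "u \<in> H1 \<Omega>"
  shows "weak_partial \<Omega> i u \<in> L2 (lebesgue_on \<Omega>)" "is_weak_partial \<Omega> i u (weak_partial \<Omega> i u)"
proof -
  have "\<exists>g. g \<in> L2 (lebesgue_on \<Omega>) \<and> is_weak_partial \<Omega> i u g"
    using assms by (auto simp: H1_def)
  from someI_ex[OF this] show "weak_partial \<Omega> i u \<in> L2 (lebesgue_on \<Omega>)"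
    "is_weak_partial \<Omega> i u (weak_partial \<Omega> i u)"
    by (auto simp: weak_partial_def)
qed

lemma H1_L2: "u \<in> H1 \<Omega> \<Longrightarrow> u \<in> L2 (lebesgue_on \<Omega>)"
  by (simp add: H1_def)

lemma is_weak_partial_lin:
  assumes "u \<in> L2 (lebesgue_on \<Omega>)" "v \<in> L2 (lebesgue_on \<Omega>)"
    and "g \<in> L2 (lebesgue_on \<Omega>)" "is_weak_partial \<Omega> i u g"
    and "h \<in> L2 (lebesgue_on \<Omega>)" "is_weak_partial \<Omega> i v h"
  shows "is_weak_partial \<Omega> i (\<lambda>x. u x + c * v x) (\<lambda>x. g x + c * h x)"
  unfolding is_weak_partial_def
proof
  fix \<phi> assume \<phi>: "\<phi> \<in> test_functions \<Omega>"
  note sq = test_function_square_integrable[OF \<phi>]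
  have int: "integrable (lebesgue_on \<Omega>) (\<lambda>x. w x * partial i \<phi> x)"
    "integrable (lebesgue_on \<Omega>) (\<lambda>x. w x * \<phi> x)" if "w \<in> L2 (lebesgue_on \<Omega>)" for w
    using that sq by (auto simp: L2_iff_square_integrable intro: square_integrable_mult)
  have "(LINT x|lebesgue_on \<Omega>. (u x + c * v x) * partial i \<phi> x)
      = (LINT x|lebesgue_on \<Omega>. u x * partial i \<phi> x) + c * (LINT x|lebesgue_on \<Omega>. v x * partial i \<phi> x)"
    using assms by (simp add: distrib_right mult.assoc int)
  also have "\<dots> = - (LINT x|lebesgue_on \<Omega>. g x * \<phi> x) - c * (LINT x|lebesgue_on \<Omega>. h x * \<phi> x)"
    using assms \<phi> by (simp add: is_weak_partial_def)
  also have "\<dots> = - (LINT x|lebesgue_on \<Omega>. (g x + c * h x) * \<phi> x)"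
    using assms by (simp add: distrib_right mult.assoc int)
  finally show "(LINT x|lebesgue_on \<Omega>. (u x + c * v x) * partial i \<phi> x)
    = - (LINT x|lebesgue_on \<Omega>. (g x + c * h x) * \<phi> x)" .
qed

lemma H1_zero: "(\<lambda>x. 0) \<in> H1 \<Omega>"
proof -
  have "(\<lambda>x. 0) \<in> L2 (lebesgue_on \<Omega>)" "is_weak_partial \<Omega> i (\<lambda>x. 0) (\<lambda>x. 0)" for i
    by (simp_all add: L2_def is_weak_partial_def)
  then show ?thesis
    unfolding H1_def by blast
qed

lemma H1_lin:
  assumes "u \<in> H1 \<Omega>" "v \<in> H1 \<Omega>"
  shows "(\<lambda>x. u x + c * v x) \<in> H1 \<Omega>"
    and "AE x in lebesgue_on \<Omega>.
      weak_partial \<Omega> i (\<lambda>x. u x + c * v x) x = weak_partial \<Omega> i u x + c * weak_partial \<Omega> i v x"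
proof -
  note w = weak_partial[OF assms(1)] weak_partial[OF assms(2)]
  have g: "(\<lambda>x. weak_partial \<Omega> i u x + c * weak_partial \<Omega> i v x) \<in> L2 (lebesgue_on \<Omega>)"
    "is_weak_partial \<Omega> i (\<lambda>x. u x + c * v x) (\<lambda>x. weak_partial \<Omega> i u x + c * weak_partial \<Omega> i v x)" for i
    using assms w by (auto intro: L2_lin is_weak_partial_lin H1_L2)
  moreover have "(\<lambda>x. u x + c * v x) \<in> L2 (lebesgue_on \<Omega>)"
    using assms by (intro L2_lin H1_L2)
  ultimately show *: "(\<lambda>x. u x + c * v x) \<in> H1 \<Omega>"
    unfolding H1_def by blast
  show "AE x in lebesgue_on \<Omega>.
      weak_partial \<Omega> i (\<lambda>x. u x + c * v x) x = weak_partial \<Omega> i u x + c * weak_partial \<Omega> i v x"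
    using weak_partial[OF *] g by (rule weak_partial_unique)
qed

lemma weak_partial_zero: "AE x in lebesgue_on \<Omega>. weak_partial \<Omega> i (\<lambda>x. 0) x = 0"
  using weak_partial[OF H1_zero]
  by (rule weak_partial_unique) (auto simp: L2_def is_weak_partial_def)

lemma H1_scale:
  assumes "u \<in> H1 \<Omega>"
  shows "(\<lambda>x. c * u x) \<in> H1 \<Omega>"
    and "AE x in lebesgue_on \<Omega>. weak_partial \<Omega> i (\<lambda>x. c * u x) x = c * weak_partial \<Omega> i u x"
proof -
  show "(\<lambda>x. c * u x) \<in> H1 \<Omega>"
    using H1_lin(1)[OF H1_zero assms, of c] by simp
  show "AE x in lebesgue_on \<Omega>. weak_partial \<Omega> i (\<lambda>x. c * u x) x = c * weak_partial \<Omega> i u x"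
    using H1_lin(2)[OF H1_zero assms, of i c] weak_partial_zero[of i] by eventually_elim simp
qed

text \<open>Weak differentiation is a closed operator.\<close>

lemma is_weak_partial_limit:
  assumes "\<And>k. u k \<in> L2 (lebesgue_on \<Omega>)" "w \<in> L2 (lebesgue_on \<Omega>)"
    and "(\<lambda>k. LINT x|lebesgue_on \<Omega>. (u k x - w x)\<^sup>2) \<longlonglongrightarrow> 0"
    and "\<And>k. g k \<in> L2 (lebesgue_on \<Omega>)" "h \<in> L2 (lebesgue_on \<Omega>)"
    and "(\<lambda>k. LINT x|lebesgue_on \<Omega>. (g k x - h x)\<^sup>2) \<longlonglongrightarrow> 0"
    and weak: "\<And>k. is_weak_partial \<Omega> i (u k) (g k)"
  shows "is_weak_partial \<Omega> i w h"
  unfolding is_weak_partial_def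
proof
  fix \<phi> assume \<phi>: "\<phi> \<in> test_functions \<Omega>"
  have lim: "(\<lambda>k. LINT x|lebesgue_on \<Omega>. a k x * \<psi> x) \<longlonglongrightarrow> (LINT x|lebesgue_on \<Omega>. z x * \<psi> x)"
    if a: "\<And>k. a k \<in> L2 (lebesgue_on \<Omega>)" and z: "z \<in> L2 (lebesgue_on \<Omega>)"
      and conv: "(\<lambda>k. LINT x|lebesgue_on \<Omega>. (a k x - z x)\<^sup>2) \<longlonglongrightarrow> 0"
      and \<psi>: "square_integrable (lebesgue_on \<Omega>) \<psi>" for a :: "nat \<Rightarrow> real ^ 'n \<Rightarrow> real" and z \<psi>
  proof -
    have sq: "square_integrable (lebesgue_on \<Omega>) (a k)" "square_integrable (lebesgue_on \<Omega>) z" for k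
      using a z by (auto simp: L2_iff_square_integrable)
    have diff: "square_integrable (lebesgue_on \<Omega>) (\<lambda>x. a k x - z x)" for k
      using square_integrable_lin[OF sq, of k "-1"] by simp
    have "norm ((LINT x|lebesgue_on \<Omega>. a k x * \<psi> x) - (LINT x|lebesgue_on \<Omega>. z x * \<psi> x))
        \<le> sqrt (LINT x|lebesgue_on \<Omega>. (a k x - z x)\<^sup>2) * sqrt (LINT x|lebesgue_on \<Omega>. (\<psi> x)\<^sup>2)" for k
      using integral_Cauchy_Schwarz[OF diff \<psi>, of k] sq \<psi>
      by (simp add: left_diff_distrib square_integrable_mult)
    moreover have "(\<lambda>k. sqrt (LINT x|lebesgue_on \<Omega>. (a k x - z x)\<^sup>2) * sqrt (LINT x|lebesgue_on \<Omega>. (\<psi> x)\<^sup>2)) \<longlonglongrightarrow> 0"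
      using tendsto_mult_left_zero[OF tendsto_real_sqrt[OF conv, simplified]] by simp
    ultimately have "(\<lambda>k. (LINT x|lebesgue_on \<Omega>. a k x * \<psi> x) - (LINT x|lebesgue_on \<Omega>. z x * \<psi> x)) \<longlonglongrightarrow> 0"
      by (rule Lim_null_comparison[OF always_eventually[OF allI]])
    then show ?thesis
      by (simp add: LIM_zero_iff)
  qed
  have "(\<lambda>k. LINT x|lebesgue_on \<Omega>. u k x * partial i \<phi> x) \<longlonglongrightarrow> (LINT x|lebesgue_on \<Omega>. w x * partial i \<phi> x)"
    using assms test_function_square_integrable[OF \<phi>] by (intro lim)
  moreover have "(\<lambda>k. LINT x|lebesgue_on \<Omega>. u k x * partial i \<phi> x) \<longlonglongrightarrow> - (LINT x|lebesgue_on \<Omega>. h x * \<phi> x)"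
    using weak \<phi> assms test_function_square_integrable[OF \<phi>]
    by (simp add: is_weak_partial_def) (intro tendsto_minus lim)
  ultimately show "(LINT x|lebesgue_on \<Omega>. w x * partial i \<phi> x) = - (LINT x|lebesgue_on \<Omega>. h x * \<phi> x)"
    by (rule LIMSEQ_unique)
qed

lemma H1_complete:
  assumes u: "\<And>k. u k \<in> H1 \<Omega>"
    and c0: "\<And>e. 0 < e \<Longrightarrow> \<exists>N. \<forall>j\<ge>N. \<forall>k\<ge>N. (LINT x|lebesgue_on \<Omega>. (u j x - u k x)\<^sup>2) < e"
    and c1: "\<And>i e. 0 < e \<Longrightarrow> \<exists>N. \<forall>j\<ge>N. \<forall>k\<ge>N.
      (LINT x|lebesgue_on \<Omega>. (weak_partial \<Omega> i (u j) x - weak_partial \<Omega> i (u k) x)\<^sup>2) < e"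
  obtains w where "w \<in> H1 \<Omega>" "(\<lambda>k. LINT x|lebesgue_on \<Omega>. (u k x - w x)\<^sup>2) \<longlonglongrightarrow> 0"
    "\<And>i. (\<lambda>k. LINT x|lebesgue_on \<Omega>. (weak_partial \<Omega> i (u k) x - weak_partial \<Omega> i w x)\<^sup>2) \<longlonglongrightarrow> 0"
proof -
  obtain w where w: "w \<in> L2 (lebesgue_on \<Omega>)" "(\<lambda>k. LINT x|lebesgue_on \<Omega>. (u k x - w x)\<^sup>2) \<longlonglongrightarrow> 0"
    using L2_complete[OF H1_L2[OF u] c0] by blast
  have "\<forall>i. \<exists>h. h \<in> L2 (lebesgue_on \<Omega>) \<and>
      (\<lambda>k. LINT x|lebesgue_on \<Omega>. (weak_partial \<Omega> i (u k) x - h x)\<^sup>2) \<longlonglongrightarrow> 0"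
    using L2_complete[OF weak_partial(1)[OF u] c1] by (intro allI) blast
  from choice[OF this] obtain h where h: "\<And>i. h i \<in> L2 (lebesgue_on \<Omega>)"
    "\<And>i. (\<lambda>k. LINT x|lebesgue_on \<Omega>. (weak_partial \<Omega> i (u k) x - h i x)\<^sup>2) \<longlonglongrightarrow> 0"
    by blast
  have weak: "is_weak_partial \<Omega> i w (h i)" for i
    by (rule is_weak_partial_limit[OF H1_L2[OF u] w weak_partial(1)[OF u] h weak_partial(2)[OF u]])
  with w h have wH: "w \<in> H1 \<Omega>"
    by (auto simp: H1_def)
  have "(\<lambda>k. LINT x|lebesgue_on \<Omega>. (weak_partial \<Omega> i (u k) x - weak_partial \<Omega> i w x)\<^sup>2) \<longlonglongrightarrow> 0" for i
  proof -
    have ae: "AE x in lebesgue_on \<Omega>. h i x = weak_partial \<Omega> i w x"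
      using h(1) weak weak_partial[OF wH] by (rule weak_partial_unique)
    have [measurable]: "weak_partial \<Omega> i (u k) \<in> borel_measurable (lebesgue_on \<Omega>)"
      "weak_partial \<Omega> i w \<in> borel_measurable (lebesgue_on \<Omega>)" "h i \<in> borel_measurable (lebesgue_on \<Omega>)" for k
      using h(1)[of i] weak_partial(1)[OF u, of i] weak_partial(1)[OF wH, of i] by (auto simp: L2_def)
    have "(LINT x|lebesgue_on \<Omega>. (weak_partial \<Omega> i (u k) x - h i x)\<^sup>2)
        = (LINT x|lebesgue_on \<Omega>. (weak_partial \<Omega> i (u k) x - weak_partial \<Omega> i w x)\<^sup>2)" for k
      by (rule integral_cong_AE) (use ae in \<open>auto elim: eventually_mono\<close>)
    with h(2)[of i] show ?thesis by simp
  qed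
  with wH w(2) show ?thesis
    by (rule that)
qed

end

section \<open>Inner products in the Clifford algebra\<close>

text \<open>Both sides are inverse to \<open>e\<^sub>A\<close>, since \<open>(-e\<^sub>i) e\<^sub>i = 1\<close> and \<open>e\<^sub>A e\<^sub>A = \<plusminus>1\<close>.\<close>

lemma cl_conj_axis_factor:
  "cl_prod (map (\<lambda>i. - cl_gen i) (rev (sorted_list_of_set A)))
    = cl_sign A A *\<^sub>R axis A 1" for A :: "'n::{finite,linorder} set"
proof -
  have foldr_append: "foldr (\<odot>) xs y = foldr (\<odot>) xs cl_one \<odot> y" for xs and y :: "'n clifford"
    by (induction xs) (simp_all add: cl_mult_one_left cl_mult_assoc)
  have inv: "cl_prod (map (\<lambda>i. - cl_gen i) (rev xs)) \<odot> cl_prod (map cl_gen xs) = cl_one"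
    for xs :: "'n list"
  proof (induction xs)
    case Nil
    show ?case by (simp add: cl_prod_def cl_mult_one_left)
  next
    case (Cons i xs)
    have "- cl_gen i \<odot> cl_gen i = cl_one"
      using cl_mult_scaleR_left[of "-1" "cl_gen i" "cl_gen i"] by (simp add: cl_gen_square)
    then have "- cl_gen i \<odot> (cl_gen i \<odot> z) = z" for z
      by (simp add: cl_mult_one_left flip: cl_mult_assoc)
    moreover have "cl_prod (map (\<lambda>i. - cl_gen i) (rev (i # xs)))
        = cl_prod (map (\<lambda>i. - cl_gen i) (rev xs)) \<odot> - cl_gen i"
      by (simp add: cl_prod_def cl_mult_one_right) (rule foldr_append)
    moreover have "cl_prod (map cl_gen (i # xs)) = cl_gen i \<odot> cl_prod (map cl_gen xs)"
      by (simp add: cl_prod_def)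
    ultimately show ?case
      using Cons by (simp add: cl_mult_assoc)
  qed
  let ?c = "cl_prod (map (\<lambda>i. - cl_gen i) (rev (sorted_list_of_set A)))"
  have c: "?c \<odot> axis A 1 = cl_one"
    using inv[of "sorted_list_of_set A"] by (simp only: cl_prod_sorted)
  have sq: "axis A 1 \<odot> axis A 1 = cl_sign A A *\<^sub>R (cl_one :: 'n clifford)"
    by (simp add: cl_mult_axis cl_one_def)
  have "?c = ?c \<odot> ((cl_sign A A * cl_sign A A) *\<^sub>R cl_one)"
    by (simp add: cl_sign_square cl_mult_one_right)
  also have "\<dots> = cl_sign A A *\<^sub>R ((?c \<odot> axis A 1) \<odot> axis A 1)"
    by (simp add: cl_mult_assoc sq cl_mult_scaleR_right)
  also have "\<dots> = cl_sign A A *\<^sub>R axis A 1"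
    by (simp add: c cl_mult_one_left)
  finally show ?thesis .
qed

lemma cl_conj_eq: "cl_conj x = (\<Sum>A\<in>UNIV. (x $ A * cl_sign A A) *\<^sub>R axis A 1)"
  by (simp add: cl_conj_def cl_conj_axis_factor)

lemma cl_conj_nth: "cl_conj x $ A = x $ A * cl_sign A A"
  by (simp add: cl_conj_eq axis_def if_distrib cong: if_cong)

text \<open>Right multiplication by a basis element permutes the coefficients up to signs.\<close>

lemma cl_mult_axis_right_nth:
  "(x \<odot> axis C 1) $ A = x $ (sym_diff A C) * cl_sign (sym_diff A C) C"
proof -
  have "sym_diff B C = A \<longleftrightarrow> B = sym_diff A C" for B
    by blast
  then have ax: "axis (sym_diff B C) 1 $ A = (if B = sym_diff A C then 1 else 0 :: real)" for B
    by (auto simp: axis_def)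
  have "x \<odot> axis C 1 = (\<Sum>B\<in>UNIV. (x $ B * cl_sign B C) *\<^sub>R axis (sym_diff B C) 1)"
    by (subst clifford_expand[of x])
      (simp only: cl_mult_sum_left cl_mult_scaleR_left cl_mult_axis scaleR_scaleR)
  then show ?thesis
    by (simp add: ax if_distrib cong: if_cong)
qed

lemma Sc_mult: "Sc (x \<odot> y) = (\<Sum>A\<in>UNIV. x $ A * y $ A * cl_sign A A)"
proof -
  have "Sc (x \<odot> axis C 1) = x $ C * cl_sign C C" for C
    by (simp add: Sc_def cl_mult_axis_right_nth)
  moreover have "x \<odot> y = (\<Sum>C\<in>UNIV. y $ C *\<^sub>R (x \<odot> axis C 1))"
    by (subst clifford_expand[of y]) (simp only: cl_mult_sum_right cl_mult_scaleR_right)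
  ultimately show ?thesis
    by (simp add: Sc_def mult_ac)
qed

text \<open>The scalar part of \<open>\<langle>F, G\<rangle>\<close> is thus the real \<open>L\<^sup>2\<close> inner product of the coefficient vectors.\<close>

lemma Sc_conj_mult: "Sc (cl_conj x \<odot> y) = x \<bullet> y"
proof -
  have "x $ A * cl_sign A A * y $ A * cl_sign A A = x $ A * y $ A" for A
  proof -
    have "x $ A * cl_sign A A * y $ A * cl_sign A A = x $ A * y $ A * (cl_sign A A * cl_sign A A)"
      by (simp only: mult_ac)
    then show ?thesis by (simp add: cl_sign_square)
  qed
  then show ?thesis
    by (simp only: Sc_mult cl_conj_nth inner_vec_def inner_real_def)
qed

text \<open>A Clifford number is determined by the scalar parts of its right multiples.\<close>

lemma clifford_eqI_Sc:
  assumes "\<And>C. Sc (x \<odot> axis C 1) = Sc (y \<odot> axis C 1)"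
  shows "x = y"
proof -
  have "cl_sign C C \<noteq> 0" for C :: "'a set"
    using cl_sign_square[of C C] by auto
  with assms show ?thesis
    by (simp add: vec_eq_iff Sc_def cl_mult_axis_right_nth)
qed

lemma bounded_bilinear_cl_mult: "bounded_bilinear ((\<odot>) :: 'n::{finite,linorder} clifford \<Rightarrow> _)"
  unfolding bilinear_conv_bounded_bilinear[symmetric] bilinear_def
  by (auto intro!: linearI simp: cl_mult_add_left cl_mult_add_right cl_mult_scaleR_left cl_mult_scaleR_right)

lemma bounded_linear_Sc: "bounded_linear Sc"
  unfolding Sc_def[abs_def] by (rule bounded_linear_vec_nth)

lemma bounded_linear_cl_conj: "bounded_linear (cl_conj :: 'n::{finite,linorder} clifford \<Rightarrow> _)"
  by (rule linear_conv_bounded_linear[THEN iffD1])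
    (auto intro!: linearI simp: vec_eq_iff cl_conj_nth algebra_simps)

lemma norm_cl_gen_mult: "norm (cl_gen i \<odot> y) = norm y"
proof -
  have nth: "(cl_gen i \<odot> y) $ A = y $ (sym_diff {i} A) * cl_sign {i} (sym_diff {i} A)" for A
  proof -
    have "sym_diff {i} B = A \<longleftrightarrow> B = sym_diff {i} A" for B
      by blast
    then have ax: "axis (sym_diff {i} B) 1 $ A = (if B = sym_diff {i} A then 1 else 0 :: real)" for B
      by (auto simp: axis_def)
    have "cl_gen i \<odot> y = (\<Sum>B\<in>UNIV. (y $ B * cl_sign {i} B) *\<^sub>R axis (sym_diff {i} B) 1)"
      unfolding cl_gen_def by (subst clifford_expand[of y])
        (simp only: cl_mult_sum_right cl_mult_scaleR_right cl_mult_axis scaleR_scaleR)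
    then show ?thesis
      by (simp add: ax if_distrib cong: if_cong)
  qed
  have "((cl_gen i \<odot> y) $ A)\<^sup>2 = (y $ (sym_diff {i} A))\<^sup>2" for A
    using cl_sign_square[of "{i}" "sym_diff {i} A"]
    by (simp only: nth power_mult_distrib) (simp add: power2_eq_square)
  then have "(\<Sum>A\<in>UNIV. ((cl_gen i \<odot> y) $ A)\<^sup>2) = (\<Sum>A\<in>UNIV. (y $ (sym_diff {i} A))\<^sup>2)"
    by simp
  also have "\<dots> = (\<Sum>A\<in>UNIV. (y $ A)\<^sup>2)"
    by (rule sum.reindex_bij_witness[of _ "sym_diff {i}" "sym_diff {i}"]) auto
  finally show ?thesis
    by (simp add: norm_vec_def L2_set_def)
qed

text \<open>Left multiplications by generators are skew-adjoint isometries that anticommute, so that the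
  vectors \<open>e\<^sub>i y\<close> are orthogonal of length \<open>\<bar>y\<bar>\<close>.\<close>

lemma norm_cl_vec_mult: "norm (cl_vec x \<odot> y) = norm x * norm y"
proof -
  have gen: "cl_gen i \<odot> (cl_gen i \<odot> y) = - y" for i and y :: "'a clifford"
    using cl_mult_scaleR_left[of "-1" cl_one y]
    by (simp add: cl_gen_square cl_mult_one_left flip: cl_mult_assoc)
  have iso: "(cl_gen i \<odot> a) \<bullet> (cl_gen i \<odot> b) = a \<bullet> b" for i and a b :: "'a clifford"
  proof -
    have "(norm (cl_gen i \<odot> (a + b)))\<^sup>2 = (norm (a + b))\<^sup>2"
      by (simp only: norm_cl_gen_mult)
    moreover have "(cl_gen i \<odot> a) \<bullet> (cl_gen i \<odot> a) = a \<bullet> a" for a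
      using norm_cl_gen_mult[of i a] by (simp only: norm_eq)
    ultimately show ?thesis
      by (simp add: power2_norm_eq_inner cl_mult_add_right inner_add_left inner_add_right inner_commute)
  qed
  have skew: "(cl_gen i \<odot> a) \<bullet> b = - (a \<bullet> (cl_gen i \<odot> b))" for i and a b :: "'a clifford"
    using iso[of i "cl_gen i \<odot> a" b] by (simp add: gen)
  have anti: "(cl_gen i \<odot> y) \<bullet> (cl_gen j \<odot> y) = (if i = j then y \<bullet> y else 0)" for i j
  proof (cases "i = j")
    case True
    then show ?thesis by (simp add: iso)
  next
    case False
    have "(cl_gen i \<odot> y) \<bullet> (cl_gen j \<odot> y) = - (y \<bullet> (cl_gen i \<odot> (cl_gen j \<odot> y)))"
      by (rule skew)
    also have "\<dots> = y \<bullet> (cl_gen j \<odot> (cl_gen i \<odot> y))"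
      using cl_gen_anticommute[OF False] cl_mult_scaleR_left[of "-1" "cl_gen j \<odot> cl_gen i" y]
      by (simp flip: cl_mult_assoc)
    also have "\<dots> = - ((cl_gen j \<odot> y) \<bullet> (cl_gen i \<odot> y))"
      by (simp add: skew)
    finally show ?thesis
      using False by (simp add: inner_commute)
  qed
  have "(cl_vec x \<odot> y) \<bullet> (cl_vec x \<odot> y) = (\<Sum>i\<in>UNIV. \<Sum>j\<in>UNIV. x $ i * (x $ j * ((cl_gen j \<odot> y) \<bullet> (cl_gen i \<odot> y))))"
    by (simp add: cl_vec_def cl_mult_sum_left cl_mult_scaleR_left inner_sum_left inner_sum_right sum_distrib_left)
  also have "\<dots> = (\<Sum>i\<in>UNIV. x $ i * x $ i) * (y \<bullet> y)"
    by (simp add: anti if_distrib sum_distrib_right mult.assoc cong: if_cong)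
  finally have "(norm (cl_vec x \<odot> y))\<^sup>2 = (norm x * norm y)\<^sup>2"
    by (simp add: power2_norm_eq_inner power_mult_distrib inner_vec_def)
  then show ?thesis
    by simp
qed

section \<open>Clifford-valued functions\<close>

lemma power2_norm_vec: "(norm (x :: real ^ 'm::finite))\<^sup>2 = (\<Sum>A\<in>UNIV. (x $ A)\<^sup>2)"
  by (simp add: norm_vec_def L2_set_def sum_nonneg)

lemma L2_cl_iff_square_integrable:
  fixes F :: "'a \<Rightarrow> 'n::{finite,linorder} clifford"
  shows "F \<in> L2_cl M \<longleftrightarrow> square_integrable M F"
proof
  assume F: "F \<in> L2_cl M"
  have "square_integrable M (\<lambda>x. \<Sum>A\<in>UNIV. F x $ A *\<^sub>R axis A 1 :: 'n clifford)"
  proof (rule square_integrable_sum)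
    fix A
    have "square_integrable M (\<lambda>x. F x $ A)"
      using F by (simp add: L2_cl_def L2_iff_square_integrable)
    then show "square_integrable M (\<lambda>x. F x $ A *\<^sub>R axis A 1 :: 'n clifford)"
      by (rule square_integrable_dominated[where K = 1])
        (use \<open>square_integrable M (\<lambda>x. F x $ A)\<close> in \<open>auto simp: square_integrable_def\<close>)
  qed simp
  then show "square_integrable M F"
    by (simp flip: clifford_expand)
next
  assume F: "square_integrable M F"
  have "square_integrable M (\<lambda>x. F x $ A)" for A
    using F by (rule square_integrable_dominated[where K = 1])
      (use F in \<open>auto simp: square_integrable_def component_le_norm_cart
        intro: measurable_compose[OF _ borel_measurable_continuous_onI[OF continuous_on_component]]\<close>)
  then show "F \<in> L2_cl M"
    by (simp add: L2_cl_def L2_iff_square_integrable)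
qed

lemma bounded_bilinear_conj_mult:
  "bounded_bilinear (\<lambda>x y. cl_conj x \<odot> (y :: 'n::{finite,linorder} clifford))"
  by (rule bounded_bilinear.comp1[OF bounded_bilinear_cl_mult bounded_linear_cl_conj])

lemma Sc_inner_cl:
  assumes "square_integrable M F" "square_integrable M G"
  shows "Sc (inner_cl M F G) = (LINT x|M. F x \<bullet> G x)"
  unfolding inner_cl_def
  by (subst integral_bounded_linear[OF bounded_linear_Sc, symmetric])
    (auto intro: square_integrable_bilinear[OF bounded_bilinear_conj_mult] assms simp: Sc_conj_mult)

lemma inner_cl_mult_right:
  assumes "square_integrable M F" "square_integrable M G"
  shows "inner_cl M F (\<lambda>x. G x \<odot> a) = inner_cl M F G \<odot> a"
  unfolding inner_cl_def cl_mult_assoc[symmetric]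
  by (intro integral_bounded_linear bounded_bilinear.bounded_linear_left[OF bounded_bilinear_cl_mult]
      square_integrable_bilinear[OF bounded_bilinear_conj_mult] assms)

lemma inner_cl_cong_AE:
  assumes "square_integrable M F" "square_integrable M G" "square_integrable M G'"
    and "AE x in M. G x = G' x"
  shows "inner_cl M F G = inner_cl M F G'"
  unfolding inner_cl_def
  using assms by (intro integral_cong_AE borel_measurable_integrable
      square_integrable_bilinear[OF bounded_bilinear_conj_mult]) (auto elim: eventually_mono)

lemma norm2_cl_eq:
  "square_integrable M F \<Longrightarrow> norm2_cl M F = sqrt (LINT x|M. (norm (F x))\<^sup>2)"
  by (simp add: norm2_cl_def Sc_inner_cl power2_norm_eq_inner)

lemma square_integrable_mult_axis:
  fixes F :: "'a \<Rightarrow> 'n::{finite,linorder} clifford"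
  assumes "square_integrable M F"
  shows "square_integrable M (\<lambda>x. F x \<odot> axis C 1)"
proof -
  have "bounded_linear (\<lambda>x :: 'n clifford. x \<odot> axis C 1)"
    by (rule bounded_bilinear.bounded_linear_left[OF bounded_bilinear_cl_mult])
  then obtain K where K: "\<And>x :: 'n clifford. norm (x \<odot> axis C 1) \<le> norm x * K"
    and cont: "continuous_on UNIV (\<lambda>x :: 'n clifford. x \<odot> axis C 1)"
    by (meson bounded_linear.bounded linear_continuous_on)
  show ?thesis
    using assms
  proof (rule square_integrable_dominated[where K = K])
    show "(\<lambda>x. F x \<odot> axis C 1) \<in> borel_measurable M"
      using assms by (intro measurable_compose[OF _ borel_measurable_continuous_onI[OF cont]])
        (simp add: square_integrable_def)
  qed (use K in \<open>simp add: mult.commute\<close>)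
qed

lemma inner_cl_mult_axis_AE:
  assumes "square_integrable M X" "square_integrable M Y" "square_integrable M Z"
    and "AE x in M. Z x = Y x \<odot> axis C 1"
  shows "inner_cl M X Z = inner_cl M X Y \<odot> axis C 1"
  using inner_cl_cong_AE[OF assms(1,3) square_integrable_mult_axis[OF assms(2)] assms(4)]
    inner_cl_mult_right[OF assms(1,2)] by simp

lemma integral_norm2_components:
  assumes "\<And>A. (\<lambda>x. F x $ A) \<in> L2 M"
  shows "(LINT x|M. (norm (F x :: real ^ 'm::finite))\<^sup>2) = (\<Sum>A\<in>UNIV. LINT x|M. (F x $ A)\<^sup>2)"
  using assms by (simp add: power2_norm_vec L2_def)

text \<open>The real inner product of \<open>H\<^sup>1(\<Omega>, \<real>\<^sub>n)\<close>, for which \<open>H1_inner \<Omega> F F = \<parallel>F\<parallel>\<^sub>2\<^sup>2 + \<parallel>F\<parallel>\<^sub>D\<^sup>2\<close>.\<close>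

definition H1_inner :: "'n rn set \<Rightarrow> ('n rn \<Rightarrow> 'n::{finite,linorder} clifford) \<Rightarrow>
    ('n rn \<Rightarrow> 'n clifford) \<Rightarrow> real" where
  "H1_inner \<Omega> F G = (LINT x|lebesgue_on \<Omega>. F x \<bullet> G x)
     + (\<Sum>i\<in>UNIV. LINT x|lebesgue_on \<Omega>. weak_partial_cl \<Omega> i F x \<bullet> weak_partial_cl \<Omega> i G x)"

text \<open>The pointwise linear combination \<open>F + c G\<close>.\<close>

definition lin_fun :: "('a \<Rightarrow> 'b::real_vector) \<Rightarrow> real \<Rightarrow> ('a \<Rightarrow> 'b) \<Rightarrow> 'a \<Rightarrow> 'b" where
  "lin_fun F c G x = F x + c *\<^sub>R G x"

locale bounded_open_cl = bounded_open \<Omega> for \<Omega> :: "'n::{finite,linorder} rn set"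
begin

abbreviation "\<Lambda> \<equiv> lebesgue_on \<Omega>"

lemma H1_cl_square_integrable: "F \<in> H1_cl \<Omega> \<Longrightarrow> square_integrable \<Lambda> F"
  unfolding L2_cl_iff_square_integrable[symmetric] by (simp add: H1_cl_def L2_cl_def H1_L2)

lemma weak_partial_cl_square_integrable:
  "F \<in> H1_cl \<Omega> \<Longrightarrow> square_integrable \<Lambda> (weak_partial_cl \<Omega> i F)"
  unfolding L2_cl_iff_square_integrable[symmetric]
  by (simp add: H1_cl_def L2_cl_def weak_partial_cl_def weak_partial)

lemma H1_cl_zero: "(\<lambda>x. 0) \<in> H1_cl \<Omega>"
  by (simp add: H1_cl_def H1_zero)

lemma H1_cl_lin:
  assumes "F \<in> H1_cl \<Omega>" "G \<in> H1_cl \<Omega>"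
  shows "lin_fun F c G \<in> H1_cl \<Omega>"
    and "AE x in \<Lambda>. weak_partial_cl \<Omega> i (lin_fun F c G) x
      = weak_partial_cl \<Omega> i F x + c *\<^sub>R weak_partial_cl \<Omega> i G x"
proof -
  have H: "(\<lambda>x. F x $ A) \<in> H1 \<Omega>" "(\<lambda>x. G x $ A) \<in> H1 \<Omega>" for A
    using assms by (simp_all add: H1_cl_def)
  show "lin_fun F c G \<in> H1_cl \<Omega>"
    using H1_lin(1)[OF H] by (simp add: H1_cl_def lin_fun_def)
  have "AE x in \<Lambda>. \<forall>A. weak_partial \<Omega> i (\<lambda>y. F y $ A + c * G y $ A) x
      = weak_partial \<Omega> i (\<lambda>y. F y $ A) x + c * weak_partial \<Omega> i (\<lambda>y. G y $ A) x"
    unfolding AE_all_countable using H by (intro allI H1_lin(2))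
  then show "AE x in \<Lambda>. weak_partial_cl \<Omega> i (lin_fun F c G) x
      = weak_partial_cl \<Omega> i F x + c *\<^sub>R weak_partial_cl \<Omega> i G x"
    by eventually_elim (simp add: vec_eq_iff weak_partial_cl_def lin_fun_def)
qed

lemma H1_cl_mult_axis:
  assumes "F \<in> H1_cl \<Omega>"
  shows "(\<lambda>x. F x \<odot> axis C 1) \<in> H1_cl \<Omega>"
    and "AE x in \<Lambda>. weak_partial_cl \<Omega> i (\<lambda>x. F x \<odot> axis C 1) x
      = weak_partial_cl \<Omega> i F x \<odot> axis C 1"
proof -
  have H: "(\<lambda>x. F x $ A) \<in> H1 \<Omega>" for A
    using assms by (simp add: H1_cl_def)
  show "(\<lambda>x. F x \<odot> axis C 1) \<in> H1_cl \<Omega>"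
    using H1_scale(1)[OF H] by (simp add: H1_cl_def cl_mult_axis_right_nth mult.commute)
  have "AE x in \<Lambda>. \<forall>A. weak_partial \<Omega> i (\<lambda>y. cl_sign (sym_diff A C) C * F y $ (sym_diff A C)) x
      = cl_sign (sym_diff A C) C * weak_partial \<Omega> i (\<lambda>y. F y $ (sym_diff A C)) x"
    unfolding AE_all_countable using H by (intro allI H1_scale(2))
  then show "AE x in \<Lambda>. weak_partial_cl \<Omega> i (\<lambda>x. F x \<odot> axis C 1) x
      = weak_partial_cl \<Omega> i F x \<odot> axis C 1"
    by eventually_elim (simp add: vec_eq_iff weak_partial_cl_def cl_mult_axis_right_nth mult.commute)
qed

lemma H1_inner_same:
  assumes "F \<in> H1_cl \<Omega>"
  shows "H1_inner \<Omega> F F = (norm2_cl \<Lambda> F)\<^sup>2 + (normD_cl \<Omega> F)\<^sup>2"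
  using assms by (simp add: H1_inner_def normD_cl_def norm2_cl_eq H1_cl_square_integrable
      weak_partial_cl_square_integrable sum_nonneg power2_norm_eq_inner)

lemma H1_inner_components:
  assumes "F \<in> H1_cl \<Omega>"
  shows "H1_inner \<Omega> F F = (\<Sum>A\<in>UNIV. (H1_norm \<Omega> (\<lambda>x. F x $ A))\<^sup>2)"
proof -
  have H: "(\<lambda>x. F x $ A) \<in> H1 \<Omega>" for A
    using assms by (simp add: H1_cl_def)
  have "H1_inner \<Omega> F F = (\<Sum>A\<in>UNIV. LINT x|\<Lambda>. (F x $ A)\<^sup>2)
      + (\<Sum>i\<in>UNIV. \<Sum>A\<in>UNIV. LINT x|\<Lambda>. (weak_partial \<Omega> i (\<lambda>y. F y $ A) x)\<^sup>2)"
    using H by (simp add: H1_inner_def integral_norm2_components H1_L2 weak_partial weak_partial_cl_def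
        flip: power2_norm_eq_inner)
  also have "\<dots> = (\<Sum>A\<in>UNIV. (LINT x|\<Lambda>. (F x $ A)\<^sup>2)
      + (\<Sum>i\<in>UNIV. LINT x|\<Lambda>. (weak_partial \<Omega> i (\<lambda>y. F y $ A) x)\<^sup>2))"
    by (subst sum.swap) (simp add: sum.distrib)
  finally show ?thesis
    by (simp add: H1_norm_def L2_norm_def sum_nonneg)
qed

lemma H1_inner_lin:
  assumes "F \<in> H1_cl \<Omega>" "G \<in> H1_cl \<Omega>" "K \<in> H1_cl \<Omega>"
  shows "H1_inner \<Omega> (lin_fun F c G) K = H1_inner \<Omega> F K + c * H1_inner \<Omega> G K"
proof -
  have P: "(LINT x|\<Lambda>. weak_partial_cl \<Omega> i (lin_fun F c G) x \<bullet> weak_partial_cl \<Omega> i K x)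
      = (LINT x|\<Lambda>. weak_partial_cl \<Omega> i F x \<bullet> weak_partial_cl \<Omega> i K x)
      + c * (LINT x|\<Lambda>. weak_partial_cl \<Omega> i G x \<bullet> weak_partial_cl \<Omega> i K x)" for i
    by (intro integral_inner_lin weak_partial_cl_square_integrable H1_cl_lin assms)
  have Z: "(LINT x|\<Lambda>. lin_fun F c G x \<bullet> K x) = (LINT x|\<Lambda>. F x \<bullet> K x) + c * (LINT x|\<Lambda>. G x \<bullet> K x)"
    by (intro integral_inner_lin H1_cl_square_integrable H1_cl_lin(1) assms) (simp add: lin_fun_def)
  show ?thesis
    unfolding H1_inner_def P Z by (simp add: sum.distrib sum_distrib_left distrib_left)
qed

lemma H1_inner_diff:
  assumes "F \<in> H1_cl \<Omega>" "G \<in> H1_cl \<Omega>"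
  shows "H1_inner \<Omega> (lin_fun F (-1) G) (lin_fun F (-1) G)
    = (\<Sum>A\<in>UNIV. (LINT x|\<Lambda>. (F x $ A - G x $ A)\<^sup>2)
      + (\<Sum>i\<in>UNIV. LINT x|\<Lambda>. (weak_partial \<Omega> i (\<lambda>y. F y $ A) x - weak_partial \<Omega> i (\<lambda>y. G y $ A) x)\<^sup>2))"
proof -
  have H: "(\<lambda>x. F x $ A) \<in> H1 \<Omega>" "(\<lambda>x. G x $ A) \<in> H1 \<Omega>" for A
    using assms by (simp_all add: H1_cl_def)
  have "(LINT x|\<Lambda>. (weak_partial \<Omega> i (\<lambda>y. F y $ A + -1 * G y $ A) x)\<^sup>2)
      = (LINT x|\<Lambda>. (weak_partial \<Omega> i (\<lambda>y. F y $ A) x - weak_partial \<Omega> i (\<lambda>y. G y $ A) x)\<^sup>2)" for i A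
  proof (rule integral_cong_AE)
    show "AE x in \<Lambda>. (weak_partial \<Omega> i (\<lambda>y. F y $ A + -1 * G y $ A) x)\<^sup>2
      = (weak_partial \<Omega> i (\<lambda>y. F y $ A) x - weak_partial \<Omega> i (\<lambda>y. G y $ A) x)\<^sup>2"
      using H1_lin(2)[OF H(1)[of A] H(2)[of A], of i "-1"] by eventually_elim simp
    have [measurable]: "weak_partial \<Omega> i u \<in> borel_measurable \<Lambda>" if "u \<in> H1 \<Omega>" for u
      using weak_partial(1)[OF that, of i] by (simp add: L2_def)
    note [measurable] = this[OF H(1)] this[OF H(2)] this[OF H1_lin(1)[OF H(1)[of A] H(2)[of A], of "-1"]]
    show "(\<lambda>x. (weak_partial \<Omega> i (\<lambda>y. F y $ A + -1 * G y $ A) x)\<^sup>2) \<in> borel_measurable \<Lambda>"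
      "(\<lambda>x. (weak_partial \<Omega> i (\<lambda>y. F y $ A) x - weak_partial \<Omega> i (\<lambda>y. G y $ A) x)\<^sup>2) \<in> borel_measurable \<Lambda>"
      by measurable
  qed
  then show ?thesis
    using H1_cl_lin(1)[OF assms]
    by (simp add: H1_inner_components H1_norm_def L2_norm_def sum_nonneg) (simp add: lin_fun_def)
qed

text \<open>As elements of \<open>H\<^sup>1\<close> are represented by functions, the inner product is only semidefinite.\<close>

lemma semi_hilbert_H1: "semi_hilbert (H1_cl \<Omega>) lin_fun (H1_inner \<Omega>)"
proof
  show "H1_cl \<Omega> \<noteq> {}"
    using H1_cl_zero by blast
next
  fix F G K c assume "F \<in> H1_cl \<Omega>" "G \<in> H1_cl \<Omega>" "K \<in> H1_cl \<Omega>"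
  then show "H1_inner \<Omega> (lin_fun F c G) K = H1_inner \<Omega> F K + c * H1_inner \<Omega> G K"
    by (rule H1_inner_lin)
next
  fix F assume "F \<in> H1_cl \<Omega>"
  then show "0 \<le> H1_inner \<Omega> F F"
    by (simp add: H1_inner_same)
next
  fix U :: "nat \<Rightarrow> 'n rn \<Rightarrow> 'n clifford"
  assume U: "\<And>k. U k \<in> H1_cl \<Omega>"
    and cauchy: "\<And>e. 0 < e \<Longrightarrow> \<exists>N. \<forall>j\<ge>N. \<forall>k\<ge>N.
      H1_inner \<Omega> (lin_fun (U j) (-1) (U k)) (lin_fun (U j) (-1) (U k)) < e"
  have H: "(\<lambda>x. U k x $ A) \<in> H1 \<Omega>" for k A
    using U by (simp add: H1_cl_def)
  define D0 where "D0 A F G = (LINT x|\<Lambda>. (F x $ A - G x $ A)\<^sup>2)" for A and F G :: "'n rn \<Rightarrow> 'n clifford"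
  define D1 where "D1 i A F G = (LINT x|\<Lambda>. (weak_partial \<Omega> i (\<lambda>y. F y $ A) x
    - weak_partial \<Omega> i (\<lambda>y. G y $ A) x)\<^sup>2)" for i A and F G :: "'n rn \<Rightarrow> 'n clifford"
  have D_nonneg: "0 \<le> D0 A F G" "0 \<le> D1 i A F G" for i A F G
    by (simp_all add: D0_def D1_def)
  have diff: "H1_inner \<Omega> (lin_fun F (-1) G) (lin_fun F (-1) G)
      = (\<Sum>A\<in>UNIV. D0 A F G + (\<Sum>i\<in>UNIV. D1 i A F G))" if "F \<in> H1_cl \<Omega>" "G \<in> H1_cl \<Omega>" for F G
    unfolding D0_def D1_def by (rule H1_inner_diff[OF that])
  have le: "D0 A F G + (\<Sum>i\<in>UNIV. D1 i A F G) \<le> H1_inner \<Omega> (lin_fun F (-1) G) (lin_fun F (-1) G)"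
    if "F \<in> H1_cl \<Omega>" "G \<in> H1_cl \<Omega>" for A F G
    unfolding diff[OF that]
    by (rule member_le_sum[of A UNIV "\<lambda>A. D0 A F G + (\<Sum>i\<in>UNIV. D1 i A F G)"])
      (auto intro!: add_nonneg_nonneg sum_nonneg D_nonneg)
  have le0: "D0 A F G \<le> H1_inner \<Omega> (lin_fun F (-1) G) (lin_fun F (-1) G)"
    if "F \<in> H1_cl \<Omega>" "G \<in> H1_cl \<Omega>" for A F G
    using le[OF that, of A] sum_nonneg[of UNIV "\<lambda>i. D1 i A F G"] D_nonneg by auto
  have le1: "D1 i A F G \<le> H1_inner \<Omega> (lin_fun F (-1) G) (lin_fun F (-1) G)"
    if "F \<in> H1_cl \<Omega>" "G \<in> H1_cl \<Omega>" for i A F G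
    using le[OF that, of A] member_le_sum[of i UNIV "\<lambda>i. D1 i A F G"] D_nonneg(1)[of A F G] D_nonneg(2)
    by auto
  have c0: "\<exists>N. \<forall>j\<ge>N. \<forall>k\<ge>N. D0 A (U j) (U k) < e" if "0 < e" for e A
    using cauchy[OF that] le0[OF U U, of A] by (meson le_less_trans)
  have c1: "\<exists>N. \<forall>j\<ge>N. \<forall>k\<ge>N. D1 i A (U j) (U k) < e" if "0 < e" for e i A
    using cauchy[OF that] le1[OF U U, of i A] by (meson le_less_trans)
  have "\<forall>A. \<exists>w. w \<in> H1 \<Omega> \<and> (\<lambda>k. LINT x|\<Lambda>. (U k x $ A - w x)\<^sup>2) \<longlonglongrightarrow> 0 \<and>
      (\<forall>i. (\<lambda>k. LINT x|\<Lambda>. (weak_partial \<Omega> i (\<lambda>y. U k y $ A) x - weak_partial \<Omega> i w x)\<^sup>2) \<longlonglongrightarrow> 0)"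
  proof
    fix A
    show "\<exists>w. w \<in> H1 \<Omega> \<and> (\<lambda>k. LINT x|\<Lambda>. (U k x $ A - w x)\<^sup>2) \<longlonglongrightarrow> 0 \<and>
      (\<forall>i. (\<lambda>k. LINT x|\<Lambda>. (weak_partial \<Omega> i (\<lambda>y. U k y $ A) x - weak_partial \<Omega> i w x)\<^sup>2) \<longlonglongrightarrow> 0)"
      by (rule H1_complete[of "\<lambda>k x. U k x $ A", OF H c0[of _ A, unfolded D0_def]
            c1[of _ _ A, unfolded D1_def]]) blast+
  qed
  from choice[OF this] obtain w where w: "\<And>A. w A \<in> H1 \<Omega>"
    "\<And>A. (\<lambda>k. LINT x|\<Lambda>. (U k x $ A - w A x)\<^sup>2) \<longlonglongrightarrow> 0"
    "\<And>i A. (\<lambda>k. LINT x|\<Lambda>. (weak_partial \<Omega> i (\<lambda>y. U k y $ A) x - weak_partial \<Omega> i (w A) x)\<^sup>2) \<longlonglongrightarrow> 0"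
    by blast
  define W where "W x = (\<chi> A. w A x)" for x
  have W: "W \<in> H1_cl \<Omega>"
    using w(1) by (simp add: H1_cl_def W_def)
  have "(\<lambda>k. \<Sum>A\<in>UNIV. D0 A (U k) W + (\<Sum>i\<in>UNIV. D1 i A (U k) W)) \<longlonglongrightarrow> (\<Sum>A\<in>(UNIV :: 'n set set). 0 + (\<Sum>i\<in>(UNIV :: 'n set). 0))"
    using w(2,3) by (intro tendsto_sum tendsto_add) (simp_all add: D0_def D1_def W_def)
  then show "\<exists>W\<in>H1_cl \<Omega>. (\<lambda>k. H1_inner \<Omega> (lin_fun (U k) (-1) W) (lin_fun (U k) (-1) W)) \<longlonglongrightarrow> 0"
    using W by (intro bexI[of _ W]) (simp_all add: diff[OF U W])
qed (simp_all add: H1_cl_lin H1_inner_def inner_commute)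

end

section \<open>The lower order terms of the Robin form\<close>

text \<open>The terms of order at most one, as a function of the point \<open>x\<close>, the derivatives \<open>P i\<close> and
  the value \<open>Y\<close>; \<open>k\<close> stands for \<open>\<bar>s\<bar>\<^sup>2 + n\<^sup>2\<close>.\<close>

definition robin_low :: "real \<Rightarrow> real \<Rightarrow> 'n::{finite,linorder} rn \<Rightarrow>
    ('n \<Rightarrow> 'n clifford) \<Rightarrow> 'n clifford \<Rightarrow> 'n clifford" where
  "robin_low s0 k x P Y =
     (2 * (2 + real CARD('n))) *\<^sub>R ((1 + (norm x)\<^sup>2) *\<^sub>R (\<Sum>i\<in>UNIV. x $ i *\<^sub>R P i))
   + 2 *\<^sub>R ((1 + (norm x)\<^sup>2) *\<^sub>R (cl_vec x \<odot> (\<Sum>i\<in>UNIV. cl_gen i \<odot> P i)))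
   - (2 * s0) *\<^sub>R ((1 + (norm x)\<^sup>2) *\<^sub>R (\<Sum>i\<in>UNIV. cl_gen i \<odot> P i)
       - real CARD('n) *\<^sub>R (cl_vec x \<odot> Y))
   + k *\<^sub>R Y"

lemma robin_low_lin:
  "robin_low s0 k x (\<lambda>i. P i + c *\<^sub>R Q i) (Y + c *\<^sub>R Z)
    = robin_low s0 k x P Y + c *\<^sub>R robin_low s0 k x Q Z"
proof -
  have D: "(\<Sum>i\<in>UNIV. cl_gen i \<odot> (P i + c *\<^sub>R Q i))
      = (\<Sum>i\<in>UNIV. cl_gen i \<odot> P i) + c *\<^sub>R (\<Sum>i\<in>UNIV. cl_gen i \<odot> Q i)"
    by (simp add: cl_mult_add_right cl_mult_scaleR_right sum.distrib scaleR_sum_right)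
  have E: "(\<Sum>i\<in>UNIV. x $ i *\<^sub>R (P i + c *\<^sub>R Q i))
      = (\<Sum>i\<in>UNIV. x $ i *\<^sub>R P i) + c *\<^sub>R (\<Sum>i\<in>UNIV. x $ i *\<^sub>R Q i)"
    by (simp add: scaleR_add_right sum.distrib scaleR_sum_right mult.commute)
  show ?thesis
    unfolding robin_low_def D E
    unfolding cl_mult_add_right cl_mult_scaleR_right
    by (simp add: algebra_simps)
qed

text \<open>Here \<open>1 \<le> \<surd>n\<close> is used to bound \<open>(2 + n) + \<surd>n\<close>, the contributions of \<open>E\<close> and \<open>x D\<^sub>e\<close>, by
  \<open>\<surd>n (3 + n)\<close>.\<close>

lemma robin_low_bound:
  fixes x :: "'n::{finite,linorder} rn"
  assumes "norm x \<le> M"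
  defines "n \<equiv> real CARD('n)"
  shows "norm (robin_low s0 k x P Y - k *\<^sub>R Y)
    \<le> 2 * (sqrt n * (1 + M\<^sup>2) * ((3 + n) * M + \<bar>s0\<bar>)) * L2_set (\<lambda>i. norm (P i)) UNIV
      + 2 * \<bar>s0\<bar> * n * M * norm Y"
proof -
  define g where "g = L2_set (\<lambda>i. norm (P i)) UNIV"
  define w where "w = 1 + (norm x)\<^sup>2"
  define E where "E = (\<Sum>i\<in>UNIV. x $ i *\<^sub>R P i)"
  define D where "D = (\<Sum>i\<in>UNIV. cl_gen i \<odot> P i)"
  have "1 \<le> n"
    by (simp add: n_def Suc_leI)
  then have n: "1 \<le> sqrt n" by simp
  have "0 \<le> M"
    using assms(1) norm_ge_zero[of x] by linarith
  have g: "0 \<le> g"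
    by (simp add: g_def)
  have w: "0 \<le> w" "w \<le> 1 + M\<^sup>2"
    using assms(1) by (simp_all add: w_def power_mono)
  have "norm E \<le> (\<Sum>i\<in>UNIV. \<bar>x $ i\<bar> * \<bar>norm (P i)\<bar>)"
    unfolding E_def by (rule sum_norm_le) simp
  also have "\<dots> \<le> norm x * g"
  proof -
    have "norm x = L2_set (\<lambda>i. x $ i) UNIV"
      by (simp add: norm_vec_def L2_set_def)
    then show ?thesis
      unfolding g_def by (simp only: L2_set_mult_ineq)
  qed
  also have "\<dots> \<le> M * g"
    by (intro mult_right_mono assms g)
  finally have E: "norm E \<le> M * g" .
  have "norm D \<le> (\<Sum>i\<in>UNIV. \<bar>1\<bar> * \<bar>norm (P i)\<bar>)"
    unfolding D_def by (rule sum_norm_le) (simp add: norm_cl_gen_mult)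
  also have "\<dots> \<le> sqrt n * g"
    using L2_set_mult_ineq[of "\<lambda>_. 1" "\<lambda>i. norm (P i)" "UNIV :: 'n set"]
    by (simp add: g_def n_def L2_set_def)
  finally have D: "norm D \<le> sqrt n * g" .
  have wE: "norm (w *\<^sub>R E) \<le> (1 + M\<^sup>2) * (M * g)"
    using w E by (auto intro!: mult_mono)
  have wD: "norm (w *\<^sub>R D) \<le> (1 + M\<^sup>2) * (sqrt n * g)"
    using w D by (auto intro!: mult_mono)
  have wxD: "norm (w *\<^sub>R (cl_vec x \<odot> D)) \<le> (1 + M\<^sup>2) * (M * (sqrt n * g))"
    using w D assms(1) \<open>0 \<le> M\<close> by (auto simp: norm_cl_vec_mult intro!: mult_mono mult_nonneg_nonneg)
  have xY: "norm (n *\<^sub>R (cl_vec x \<odot> Y)) \<le> n * (M * norm Y)"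
    using assms(1) \<open>1 \<le> n\<close> \<open>0 \<le> M\<close> by (auto simp: norm_cl_vec_mult intro!: mult_mono)
  have "robin_low s0 k x P Y - k *\<^sub>R Y = (2 * (2 + n)) *\<^sub>R (w *\<^sub>R E) + 2 *\<^sub>R (w *\<^sub>R (cl_vec x \<odot> D))
      - (2 * s0) *\<^sub>R (w *\<^sub>R D - n *\<^sub>R (cl_vec x \<odot> Y))"
    by (simp add: robin_low_def w_def E_def D_def n_def)
  also have "norm \<dots> \<le> norm ((2 * (2 + n)) *\<^sub>R (w *\<^sub>R E)) + norm (2 *\<^sub>R (w *\<^sub>R (cl_vec x \<odot> D)))
      + norm ((2 * s0) *\<^sub>R (w *\<^sub>R D - n *\<^sub>R (cl_vec x \<odot> Y)))"
    by (meson norm_triangle_ineq norm_triangle_ineq4 order_trans add_right_mono)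
  also have "\<dots> = 2 * (2 + n) * norm (w *\<^sub>R E) + 2 * norm (w *\<^sub>R (cl_vec x \<odot> D))
      + 2 * \<bar>s0\<bar> * norm (w *\<^sub>R D - n *\<^sub>R (cl_vec x \<odot> Y))"
    using \<open>1 \<le> n\<close> by (simp only: norm_scaleR) (simp add: abs_mult)
  also have "\<dots> \<le> 2 * (2 + n) * ((1 + M\<^sup>2) * (M * g)) + 2 * ((1 + M\<^sup>2) * (M * (sqrt n * g)))
      + 2 * \<bar>s0\<bar> * ((1 + M\<^sup>2) * (sqrt n * g) + n * (M * norm Y))"
  proof (intro add_mono mult_left_mono wE wxD)
    show "norm (w *\<^sub>R D - n *\<^sub>R (cl_vec x \<odot> Y)) \<le> (1 + M\<^sup>2) * (sqrt n * g) + n * (M * norm Y)"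
      using norm_triangle_ineq4 wD xY by (rule order_trans[OF _ add_mono])
  qed (use \<open>1 \<le> n\<close> in auto)
  also have "\<dots> = 2 * (1 + M\<^sup>2) * g * (2 + n) * M + 2 * (1 + M\<^sup>2) * g * (sqrt n * M + sqrt n * \<bar>s0\<bar>)
      + 2 * \<bar>s0\<bar> * n * M * norm Y"
    by (simp add: algebra_simps)
  also have "2 * (1 + M\<^sup>2) * g * (2 + n) * M \<le> 2 * (1 + M\<^sup>2) * g * (2 + n) * M * sqrt n"
  proof -
    have "0 \<le> 2 * (1 + M\<^sup>2) * g * (2 + n) * M"
      using \<open>0 \<le> M\<close> g \<open>1 \<le> n\<close> by simp
    from mult_left_mono[OF n this] show ?thesis by simp
  qed
  finally show ?thesis
    unfolding g_def[symmetric] by (simp add: algebra_simps)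
qed

context bounded_open_cl
begin

lemma square_integrable_continuous_mult:
  fixes pr :: "'b::euclidean_space \<Rightarrow> 'c::euclidean_space \<Rightarrow> 'd::euclidean_space"
  assumes "bounded_bilinear pr" "continuous_on UNIV a" "square_integrable \<Lambda> F"
  shows "square_integrable \<Lambda> (\<lambda>x. pr (a x) (F x))"
proof -
  obtain K where K: "\<And>x y. norm (pr x y) \<le> norm x * norm y * K" "0 \<le> K"
    using bounded_bilinear.nonneg_bounded[OF assms(1)] by blast
  have "compact (a ` closure \<Omega>)"
    using bounded_domain assms(2)
    by (intro compact_continuous_image) (auto simp: compact_closure intro: continuous_on_subset)
  then obtain C where C: "\<And>x. x \<in> \<Omega> \<Longrightarrow> norm (a x) \<le> C"
    using closure_subset[of \<Omega>] by (force dest!: compact_imp_bounded simp: bounded_iff)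
  have cont: "continuous_on UNIV (\<lambda>x. pr (fst x) (snd x))"
    by (rule bounded_bilinear.continuous_on[OF assms(1)]) (auto intro: continuous_intros)
  show ?thesis
    using assms(3)
  proof (rule square_integrable_dominated)
    show "(\<lambda>x. pr (a x) (F x)) \<in> borel_measurable \<Lambda>"
      using assms(3) continuous_square_integrable[OF assms(2)] cont
      by (intro borel_measurable_continuous_Pair[where H = pr]) (auto simp: square_integrable_def)
    show "AE x in \<Lambda>. norm (pr (a x) (F x)) \<le> (C * K) * norm (F x)"
    proof (rule AE_I2)
      fix x assume "x \<in> space \<Lambda>"
      then have "norm (a x) * norm (F x) * K \<le> C * norm (F x) * K"
        using C K(2) by (intro mult_right_mono) auto
      with K(1)[of "a x" "F x"] show "norm (pr (a x) (F x)) \<le> (C * K) * norm (F x)"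
        by (simp add: mult_ac)
    qed
  qed
qed

lemmas square_integrable_continuous_scaleR =
  square_integrable_continuous_mult[OF bounded_bilinear_scaleR]
lemmas square_integrable_continuous_cl_mult =
  square_integrable_continuous_mult[OF bounded_bilinear_cl_mult]

lemma continuous_on_cl_vec: "continuous_on S cl_vec"
  unfolding cl_vec_def by (intro continuous_intros)

lemma square_integrable_cl_gen_sum:
  assumes "\<And>i. square_integrable \<Lambda> (P i)"
  shows "square_integrable \<Lambda> (\<lambda>x. \<Sum>i\<in>UNIV. cl_gen i \<odot> P i x)"
  using assms by (intro square_integrable_sum square_integrable_continuous_cl_mult continuous_intros) auto

lemma square_integrable_euler_sum:
  assumes "\<And>i. square_integrable \<Lambda> (P i)"
  shows "square_integrable \<Lambda> (\<lambda>x. \<Sum>i\<in>UNIV. x $ i *\<^sub>R P i x)"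
  using assms by (intro square_integrable_sum square_integrable_continuous_scaleR continuous_intros) auto

lemmas square_integrable_terms = square_integrable_scaleR square_integrable_add
  square_integrable_continuous_scaleR square_integrable_continuous_cl_mult continuous_on_cl_vec
  square_integrable_cl_gen_sum square_integrable_euler_sum

lemma square_integrable_robin_low:
  assumes "\<And>i. square_integrable \<Lambda> (P i)" "square_integrable \<Lambda> Y"
  shows "square_integrable \<Lambda> (\<lambda>x. robin_low s0 k x (\<lambda>i. P i x) (Y x))"
  unfolding robin_low_def using assms
  by (intro square_integrable_terms square_integrable_diff continuous_intros) auto

end


section \<open>The boundary coefficient and the trace inequality\<close>

lemma Linfty_norm_AE:
  assumes "b \<in> Linfty M"
  shows "AE x in M. \<bar>b x\<bar> \<le> Linfty_norm M b"
  using esssup_AE[of "\<lambda>x. ereal \<bar>b x\<bar>" M]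
proof eventually_elim
  case (elim x)
  moreover have "esssup M (\<lambda>x. ereal \<bar>b x\<bar>) < \<infinity>"
    using assms by (simp add: Linfty_def)
  ultimately show ?case
    unfolding Linfty_norm_def by (cases "esssup M (\<lambda>x. ereal \<bar>b x\<bar>)") auto
qed

text \<open>For the zero measure the essential supremum is \<open>-\<infinity>\<close>, and \<open>Linfty_norm\<close> takes the default value \<open>0\<close>.\<close>

lemma Linfty_norm_nonneg:
  assumes "b \<in> Linfty M"
  shows "0 \<le> Linfty_norm M b"
proof (cases "emeasure M (space M) = 0")
  case True
  moreover have "(\<lambda>x. ereal \<bar>b x\<bar>) \<in> borel_measurable M"
    using assms by (intro borel_measurable_ereal borel_measurable_abs) (simp add: Linfty_def)
  ultimately have "esssup M (\<lambda>x. ereal \<bar>b x\<bar>) = - \<infinity>"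
    by (rule esssup_zero_space)
  then show ?thesis
    by (simp add: Linfty_norm_def)
next
  case False
  show ?thesis
  proof (rule ccontr)
    assume "\<not> 0 \<le> Linfty_norm M b"
    with Linfty_norm_AE[OF assms] have "AE x in M. False"
      by (auto elim!: eventually_mono)
    with False show False
      by (simp add: eventually_False ae_filter_eq_bot_iff)
  qed
qed

lemma trace_cl_lin_component:
  "trace_cl \<tau> (lin_fun F c G) x $ A = \<tau> (\<lambda>y. 1 * F y $ A + c * G y $ A) x"
  by (simp add: trace_cl_def lin_fun_def)

locale robin_problem = bounded_open_cl \<Omega> for \<Omega> :: "'n::{finite,linorder} rn set" +
  fixes b :: "'n rn \<Rightarrow> real" and \<tau> :: "('n rn \<Rightarrow> real) \<Rightarrow> ('n rn \<Rightarrow> real)"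
  assumes b_Linfty: "b \<in> Linfty (surface_measure \<Omega>)"
    and trace: "dirichlet_trace \<Omega> \<tau>"
begin

abbreviation "\<sigma> \<equiv> surface_measure \<Omega>"
abbreviation "\<beta> \<equiv> Linfty_norm \<sigma> b"
abbreviation "T \<equiv> trace_norm \<Omega> \<tau>"

lemma trace_L2: "u \<in> H1 \<Omega> \<Longrightarrow> \<tau> u \<in> L2 \<sigma>"
  using trace by (simp add: dirichlet_trace_def)

lemma trace_lin: "\<lbrakk>u \<in> H1 \<Omega>; v \<in> H1 \<Omega>\<rbrakk> \<Longrightarrow>
    AE x in \<sigma>. \<tau> (\<lambda>y. \<alpha> * u y + \<gamma> * v y) x = \<alpha> * \<tau> u x + \<gamma> * \<tau> v x"
  using trace by (simp add: dirichlet_trace_def)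

lemma trace_cl_square_integrable:
  assumes "F \<in> H1_cl \<Omega>"
  shows "square_integrable \<sigma> (trace_cl \<tau> F)"
  unfolding L2_cl_iff_square_integrable[symmetric]
  using assms by (simp add: L2_cl_def H1_cl_def trace_cl_def trace_L2)

lemma trace_cl_lin:
  assumes "F \<in> H1_cl \<Omega>" "G \<in> H1_cl \<Omega>"
  shows "AE x in \<sigma>. trace_cl \<tau> (lin_fun F c G) x = trace_cl \<tau> F x + c *\<^sub>R trace_cl \<tau> G x"
proof -
  have H: "(\<lambda>x. F x $ A) \<in> H1 \<Omega>" "(\<lambda>x. G x $ A) \<in> H1 \<Omega>" for A
    using assms by (simp_all add: H1_cl_def)
  have "AE x in \<sigma>. \<forall>A. \<tau> (\<lambda>y. 1 * F y $ A + c * G y $ A) x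
      = 1 * \<tau> (\<lambda>y. F y $ A) x + c * \<tau> (\<lambda>y. G y $ A) x"
    unfolding AE_all_countable using H by (intro allI trace_lin)
  then show ?thesis
    by eventually_elim (simp add: vec_eq_iff trace_cl_lin_component, simp add: trace_cl_def)
qed

lemma trace_scale:
  assumes "u \<in> H1 \<Omega>"
  shows "AE x in \<sigma>. \<tau> (\<lambda>y. c * u y) x = c * \<tau> u x"
  using trace_lin[OF assms assms, of c 0] by simp

lemma trace_cl_mult_axis:
  assumes "F \<in> H1_cl \<Omega>"
  shows "AE x in \<sigma>. trace_cl \<tau> (\<lambda>x. F x \<odot> axis C 1) x = trace_cl \<tau> F x \<odot> axis C 1"
proof -
  have H: "(\<lambda>x. F x $ A) \<in> H1 \<Omega>" for A
    using assms by (simp add: H1_cl_def)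
  have "AE x in \<sigma>. \<forall>A. \<tau> (\<lambda>y. cl_sign (sym_diff A C) C * F y $ (sym_diff A C)) x
      = cl_sign (sym_diff A C) C * \<tau> (\<lambda>y. F y $ (sym_diff A C)) x"
    unfolding AE_all_countable using H by (intro allI trace_scale)
  then show ?thesis
    by eventually_elim (simp add: vec_eq_iff trace_cl_def cl_mult_axis_right_nth mult.commute)
qed

lemma normH1_cl_eq: "F \<in> H1_cl \<Omega> \<Longrightarrow> normH1_cl \<Omega> F = sqrt (H1_inner \<Omega> F F)"
  by (simp add: normH1_cl_def H1_inner_same)

lemma trace_cl_bounded:
  obtains C where "\<And>F. F \<in> H1_cl \<Omega> \<Longrightarrow> norm2_cl \<sigma> (trace_cl \<tau> F) \<le> C * normH1_cl \<Omega> F"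
proof -
  obtain C where C: "\<And>u. u \<in> H1 \<Omega> \<Longrightarrow> L2_norm \<sigma> (\<tau> u) \<le> C * H1_norm \<Omega> u"
    using trace unfolding dirichlet_trace_def by blast
  show ?thesis
  proof (rule that[of "\<bar>C\<bar>"])
    fix F assume F: "F \<in> H1_cl \<Omega>"
    then have H: "(\<lambda>x. F x $ A) \<in> H1 \<Omega>" for A
      by (simp add: H1_cl_def)
    have "(norm2_cl \<sigma> (trace_cl \<tau> F))\<^sup>2 = (\<Sum>A\<in>UNIV. (L2_norm \<sigma> (\<tau> (\<lambda>y. F y $ A)))\<^sup>2)"
      using H by (simp add: norm2_cl_eq trace_cl_square_integrable[OF F] integral_norm2_components
          trace_cl_def trace_L2 L2_norm_def sum_nonneg)
    also have "\<dots> \<le> (\<Sum>A\<in>UNIV. (C * H1_norm \<Omega> (\<lambda>y. F y $ A))\<^sup>2)"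
      by (intro sum_mono power_mono C H) (simp add: L2_norm_def)
    also have "\<dots> = C\<^sup>2 * H1_inner \<Omega> F F"
      by (simp add: H1_inner_components[OF F] power_mult_distrib sum_distrib_left)
    also have "\<dots> = (\<bar>C\<bar> * normH1_cl \<Omega> F)\<^sup>2"
      by (simp add: normH1_cl_eq[OF F] power_mult_distrib H1_inner_same[OF F])
    finally show "norm2_cl \<sigma> (trace_cl \<tau> F) \<le> \<bar>C\<bar> * normH1_cl \<Omega> F"
      by (rule power2_le_imp_le) (simp add: normH1_cl_def)
  qed
qed

text \<open>The supremum defining the operator norm is taken over a set that is bounded above, by the
  boundedness of the scalar trace applied to each component.\<close>

lemma trace_norm_bound:
  assumes F: "F \<in> H1_cl \<Omega>"
  shows "norm2_cl \<sigma> (trace_cl \<tau> F) \<le> T * normH1_cl \<Omega> F"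
proof -
  obtain C where C: "\<And>F. F \<in> H1_cl \<Omega> \<Longrightarrow> norm2_cl \<sigma> (trace_cl \<tau> F) \<le> C * normH1_cl \<Omega> F"
    by (rule trace_cl_bounded) blast
  have N0: "0 \<le> normH1_cl \<Omega> F" for F
    by (simp add: normH1_cl_def)
  have "norm2_cl \<sigma> (trace_cl \<tau> F) \<le> \<bar>C\<bar>" if "F \<in> H1_cl \<Omega>" "normH1_cl \<Omega> F \<le> 1" for F
  proof -
    have "C * normH1_cl \<Omega> F \<le> \<bar>C\<bar> * 1"
      using that N0 by (intro mult_mono) auto
    with C[OF that(1)] show ?thesis by simp
  qed
  then have bdd: "bdd_above ((\<lambda>F. norm2_cl \<sigma> (trace_cl \<tau> F)) ` {F \<in> H1_cl \<Omega>. normH1_cl \<Omega> F \<le> 1})"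
    by (auto simp: bdd_above_def)
  show ?thesis
  proof (cases "normH1_cl \<Omega> F = 0")
    case True
    with C[OF F] show ?thesis by simp
  next
    case False
    with N0[of F] have pos: "0 < normH1_cl \<Omega> F"
      by linarith
    define c where "c = 1 / normH1_cl \<Omega> F"
    define G where "G = lin_fun (\<lambda>x. 0) c F"
    have c: "0 < c"
      using pos by (simp add: c_def)
    have G: "G \<in> H1_cl \<Omega>"
      unfolding G_def by (intro H1_cl_lin H1_cl_zero F)
    interpret semi_hilbert "H1_cl \<Omega>" lin_fun "H1_inner \<Omega>"
      by (rule semi_hilbert_H1)
    have "H1_inner \<Omega> (\<lambda>x. 0) K = 0" if "K \<in> H1_cl \<Omega>" for K
    proof -
      have "lin_fun (\<lambda>x :: 'n rn. 0 :: 'n clifford) 1 (\<lambda>x. 0) = (\<lambda>x. 0)"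
        by (simp add: lin_fun_def fun_eq_iff)
      with ip_lin_left[OF H1_cl_zero H1_cl_zero that, of 1] show ?thesis by simp
    qed
    then have "H1_inner \<Omega> G G = c\<^sup>2 * H1_inner \<Omega> F F"
      unfolding G_def by (simp add: ip_lin_lin H1_cl_zero F)
    then have "normH1_cl \<Omega> G = 1"
      using pos c by (simp add: normH1_cl_eq G F real_sqrt_mult c_def)
    then have "norm2_cl \<sigma> (trace_cl \<tau> G) \<le> T"
      unfolding trace_norm_def using G by (intro cSUP_upper bdd) simp
    moreover have "norm2_cl \<sigma> (trace_cl \<tau> G) = c * norm2_cl \<sigma> (trace_cl \<tau> F)"
    proof -
      have H: "(\<lambda>x. F x $ A) \<in> H1 \<Omega>" for A
        using F by (simp add: H1_cl_def)
      have "AE x in \<sigma>. \<forall>A. \<tau> (\<lambda>y. c * F y $ A) x = c * \<tau> (\<lambda>y. F y $ A) x"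
        unfolding AE_all_countable using H by (intro allI trace_scale)
      then have "AE x in \<sigma>. trace_cl \<tau> G x = c *\<^sub>R trace_cl \<tau> F x"
        by eventually_elim (simp add: vec_eq_iff trace_cl_def G_def lin_fun_def)
      then have "(LINT x|\<sigma>. (norm (trace_cl \<tau> G x))\<^sup>2) = (LINT x|\<sigma>. c\<^sup>2 * (norm (trace_cl \<tau> F x))\<^sup>2)"
        using trace_cl_square_integrable[OF G] trace_cl_square_integrable[OF F]
        by (intro integral_cong_AE) (auto simp: square_integrable_def power_mult_distrib elim!: eventually_mono)
      then show ?thesis
        using c by (simp add: norm2_cl_eq trace_cl_square_integrable F G real_sqrt_mult)
    qed
    ultimately show ?thesis
      using pos by (simp add: c_def field_simps)
  qed
qed

end

section \<open>The scalar part of the Robin form\<close>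

lemma Sc_add: "Sc (x + y) = Sc x + Sc y" and Sc_diff: "Sc (x - y) = Sc x - Sc y"
  and Sc_scaleR: "Sc (c *\<^sub>R x) = c * Sc x" and Sc_sum: "Sc (\<Sum>i\<in>I. g i) = (\<Sum>i\<in>I. Sc (g i))"
  by (simp_all add: Sc_def)

text \<open>The scalar part of the Robin form, with \<open>k\<close> standing for \<open>\<bar>s\<bar>\<^sup>2 + n\<^sup>2\<close>.\<close>

definition robin_scalar_form :: "'n rn set \<Rightarrow> ('n rn \<Rightarrow> real) \<Rightarrow>
    (('n rn \<Rightarrow> real) \<Rightarrow> ('n rn \<Rightarrow> real)) \<Rightarrow> real \<Rightarrow> real \<Rightarrow>
    ('n rn \<Rightarrow> 'n clifford) \<Rightarrow> ('n rn \<Rightarrow> 'n::{finite,linorder} clifford) \<Rightarrow> real" where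
  "robin_scalar_form \<Omega> b \<tau> s0 k F G =
     (\<Sum>i\<in>UNIV. LINT x|lebesgue_on \<Omega>.
        ((1 + (norm x)\<^sup>2)\<^sup>2 *\<^sub>R weak_partial_cl \<Omega> i F x) \<bullet> weak_partial_cl \<Omega> i G x)
   + (LINT x|lebesgue_on \<Omega>. robin_low s0 k x (\<lambda>i. weak_partial_cl \<Omega> i F x) (F x) \<bullet> G x)
   + (LINT x|surface_measure \<Omega>. (b x *\<^sub>R trace_cl \<tau> F x) \<bullet> trace_cl \<tau> G x)"

context robin_problem
begin

lemma weighted_partial_square_integrable:
  "F \<in> H1_cl \<Omega> \<Longrightarrow> square_integrable \<Lambda> (\<lambda>x. (1 + (norm x)\<^sup>2)\<^sup>2 *\<^sub>R weak_partial_cl \<Omega> i F x)"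
  by (intro square_integrable_continuous_scaleR continuous_intros weak_partial_cl_square_integrable)

lemma robin_low_square_integrable:
  "F \<in> H1_cl \<Omega> \<Longrightarrow>
    square_integrable \<Lambda> (\<lambda>x. robin_low s0 k x (\<lambda>i. weak_partial_cl \<Omega> i F x) (F x))"
  by (intro square_integrable_robin_low weak_partial_cl_square_integrable H1_cl_square_integrable)

lemma AE_b: "AE x in \<sigma>. \<bar>b x\<bar> \<le> \<beta>"
  by (rule Linfty_norm_AE[OF b_Linfty])

lemma weighted_trace_square_integrable:
  assumes "F \<in> H1_cl \<Omega>"
  shows "square_integrable \<sigma> (\<lambda>x. b x *\<^sub>R trace_cl \<tau> F x)"
proof (rule square_integrable_dominated[OF trace_cl_square_integrable[OF assms]])
  show "(\<lambda>x. b x *\<^sub>R trace_cl \<tau> F x) \<in> borel_measurable \<sigma>"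
    using b_Linfty trace_cl_square_integrable[OF assms] by (auto simp: Linfty_def square_integrable_def)
  show "AE x in \<sigma>. norm (b x *\<^sub>R trace_cl \<tau> F x) \<le> \<beta> * norm (trace_cl \<tau> F x)"
    using AE_b by eventually_elim (simp add: mult_right_mono)
qed

lemma robin_terms_square_integrable:
  assumes F: "F \<in> H1_cl \<Omega>"
  shows "square_integrable \<Lambda> (\<lambda>x. (1 + (norm x)\<^sup>2) *\<^sub>R euler \<Omega> F x)"
    and "square_integrable \<Lambda> (\<lambda>x. (1 + (norm x)\<^sup>2) *\<^sub>R (cl_vec x \<odot> dirac_e \<Omega> F x))"
    and "square_integrable \<Lambda> (dirac_S \<Omega> F)"
proof -
  note sqP = weak_partial_cl_square_integrable[OF F]
  have sqD: "square_integrable \<Lambda> (dirac_e \<Omega> F)"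
    unfolding dirac_e_def[abs_def] by (intro square_integrable_cl_gen_sum sqP)
  show "square_integrable \<Lambda> (\<lambda>x. (1 + (norm x)\<^sup>2) *\<^sub>R euler \<Omega> F x)"
    unfolding euler_def by (intro square_integrable_terms continuous_intros sqP)
  show "square_integrable \<Lambda> (\<lambda>x. (1 + (norm x)\<^sup>2) *\<^sub>R (cl_vec x \<odot> dirac_e \<Omega> F x))"
    by (intro square_integrable_terms continuous_intros sqD)
  show "square_integrable \<Lambda> (dirac_S \<Omega> F)"
    unfolding dirac_S_def[abs_def] by (intro square_integrable_diff square_integrable_terms
        continuous_intros sqD H1_cl_square_integrable F)
qed

lemma Sc_robin_form:
  assumes F: "F \<in> H1_cl \<Omega>" and G: "G \<in> H1_cl \<Omega>"
  shows "Sc (robin_form \<Omega> b \<tau> s F G)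
    = robin_scalar_form \<Omega> b \<tau> (Sc s) ((norm s)\<^sup>2 + (real CARD('n))\<^sup>2) F G"
proof -
  note sqF = H1_cl_square_integrable[OF F] and sqG = H1_cl_square_integrable[OF G]
  note sq1 = robin_terms_square_integrable(1)[OF F] and sq2 = robin_terms_square_integrable(2)[OF F]
    and sq3 = robin_terms_square_integrable(3)[OF F]
  have "(LINT x|\<Lambda>. robin_low (Sc s) ((norm s)\<^sup>2 + (real CARD('n))\<^sup>2) x (\<lambda>i. weak_partial_cl \<Omega> i F x) (F x) \<bullet> G x)
      = (LINT x|\<Lambda>. (2 * (2 + real CARD('n))) * (((1 + (norm x)\<^sup>2) *\<^sub>R euler \<Omega> F x) \<bullet> G x)
        + 2 * (((1 + (norm x)\<^sup>2) *\<^sub>R (cl_vec x \<odot> dirac_e \<Omega> F x)) \<bullet> G x)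
        - (2 * Sc s) * (dirac_S \<Omega> F x \<bullet> G x) + ((norm s)\<^sup>2 + (real CARD('n))\<^sup>2) * (F x \<bullet> G x))"
    unfolding robin_low_def euler_def[symmetric] dirac_e_def[symmetric] dirac_S_def[symmetric]
    by (simp only: inner_add_left inner_diff_left inner_scaleR_left)
  also have "\<dots> = (2 * (2 + real CARD('n))) * (LINT x|\<Lambda>. ((1 + (norm x)\<^sup>2) *\<^sub>R euler \<Omega> F x) \<bullet> G x)
        + 2 * (LINT x|\<Lambda>. ((1 + (norm x)\<^sup>2) *\<^sub>R (cl_vec x \<odot> dirac_e \<Omega> F x)) \<bullet> G x)
        - (2 * Sc s) * (LINT x|\<Lambda>. dirac_S \<Omega> F x \<bullet> G x)
        + ((norm s)\<^sup>2 + (real CARD('n))\<^sup>2) * (LINT x|\<Lambda>. F x \<bullet> G x)"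
    using square_integrable_inner[OF sq1 sqG] square_integrable_inner[OF sq2 sqG]
      square_integrable_inner[OF sq3 sqG] square_integrable_inner[OF sqF sqG]
    by (simp del: inner_scaleR_left)
  finally show ?thesis
    unfolding robin_form_def robin_scalar_form_def Sc_add Sc_diff Sc_scaleR Sc_sum
      Sc_inner_cl[OF sq1 sqG] Sc_inner_cl[OF sq2 sqG] Sc_inner_cl[OF sq3 sqG] Sc_inner_cl[OF sqF sqG]
      Sc_inner_cl[OF weighted_partial_square_integrable[OF F] weak_partial_cl_square_integrable[OF G]]
      Sc_inner_cl[OF weighted_trace_square_integrable[OF F] trace_cl_square_integrable[OF G]]
    by simp
qed

lemma robin_form_mult_axis:
  assumes F: "F \<in> H1_cl \<Omega>" and G: "G \<in> H1_cl \<Omega>"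
  shows "robin_form \<Omega> b \<tau> s F (\<lambda>x. G x \<odot> axis C 1) = robin_form \<Omega> b \<tau> s F G \<odot> axis C 1"
proof -
  note sqF = H1_cl_square_integrable[OF F] and sqG = H1_cl_square_integrable[OF G]
  note sq1 = robin_terms_square_integrable(1)[OF F] and sq2 = robin_terms_square_integrable(2)[OF F]
    and sq3 = robin_terms_square_integrable(3)[OF F]
  note GC = H1_cl_mult_axis[OF G]
  have P: "inner_cl \<Lambda> (\<lambda>x. (1 + (norm x)\<^sup>2)\<^sup>2 *\<^sub>R weak_partial_cl \<Omega> i F x) (weak_partial_cl \<Omega> i (\<lambda>x. G x \<odot> axis C 1))
      = inner_cl \<Lambda> (\<lambda>x. (1 + (norm x)\<^sup>2)\<^sup>2 *\<^sub>R weak_partial_cl \<Omega> i F x) (weak_partial_cl \<Omega> i G) \<odot> axis C 1" for i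
    by (intro inner_cl_mult_axis_AE weighted_partial_square_integrable weak_partial_cl_square_integrable F G GC)
  have B: "inner_cl \<sigma> (\<lambda>x. b x *\<^sub>R trace_cl \<tau> F x) (trace_cl \<tau> (\<lambda>x. G x \<odot> axis C 1))
      = inner_cl \<sigma> (\<lambda>x. b x *\<^sub>R trace_cl \<tau> F x) (trace_cl \<tau> G) \<odot> axis C 1"
    by (intro inner_cl_mult_axis_AE weighted_trace_square_integrable trace_cl_square_integrable
        trace_cl_mult_axis F G GC)
  have minus: "(x - y) \<odot> z = x \<odot> z - y \<odot> z" for x y z :: "'n clifford"
    by (rule bounded_bilinear.diff_left[OF bounded_bilinear_cl_mult])
  show ?thesis
    unfolding robin_form_def P B inner_cl_mult_right[OF sq1 sqG] inner_cl_mult_right[OF sq2 sqG]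
      inner_cl_mult_right[OF sq3 sqG] inner_cl_mult_right[OF sqF sqG]
    by (simp only: cl_mult_add_left minus cl_mult_scaleR_left cl_mult_sum_left)
qed

lemma robin_scalar_form_lin_left:
  assumes F: "F \<in> H1_cl \<Omega>" and G: "G \<in> H1_cl \<Omega>" and K: "K \<in> H1_cl \<Omega>"
  shows "robin_scalar_form \<Omega> b \<tau> s0 k (lin_fun F c G) K
    = robin_scalar_form \<Omega> b \<tau> s0 k F K + c * robin_scalar_form \<Omega> b \<tau> s0 k G K"
proof -
  note L = H1_cl_lin(1)[OF F G, of c]
  have 1: "(LINT x|\<Lambda>. ((1 + (norm x)\<^sup>2)\<^sup>2 *\<^sub>R weak_partial_cl \<Omega> i (lin_fun F c G) x) \<bullet> weak_partial_cl \<Omega> i K x)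
      = (LINT x|\<Lambda>. ((1 + (norm x)\<^sup>2)\<^sup>2 *\<^sub>R weak_partial_cl \<Omega> i F x) \<bullet> weak_partial_cl \<Omega> i K x)
      + c * (LINT x|\<Lambda>. ((1 + (norm x)\<^sup>2)\<^sup>2 *\<^sub>R weak_partial_cl \<Omega> i G x) \<bullet> weak_partial_cl \<Omega> i K x)" for i
  proof (intro integral_inner_lin weighted_partial_square_integrable weak_partial_cl_square_integrable F G K L)
    show "AE x in \<Lambda>. (1 + (norm x)\<^sup>2)\<^sup>2 *\<^sub>R weak_partial_cl \<Omega> i (lin_fun F c G) x
      = (1 + (norm x)\<^sup>2)\<^sup>2 *\<^sub>R weak_partial_cl \<Omega> i F x + c *\<^sub>R (1 + (norm x)\<^sup>2)\<^sup>2 *\<^sub>R weak_partial_cl \<Omega> i G x"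
      using H1_cl_lin(2)[OF F G, of i c] by eventually_elim (simp add: scaleR_add_right mult.commute)
  qed
  have 2: "(LINT x|\<Lambda>. robin_low s0 k x (\<lambda>i. weak_partial_cl \<Omega> i (lin_fun F c G) x) (lin_fun F c G x) \<bullet> K x)
      = (LINT x|\<Lambda>. robin_low s0 k x (\<lambda>i. weak_partial_cl \<Omega> i F x) (F x) \<bullet> K x)
      + c * (LINT x|\<Lambda>. robin_low s0 k x (\<lambda>i. weak_partial_cl \<Omega> i G x) (G x) \<bullet> K x)"
  proof (intro integral_inner_lin robin_low_square_integrable H1_cl_square_integrable F G K L)
    have "AE x in \<Lambda>. \<forall>i. weak_partial_cl \<Omega> i (lin_fun F c G) x
        = weak_partial_cl \<Omega> i F x + c *\<^sub>R weak_partial_cl \<Omega> i G x"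
      unfolding AE_all_countable using F G by (intro allI H1_cl_lin(2))
    then show "AE x in \<Lambda>. robin_low s0 k x (\<lambda>i. weak_partial_cl \<Omega> i (lin_fun F c G) x) (lin_fun F c G x)
      = robin_low s0 k x (\<lambda>i. weak_partial_cl \<Omega> i F x) (F x)
        + c *\<^sub>R robin_low s0 k x (\<lambda>i. weak_partial_cl \<Omega> i G x) (G x)"
      by eventually_elim (simp add: lin_fun_def robin_low_lin)
  qed
  have 3: "(LINT x|\<sigma>. (b x *\<^sub>R trace_cl \<tau> (lin_fun F c G) x) \<bullet> trace_cl \<tau> K x)
      = (LINT x|\<sigma>. (b x *\<^sub>R trace_cl \<tau> F x) \<bullet> trace_cl \<tau> K x)
      + c * (LINT x|\<sigma>. (b x *\<^sub>R trace_cl \<tau> G x) \<bullet> trace_cl \<tau> K x)"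
  proof (intro integral_inner_lin weighted_trace_square_integrable trace_cl_square_integrable F G K L)
    show "AE x in \<sigma>. b x *\<^sub>R trace_cl \<tau> (lin_fun F c G) x
      = b x *\<^sub>R trace_cl \<tau> F x + c *\<^sub>R b x *\<^sub>R trace_cl \<tau> G x"
      using trace_cl_lin[OF F G, of c] by eventually_elim (simp add: scaleR_add_right mult.commute)
  qed
  show ?thesis
    unfolding robin_scalar_form_def 1 2 3
    by (simp only: sum.distrib sum_distrib_left distrib_left)
qed

lemma robin_scalar_form_lin_right:
  assumes F: "F \<in> H1_cl \<Omega>" and G: "G \<in> H1_cl \<Omega>" and K: "K \<in> H1_cl \<Omega>"
  shows "robin_scalar_form \<Omega> b \<tau> s0 k K (lin_fun F c G)
    = robin_scalar_form \<Omega> b \<tau> s0 k K F + c * robin_scalar_form \<Omega> b \<tau> s0 k K G"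
proof -
  note L = H1_cl_lin(1)[OF F G, of c]
  have 1: "(LINT x|\<Lambda>. ((1 + (norm x)\<^sup>2)\<^sup>2 *\<^sub>R weak_partial_cl \<Omega> i K x) \<bullet> weak_partial_cl \<Omega> i (lin_fun F c G) x)
      = (LINT x|\<Lambda>. ((1 + (norm x)\<^sup>2)\<^sup>2 *\<^sub>R weak_partial_cl \<Omega> i K x) \<bullet> weak_partial_cl \<Omega> i F x)
      + c * (LINT x|\<Lambda>. ((1 + (norm x)\<^sup>2)\<^sup>2 *\<^sub>R weak_partial_cl \<Omega> i K x) \<bullet> weak_partial_cl \<Omega> i G x)" for i
    by (intro integral_inner_lin_right weighted_partial_square_integrable
        weak_partial_cl_square_integrable H1_cl_lin(2) F G K L)
  have 2: "(LINT x|\<Lambda>. robin_low s0 k x (\<lambda>i. weak_partial_cl \<Omega> i K x) (K x) \<bullet> lin_fun F c G x)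
      = (LINT x|\<Lambda>. robin_low s0 k x (\<lambda>i. weak_partial_cl \<Omega> i K x) (K x) \<bullet> F x)
      + c * (LINT x|\<Lambda>. robin_low s0 k x (\<lambda>i. weak_partial_cl \<Omega> i K x) (K x) \<bullet> G x)"
    by (intro integral_inner_lin_right robin_low_square_integrable H1_cl_square_integrable F G K L)
      (simp add: lin_fun_def)
  have 3: "(LINT x|\<sigma>. (b x *\<^sub>R trace_cl \<tau> K x) \<bullet> trace_cl \<tau> (lin_fun F c G) x)
      = (LINT x|\<sigma>. (b x *\<^sub>R trace_cl \<tau> K x) \<bullet> trace_cl \<tau> F x)
      + c * (LINT x|\<sigma>. (b x *\<^sub>R trace_cl \<tau> K x) \<bullet> trace_cl \<tau> G x)"
    by (intro integral_inner_lin_right weighted_trace_square_integrable trace_cl_square_integrable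
        trace_cl_lin F G K L)
  show ?thesis
    unfolding robin_scalar_form_def 1 2 3
    by (simp only: sum.distrib sum_distrib_left distrib_left)
qed

end

section \<open>Boundedness and coercivity\<close>

context robin_problem
begin

text \<open>The pointwise length \<open>\<bar>\<nabla>F\<bar> = (\<Sum>\<^sub>i \<bar>\<partial>\<^sub>i F\<bar>\<^sup>2)\<^sup>1\<^sup>/\<^sup>2\<close> of the weak gradient.\<close>

definition grad_norm :: "('n rn \<Rightarrow> 'n clifford) \<Rightarrow> 'n rn \<Rightarrow> real" where
  "grad_norm F x = L2_set (\<lambda>i. norm (weak_partial_cl \<Omega> i F x)) UNIV"

lemma grad_norm_square_integrable:
  assumes "F \<in> H1_cl \<Omega>"
  shows "square_integrable \<Lambda> (grad_norm F)"
    and "(LINT x|\<Lambda>. (grad_norm F x)\<^sup>2) = (normD_cl \<Omega> F)\<^sup>2"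
proof -
  note sq = weak_partial_cl_square_integrable[OF assms]
  have eq: "(grad_norm F x)\<^sup>2 = (\<Sum>i\<in>UNIV. (norm (weak_partial_cl \<Omega> i F x))\<^sup>2)" for x
    by (simp add: grad_norm_def L2_set_def sum_nonneg)
  have "grad_norm F \<in> borel_measurable \<Lambda>"
    unfolding grad_norm_def[abs_def] L2_set_def
    using square_integrable_measurable[OF sq] by measurable
  then show "square_integrable \<Lambda> (grad_norm F)"
    using sq by (simp add: square_integrable_def eq)
  show "(LINT x|\<Lambda>. (grad_norm F x)\<^sup>2) = (normD_cl \<Omega> F)\<^sup>2"
    using sq by (simp add: eq normD_cl_def norm2_cl_eq sum_nonneg square_integrable_def)
qed

lemma norm2_cl_square: "F \<in> H1_cl \<Omega> \<Longrightarrow> (LINT x|\<Lambda>. (norm (F x))\<^sup>2) = (norm2_cl \<Lambda> F)\<^sup>2"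
  by (simp add: norm2_cl_eq H1_cl_square_integrable)

lemma boundary_term_bound:
  assumes F: "F \<in> H1_cl \<Omega>" and G: "G \<in> H1_cl \<Omega>"
  shows "\<bar>LINT x|\<sigma>. (b x *\<^sub>R trace_cl \<tau> F x) \<bullet> trace_cl \<tau> G x\<bar>
    \<le> \<beta> * T\<^sup>2 * (normH1_cl \<Omega> F * normH1_cl \<Omega> G)"
proof -
  note sqF = trace_cl_square_integrable[OF F] and sqG = trace_cl_square_integrable[OF G]
  note sqb = weighted_trace_square_integrable[OF F]
  have \<beta>: "0 \<le> \<beta>"
    by (rule Linfty_norm_nonneg[OF b_Linfty])
  have "(LINT x|\<sigma>. (norm (b x *\<^sub>R trace_cl \<tau> F x))\<^sup>2) \<le> (LINT x|\<sigma>. \<beta>\<^sup>2 * (norm (trace_cl \<tau> F x))\<^sup>2)"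
  proof (rule integral_mono_AE)
    show "AE x in \<sigma>. (norm (b x *\<^sub>R trace_cl \<tau> F x))\<^sup>2 \<le> \<beta>\<^sup>2 * (norm (trace_cl \<tau> F x))\<^sup>2"
      using AE_b
    proof eventually_elim
      case (elim x)
      then have "\<bar>b x\<bar>\<^sup>2 \<le> \<beta>\<^sup>2"
        by (intro power_mono) auto
      then show ?case
        by (simp add: power_mult_distrib mult_right_mono)
    qed
  qed (use sqF sqb in \<open>auto simp: square_integrable_def\<close>)
  then have "sqrt (LINT x|\<sigma>. (norm (b x *\<^sub>R trace_cl \<tau> F x))\<^sup>2) \<le> sqrt (\<beta>\<^sup>2 * (LINT x|\<sigma>. (norm (trace_cl \<tau> F x))\<^sup>2))"
    by (simp only: real_sqrt_le_iff integral_mult_right_zero)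
  also have "\<dots> = \<beta> * norm2_cl \<sigma> (trace_cl \<tau> F)"
    using \<beta> by (simp add: real_sqrt_mult norm2_cl_eq sqF)
  also have "\<dots> \<le> \<beta> * (T * normH1_cl \<Omega> F)"
    using \<beta> by (intro mult_left_mono trace_norm_bound F)
  finally have 1: "sqrt (LINT x|\<sigma>. (norm (b x *\<^sub>R trace_cl \<tau> F x))\<^sup>2) \<le> \<beta> * (T * normH1_cl \<Omega> F)" .
  have 2: "sqrt (LINT x|\<sigma>. (norm (trace_cl \<tau> G x))\<^sup>2) \<le> T * normH1_cl \<Omega> G"
    using trace_norm_bound[OF G] by (simp add: norm2_cl_eq sqG)
  have "\<bar>LINT x|\<sigma>. (b x *\<^sub>R trace_cl \<tau> F x) \<bullet> trace_cl \<tau> G x\<bar>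
      \<le> sqrt (LINT x|\<sigma>. (norm (b x *\<^sub>R trace_cl \<tau> F x))\<^sup>2) * sqrt (LINT x|\<sigma>. (norm (trace_cl \<tau> G x))\<^sup>2)"
    by (rule integral_Cauchy_Schwarz[OF sqb sqG])
  also have "\<dots> \<le> (\<beta> * (T * normH1_cl \<Omega> F)) * (T * normH1_cl \<Omega> G)"
    using 1 2 by (rule mult_mono) (auto intro: order_trans[OF _ 1])
  finally show ?thesis
    by (simp add: power2_eq_square mult_ac)
qed

lemma robin_low_L2_bound:
  assumes "\<And>x. x \<in> \<Omega> \<Longrightarrow> norm x \<le> M"
  shows "\<exists>C\<ge>0. \<forall>F\<in>H1_cl \<Omega>.
    sqrt (LINT x|\<Lambda>. (norm (robin_low s0 k x (\<lambda>i. weak_partial_cl \<Omega> i F x) (F x)))\<^sup>2) \<le> C * normH1_cl \<Omega> F"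
proof -
  define a where "a = 2 * (sqrt (real CARD('n)) * (1 + M\<^sup>2) * ((3 + real CARD('n)) * M + \<bar>s0\<bar>))"
  define d where "d = 2 * \<bar>s0\<bar> * real CARD('n) * M + \<bar>k\<bar>"
  define C where "C = sqrt (2 * (a\<^sup>2 + d\<^sup>2))"
  show ?thesis
  proof (intro exI[of _ C] conjI ballI)
    show "0 \<le> C" by (simp add: C_def)
    fix F assume F: "F \<in> H1_cl \<Omega>"
    let ?L = "\<lambda>x. robin_low s0 k x (\<lambda>i. weak_partial_cl \<Omega> i F x) (F x)"
    have int: "integrable \<Lambda> (\<lambda>x. (grad_norm F x)\<^sup>2)" "integrable \<Lambda> (\<lambda>x. (norm (F x))\<^sup>2)"
      using grad_norm_square_integrable(1)[OF F] H1_cl_square_integrable[OF F]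
      by (simp_all add: square_integrable_def)
    have "(LINT x|\<Lambda>. (norm (?L x))\<^sup>2) \<le> (LINT x|\<Lambda>. 2 * (a\<^sup>2 + d\<^sup>2) * ((grad_norm F x)\<^sup>2 + (norm (F x))\<^sup>2))"
    proof (rule integral_mono)
      fix x assume "x \<in> space \<Lambda>"
      then have "norm x \<le> M"
        using assms by simp
      from robin_low_bound[OF this, of s0 k "\<lambda>i. weak_partial_cl \<Omega> i F x" "F x"]
      have "norm (?L x - k *\<^sub>R F x) \<le> a * grad_norm F x + 2 * \<bar>s0\<bar> * real CARD('n) * M * norm (F x)"
        by (simp add: a_def grad_norm_def)
      then have "norm (?L x) \<le> a * grad_norm F x + d * norm (F x)"
        using norm_triangle_ineq[of "?L x - k *\<^sub>R F x" "k *\<^sub>R F x"] by (simp add: d_def algebra_simps)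
      then have "(norm (?L x))\<^sup>2 \<le> (a * grad_norm F x + d * norm (F x))\<^sup>2"
        by (intro power_mono) auto
      also have "\<dots> \<le> (a\<^sup>2 + d\<^sup>2) * ((grad_norm F x)\<^sup>2 + (norm (F x))\<^sup>2)"
        using zero_le_power2[of "a * norm (F x) - d * grad_norm F x"]
        by (simp add: power2_eq_square algebra_simps)
      also have "\<dots> \<le> 2 * (a\<^sup>2 + d\<^sup>2) * ((grad_norm F x)\<^sup>2 + (norm (F x))\<^sup>2)"
        by (intro mult_right_mono) auto
      finally show "(norm (?L x))\<^sup>2 \<le> 2 * (a\<^sup>2 + d\<^sup>2) * ((grad_norm F x)\<^sup>2 + (norm (F x))\<^sup>2)" .
    qed (use int robin_low_square_integrable[OF F] in \<open>auto simp: square_integrable_def\<close>)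
    also have "\<dots> = 2 * (a\<^sup>2 + d\<^sup>2) * (normH1_cl \<Omega> F)\<^sup>2"
      using int by (simp add: grad_norm_square_integrable(2)[OF F] norm2_cl_square[OF F] normH1_cl_def)
    finally have "sqrt (LINT x|\<Lambda>. (norm (?L x))\<^sup>2) \<le> sqrt (2 * (a\<^sup>2 + d\<^sup>2) * (normH1_cl \<Omega> F)\<^sup>2)"
      by (rule real_sqrt_le_mono)
    then show "sqrt (LINT x|\<Lambda>. (norm (?L x))\<^sup>2) \<le> C * normH1_cl \<Omega> F"
      by (simp add: C_def real_sqrt_mult normH1_cl_def)
  qed
qed

lemma norms_le_normH1:
  assumes "F \<in> H1_cl \<Omega>"
  shows "norm2_cl \<Lambda> F \<le> normH1_cl \<Omega> F" "norm2_cl \<Lambda> (weak_partial_cl \<Omega> i F) \<le> normH1_cl \<Omega> F"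
proof -
  have "(norm2_cl \<Lambda> (weak_partial_cl \<Omega> i F))\<^sup>2 \<le> (normD_cl \<Omega> F)\<^sup>2"
    using member_le_sum[of i UNIV "\<lambda>i. (norm2_cl \<Lambda> (weak_partial_cl \<Omega> i F))\<^sup>2"]
    by (simp add: normD_cl_def sum_nonneg)
  then show "norm2_cl \<Lambda> F \<le> normH1_cl \<Omega> F" "norm2_cl \<Lambda> (weak_partial_cl \<Omega> i F) \<le> normH1_cl \<Omega> F"
    unfolding normH1_cl_def by (intro real_le_rsqrt; simp add: add_increasing)+
qed

lemma robin_scalar_form_bounded:
  assumes M: "\<And>x. x \<in> \<Omega> \<Longrightarrow> norm x \<le> M"
  obtains C where "\<And>F G. \<lbrakk>F \<in> H1_cl \<Omega>; G \<in> H1_cl \<Omega>\<rbrakk> \<Longrightarrow>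
    \<bar>robin_scalar_form \<Omega> b \<tau> s0 k F G\<bar> \<le> C * normH1_cl \<Omega> F * normH1_cl \<Omega> G"
proof -
  obtain K where K: "0 \<le> K" "\<And>F. F \<in> H1_cl \<Omega> \<Longrightarrow>
    sqrt (LINT x|\<Lambda>. (norm (robin_low s0 k x (\<lambda>i. weak_partial_cl \<Omega> i F x) (F x)))\<^sup>2) \<le> K * normH1_cl \<Omega> F"
    using robin_low_L2_bound[OF M, of s0 k] by blast
  define W where "W = (1 + M\<^sup>2)\<^sup>2"
  define C where "C = real CARD('n) * W + K + \<beta> * T\<^sup>2"
  have W: "0 \<le> W" by (simp add: W_def)
  show ?thesis
  proof (rule that[of C])
    fix F G assume F: "F \<in> H1_cl \<Omega>" and G: "G \<in> H1_cl \<Omega>"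
    let ?N = "normH1_cl \<Omega> F * normH1_cl \<Omega> G"
    have N0: "0 \<le> normH1_cl \<Omega> F" "0 \<le> normH1_cl \<Omega> G"
      by (simp_all add: normH1_cl_def)
    have 1: "\<bar>LINT x|\<Lambda>. ((1 + (norm x)\<^sup>2)\<^sup>2 *\<^sub>R weak_partial_cl \<Omega> i F x) \<bullet> weak_partial_cl \<Omega> i G x\<bar> \<le> W * ?N" for i
    proof -
      note sqF = weak_partial_cl_square_integrable[OF F, of i]
      note sqG = weak_partial_cl_square_integrable[OF G, of i]
      note sqw = weighted_partial_square_integrable[OF F, of i]
      have "(LINT x|\<Lambda>. (norm ((1 + (norm x)\<^sup>2)\<^sup>2 *\<^sub>R weak_partial_cl \<Omega> i F x))\<^sup>2)
          \<le> (LINT x|\<Lambda>. W\<^sup>2 * (norm (weak_partial_cl \<Omega> i F x))\<^sup>2)"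
      proof (rule integral_mono)
        fix x assume "x \<in> space \<Lambda>"
        then have "(1 + (norm x)\<^sup>2)\<^sup>2 \<le> W"
          unfolding W_def using M by (intro power_mono add_left_mono) auto
        then have "((1 + (norm x)\<^sup>2)\<^sup>2)\<^sup>2 \<le> W\<^sup>2"
          by (intro power_mono) auto
        then show "(norm ((1 + (norm x)\<^sup>2)\<^sup>2 *\<^sub>R weak_partial_cl \<Omega> i F x))\<^sup>2
            \<le> W\<^sup>2 * (norm (weak_partial_cl \<Omega> i F x))\<^sup>2"
          by (simp add: power_mult_distrib mult_right_mono)
      qed (use sqF sqw in \<open>auto simp: square_integrable_def\<close>)
      then have "sqrt (LINT x|\<Lambda>. (norm ((1 + (norm x)\<^sup>2)\<^sup>2 *\<^sub>R weak_partial_cl \<Omega> i F x))\<^sup>2)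
          \<le> sqrt (W\<^sup>2 * (LINT x|\<Lambda>. (norm (weak_partial_cl \<Omega> i F x))\<^sup>2))"
        by (simp only: real_sqrt_le_iff integral_mult_right_zero)
      also have "\<dots> = W * norm2_cl \<Lambda> (weak_partial_cl \<Omega> i F)"
        using W by (simp add: real_sqrt_mult norm2_cl_eq sqF)
      also have "\<dots> \<le> W * normH1_cl \<Omega> F"
        using W by (intro mult_left_mono norms_le_normH1 F)
      finally have a: "sqrt (LINT x|\<Lambda>. (norm ((1 + (norm x)\<^sup>2)\<^sup>2 *\<^sub>R weak_partial_cl \<Omega> i F x))\<^sup>2)
        \<le> W * normH1_cl \<Omega> F" .
      have c: "sqrt (LINT x|\<Lambda>. (norm (weak_partial_cl \<Omega> i G x))\<^sup>2) \<le> normH1_cl \<Omega> G"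
        using norms_le_normH1(2)[OF G, of i] by (simp add: norm2_cl_eq sqG)
      from integral_Cauchy_Schwarz[OF sqw sqG] mult_mono[OF a c] W N0 show ?thesis
        by (simp add: mult.assoc)
    qed
    have 2: "\<bar>LINT x|\<Lambda>. robin_low s0 k x (\<lambda>i. weak_partial_cl \<Omega> i F x) (F x) \<bullet> G x\<bar> \<le> K * ?N"
    proof -
      have c: "sqrt (LINT x|\<Lambda>. (norm (G x))\<^sup>2) \<le> normH1_cl \<Omega> G"
        using norms_le_normH1(1)[OF G] by (simp add: norm2_cl_eq H1_cl_square_integrable[OF G])
      from integral_Cauchy_Schwarz[OF robin_low_square_integrable[OF F] H1_cl_square_integrable[OF G], of s0 k]
        mult_mono[OF K(2)[OF F] c] K(1) N0
      show ?thesis by (simp add: mult.assoc)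
    qed
    have "\<bar>\<Sum>i\<in>UNIV. LINT x|\<Lambda>. ((1 + (norm x)\<^sup>2)\<^sup>2 *\<^sub>R weak_partial_cl \<Omega> i F x) \<bullet> weak_partial_cl \<Omega> i G x\<bar>
        \<le> (\<Sum>i\<in>(UNIV::'n set). W * ?N)"
      by (rule order_trans[OF sum_abs sum_mono]) (rule 1)
    then have "\<bar>robin_scalar_form \<Omega> b \<tau> s0 k F G\<bar> \<le> real CARD('n) * (W * ?N) + K * ?N + \<beta> * T\<^sup>2 * ?N"
      using 2 boundary_term_bound[OF F G] unfolding robin_scalar_form_def by simp
    then show "\<bar>robin_scalar_form \<Omega> b \<tau> s0 k F G\<bar> \<le> C * normH1_cl \<Omega> F * normH1_cl \<Omega> G"
      by (simp add: C_def algebra_simps)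
  qed
qed

lemma robin_scalar_form_lower_bound:
  assumes m: "0 \<le> m" "\<And>x. x \<in> \<Omega> \<Longrightarrow> m \<le> norm x" and M: "0 \<le> M" "\<And>x. x \<in> \<Omega> \<Longrightarrow> norm x \<le> M"
    and F: "F \<in> H1_cl \<Omega>"
  defines "n \<equiv> real CARD('n)" and "p \<equiv> normD_cl \<Omega> F" and "q \<equiv> norm2_cl \<Lambda> F"
  shows "(1 + m\<^sup>2)\<^sup>2 * p\<^sup>2 - 2 * (sqrt n * (1 + M\<^sup>2) * ((3 + n) * M + \<bar>s0\<bar>)) * p * q
      + (k - 2 * \<bar>s0\<bar> * n * M) * q\<^sup>2 - \<beta> * T\<^sup>2 * (p\<^sup>2 + q\<^sup>2)
    \<le> robin_scalar_form \<Omega> b \<tau> s0 k F F"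
proof -
  define c where "c = sqrt n * (1 + M\<^sup>2) * ((3 + n) * M + \<bar>s0\<bar>)"
  define d where "d = 2 * \<bar>s0\<bar> * n * M"
  have c: "0 \<le> c"
    using M by (simp add: c_def n_def)
  have pq: "0 \<le> p" "0 \<le> q"
    by (simp_all add: p_def q_def normD_cl_def sum_nonneg norm2_cl_eq H1_cl_square_integrable[OF F])
  note sq = weak_partial_cl_square_integrable[OF F]
  note sqF = H1_cl_square_integrable[OF F]
  have "(1 + m\<^sup>2)\<^sup>2 * (LINT x|\<Lambda>. (norm (weak_partial_cl \<Omega> i F x))\<^sup>2)
      \<le> (LINT x|\<Lambda>. ((1 + (norm x)\<^sup>2)\<^sup>2 *\<^sub>R weak_partial_cl \<Omega> i F x) \<bullet> weak_partial_cl \<Omega> i F x)" for i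
  proof -
    have "(LINT x|\<Lambda>. (1 + m\<^sup>2)\<^sup>2 * (norm (weak_partial_cl \<Omega> i F x))\<^sup>2)
      \<le> (LINT x|\<Lambda>. ((1 + (norm x)\<^sup>2)\<^sup>2 *\<^sub>R weak_partial_cl \<Omega> i F x) \<bullet> weak_partial_cl \<Omega> i F x)"
    proof (rule integral_mono)
      show "integrable \<Lambda> (\<lambda>x. ((1 + (norm x)\<^sup>2)\<^sup>2 *\<^sub>R weak_partial_cl \<Omega> i F x) \<bullet> weak_partial_cl \<Omega> i F x)"
        by (rule square_integrable_inner[OF weighted_partial_square_integrable[OF F] sq])
      fix x assume "x \<in> space \<Lambda>"
      then have "(1 + m\<^sup>2)\<^sup>2 \<le> (1 + (norm x)\<^sup>2)\<^sup>2"
        using m by (intro power_mono add_left_mono) auto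
      then show "(1 + m\<^sup>2)\<^sup>2 * (norm (weak_partial_cl \<Omega> i F x))\<^sup>2
          \<le> ((1 + (norm x)\<^sup>2)\<^sup>2 *\<^sub>R weak_partial_cl \<Omega> i F x) \<bullet> weak_partial_cl \<Omega> i F x"
        by (simp add: dot_square_norm mult_right_mono)
    qed (use sq[of i] in \<open>auto simp: square_integrable_def\<close>)
    then show ?thesis by simp
  qed
  then have "(\<Sum>i\<in>UNIV. (1 + m\<^sup>2)\<^sup>2 * (LINT x|\<Lambda>. (norm (weak_partial_cl \<Omega> i F x))\<^sup>2))
      \<le> (\<Sum>i\<in>UNIV. LINT x|\<Lambda>. ((1 + (norm x)\<^sup>2)\<^sup>2 *\<^sub>R weak_partial_cl \<Omega> i F x) \<bullet> weak_partial_cl \<Omega> i F x)"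
    by (rule sum_mono)
  moreover have "(\<Sum>i\<in>UNIV. (1 + m\<^sup>2)\<^sup>2 * (LINT x|\<Lambda>. (norm (weak_partial_cl \<Omega> i F x))\<^sup>2)) = (1 + m\<^sup>2)\<^sup>2 * p\<^sup>2"
    by (simp add: p_def normD_cl_def norm2_cl_eq sq sum_nonneg sum_distrib_left)
  ultimately have 1: "(1 + m\<^sup>2)\<^sup>2 * p\<^sup>2
      \<le> (\<Sum>i\<in>UNIV. LINT x|\<Lambda>. ((1 + (norm x)\<^sup>2)\<^sup>2 *\<^sub>R weak_partial_cl \<Omega> i F x) \<bullet> weak_partial_cl \<Omega> i F x)"
    by simp
  note sqg = grad_norm_square_integrable(1)[OF F] and sqn = square_integrable_norm[OF sqF]
  have int: "integrable \<Lambda> (\<lambda>x. grad_norm F x * norm (F x))" "integrable \<Lambda> (\<lambda>x. (norm (F x))\<^sup>2)"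
    using square_integrable_mult[OF sqg sqn] sqF by (simp_all add: square_integrable_def)
  have "(LINT x|\<Lambda>. (k - d) * (norm (F x))\<^sup>2 - 2 * c * (grad_norm F x * norm (F x)))
      \<le> (LINT x|\<Lambda>. robin_low s0 k x (\<lambda>i. weak_partial_cl \<Omega> i F x) (F x) \<bullet> F x)"
  proof (rule integral_mono)
    show "integrable \<Lambda> (\<lambda>x. robin_low s0 k x (\<lambda>i. weak_partial_cl \<Omega> i F x) (F x) \<bullet> F x)"
      by (rule square_integrable_inner[OF robin_low_square_integrable[OF F] sqF])
    fix x assume "x \<in> space \<Lambda>"
    then have "norm x \<le> M"
      using M by simp
    let ?L = "robin_low s0 k x (\<lambda>i. weak_partial_cl \<Omega> i F x) (F x)"
    have "norm (?L - k *\<^sub>R F x) \<le> 2 * c * grad_norm F x + d * norm (F x)"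
      using robin_low_bound[OF \<open>norm x \<le> M\<close>, of s0 k "\<lambda>i. weak_partial_cl \<Omega> i F x" "F x"]
      by (simp add: c_def d_def n_def grad_norm_def)
    then have "norm (?L - k *\<^sub>R F x) * norm (F x) \<le> (2 * c * grad_norm F x + d * norm (F x)) * norm (F x)"
      by (intro mult_right_mono) auto
    moreover have "\<bar>(?L - k *\<^sub>R F x) \<bullet> F x\<bar> \<le> norm (?L - k *\<^sub>R F x) * norm (F x)"
      by (rule Cauchy_Schwarz_ineq2)
    moreover have "(?L - k *\<^sub>R F x) \<bullet> F x = ?L \<bullet> F x - k * (norm (F x))\<^sup>2"
      by (simp add: inner_diff_left dot_square_norm)
    ultimately have "k * (norm (F x))\<^sup>2 - (2 * c * grad_norm F x + d * norm (F x)) * norm (F x) \<le> ?L \<bullet> F x"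
      by linarith
    then show "(k - d) * (norm (F x))\<^sup>2 - 2 * c * (grad_norm F x * norm (F x)) \<le> ?L \<bullet> F x"
      by (simp add: algebra_simps power2_eq_square)
  qed (use int in auto)
  moreover have "(LINT x|\<Lambda>. (k - d) * (norm (F x))\<^sup>2 - 2 * c * (grad_norm F x * norm (F x)))
      = (k - d) * q\<^sup>2 - 2 * c * (LINT x|\<Lambda>. grad_norm F x * norm (F x))"
    using int by (simp add: norm2_cl_square[OF F] q_def)
  moreover have "2 * c * (LINT x|\<Lambda>. grad_norm F x * norm (F x)) \<le> 2 * c * (p * q)"
  proof (rule mult_left_mono)
    have "(LINT x|\<Lambda>. grad_norm F x * norm (F x)) \<le> sqrt (p\<^sup>2) * sqrt (q\<^sup>2)"
      using integral_Cauchy_Schwarz[OF sqg sqn]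
      by (simp add: grad_norm_square_integrable(2)[OF F] norm2_cl_square[OF F] p_def q_def abs_le_iff)
    then show "(LINT x|\<Lambda>. grad_norm F x * norm (F x)) \<le> p * q"
      using pq by simp
  qed (use c in simp)
  ultimately have 2: "(k - d) * q\<^sup>2 - 2 * c * (p * q)
      \<le> (LINT x|\<Lambda>. robin_low s0 k x (\<lambda>i. weak_partial_cl \<Omega> i F x) (F x) \<bullet> F x)"
    by linarith
  have 3: "- (\<beta> * T\<^sup>2 * (p\<^sup>2 + q\<^sup>2)) \<le> (LINT x|\<sigma>. (b x *\<^sub>R trace_cl \<tau> F x) \<bullet> trace_cl \<tau> F x)"
  proof -
    have "normH1_cl \<Omega> F * normH1_cl \<Omega> F = p\<^sup>2 + q\<^sup>2"
      by (simp add: normH1_cl_def p_def q_def)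
    with boundary_term_bound[OF F F] show ?thesis by (simp add: abs_le_iff)
  qed
  from add_mono[OF add_mono[OF 1 2] 3] show ?thesis
    unfolding robin_scalar_form_def c_def[symmetric] d_def[symmetric] by (simp add: mult.assoc)
qed

text \<open>Existence, uniqueness and the norm estimates for a coercive Robin form. The equation only has to
  be solved for scalar parts: replacing \<open>G\<close> by \<open>G e\<^sub>C\<close> recovers all components.\<close>

theorem robin_solution_exists:
  assumes M: "\<And>x. x \<in> \<Omega> \<Longrightarrow> norm x \<le> M"
    and H: "0 < H" "\<And>F. F \<in> H1_cl \<Omega> \<Longrightarrow> H * H1_inner \<Omega> F F
      \<le> robin_scalar_form \<Omega> b \<tau> (Sc s) ((norm s)\<^sup>2 + (real CARD('n))\<^sup>2) F F"
    and f: "f \<in> L2_cl \<Lambda>"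
  shows "\<exists>F. robin_solution \<Omega> b \<tau> s f F \<and>
      (\<forall>F'. robin_solution \<Omega> b \<tau> s f F' \<longrightarrow> (AE x in \<Lambda>. F' x = F x)) \<and>
      norm2_cl \<Lambda> F \<le> 1 / H * norm2_cl \<Lambda> f \<and> normD_cl \<Omega> F \<le> 1 / H * norm2_cl \<Lambda> f"
proof -
  let ?B = "robin_scalar_form \<Omega> b \<tau> (Sc s) ((norm s)\<^sup>2 + (real CARD('n))\<^sup>2)"
  interpret semi_hilbert "H1_cl \<Omega>" lin_fun "H1_inner \<Omega>"
    by (rule semi_hilbert_H1)
  have sqf: "square_integrable \<Lambda> f"
    using f by (simp add: L2_cl_iff_square_integrable)
  have l_bound: "\<bar>LINT x|\<Lambda>. f x \<bullet> G x\<bar> \<le> norm2_cl \<Lambda> f * norm2_cl \<Lambda> G" if "G \<in> H1_cl \<Omega>" for G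
    using integral_Cauchy_Schwarz[OF sqf H1_cl_square_integrable[OF that]]
    by (simp add: norm2_cl_eq sqf H1_cl_square_integrable[OF that])
  obtain C where C: "\<And>F G. \<lbrakk>F \<in> H1_cl \<Omega>; G \<in> H1_cl \<Omega>\<rbrakk> \<Longrightarrow>
      \<bar>?B F G\<bar> \<le> C * normH1_cl \<Omega> F * normH1_cl \<Omega> G"
    using robin_scalar_form_bounded[OF M, of "Sc s" "(norm s)\<^sup>2 + (real CARD('n))\<^sup>2"] by metis
  obtain F where F: "F \<in> H1_cl \<Omega>" and eq: "\<And>G. G \<in> H1_cl \<Omega> \<Longrightarrow> ?B F G = (LINT x|\<Lambda>. f x \<bullet> G x)"
  proof (rule Lax_Milgram[of ?B C H "\<lambda>G. LINT x|\<Lambda>. f x \<bullet> G x" "norm2_cl \<Lambda> f"])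
    show "\<bar>?B u v\<bar> \<le> C * sqrt (H1_inner \<Omega> u u) * sqrt (H1_inner \<Omega> v v)" if "u \<in> H1_cl \<Omega>" "v \<in> H1_cl \<Omega>" for u v
      using C[OF that] by (simp add: normH1_cl_eq that)
    show "(LINT x|\<Lambda>. f x \<bullet> lin_fun u c v x) = (LINT x|\<Lambda>. f x \<bullet> u x) + c * (LINT x|\<Lambda>. f x \<bullet> v x)"
      if "u \<in> H1_cl \<Omega>" "v \<in> H1_cl \<Omega>" for u v c
      using that by (intro integral_inner_lin_right H1_cl_square_integrable sqf H1_cl_lin(1))
        (simp_all add: lin_fun_def)
    show "\<bar>LINT x|\<Lambda>. f x \<bullet> v x\<bar> \<le> norm2_cl \<Lambda> f * sqrt (H1_inner \<Omega> v v)" if v: "v \<in> H1_cl \<Omega>" for v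
    proof -
      have "norm2_cl \<Lambda> f * norm2_cl \<Lambda> v \<le> norm2_cl \<Lambda> f * normH1_cl \<Omega> v"
        by (intro mult_left_mono norms_le_normH1 v) (simp add: norm2_cl_eq sqf)
      with l_bound[OF v] show ?thesis
        by (simp add: normH1_cl_eq[OF v])
    qed
  qed (use H robin_scalar_form_lin_left robin_scalar_form_lin_right in auto)
  have sol: "robin_solution \<Omega> b \<tau> s f F"
    unfolding robin_solution_def
  proof (intro conjI ballI F clifford_eqI_Sc)
    fix G C assume G: "G \<in> H1_cl \<Omega>"
    note GC = H1_cl_mult_axis(1)[OF G, of C]
    have "Sc (robin_form \<Omega> b \<tau> s F G \<odot> axis C 1) = (LINT x|\<Lambda>. f x \<bullet> (G x \<odot> axis C 1))"
      using eq[OF GC] by (simp add: Sc_robin_form[OF F GC] flip: robin_form_mult_axis[OF F G])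
    also have "\<dots> = Sc (inner_cl \<Lambda> f G \<odot> axis C 1)"
      by (simp add: Sc_inner_cl sqf H1_cl_square_integrable G GC flip: inner_cl_mult_right)
    finally show "Sc (robin_form \<Omega> b \<tau> s F G \<odot> axis C 1) = Sc (inner_cl \<Lambda> f G \<odot> axis C 1)" .
  qed
  have unique: "AE x in \<Lambda>. F' x = F x" if "robin_solution \<Omega> b \<tau> s f F'" for F'
  proof -
    have F': "F' \<in> H1_cl \<Omega>"
      using that by (simp add: robin_solution_def)
    have eq': "?B F' G = (LINT x|\<Lambda>. f x \<bullet> G x)" if "G \<in> H1_cl \<Omega>" for G
      using \<open>robin_solution \<Omega> b \<tau> s f F'\<close> that
      by (simp add: robin_solution_def Sc_inner_cl sqf H1_cl_square_integrable flip: Sc_robin_form[OF F' that])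
    let ?D = "lin_fun F' (-1) F"
    have D: "?D \<in> H1_cl \<Omega>"
      by (intro H1_cl_lin F F')
    have "H * H1_inner \<Omega> ?D ?D \<le> 0"
      using H(2)[OF D] robin_scalar_form_lin_left[OF F' F D, of "Sc s" _ "-1"] eq[OF D] eq'[OF D] by simp
    then have "H1_inner \<Omega> ?D ?D \<le> 0"
      using H(1) by (simp add: mult_le_0_iff)
    then have "norm2_cl \<Lambda> ?D = 0"
      by (simp add: H1_inner_same[OF D] sum_power2_le_zero_iff)
    then have "(LINT x|\<Lambda>. (norm (?D x))\<^sup>2) = 0"
      by (simp add: norm2_cl_square[OF D])
    then have "AE x in \<Lambda>. (norm (?D x))\<^sup>2 = 0"
      using H1_cl_square_integrable[OF D] by (subst (asm) integral_nonneg_eq_0_iff_AE) (auto simp: square_integrable_def)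
    then show ?thesis
      by eventually_elim (simp add: lin_fun_def)
  qed
  define p where "p = normD_cl \<Omega> F"
  define q where "q = norm2_cl \<Lambda> F"
  define r where "r = 1 / H * norm2_cl \<Lambda> f"
  have nonneg: "0 \<le> p" "0 \<le> q" "0 \<le> r"
    using H(1) by (simp_all add: p_def q_def r_def normD_cl_def sum_nonneg norm2_cl_eq sqf H1_cl_square_integrable[OF F])
  have "H * (p\<^sup>2 + q\<^sup>2) \<le> norm2_cl \<Lambda> f * q"
    using H(2)[OF F] eq[OF F] l_bound[OF F] by (simp add: H1_inner_same[OF F] p_def q_def add.commute)
  then have est: "p\<^sup>2 + q\<^sup>2 \<le> r * q"
    using H(1) by (simp add: r_def field_simps)
  \<comment> \<open>\<open>q\<^sup>2 \<le> r q\<close> and then \<open>p\<^sup>2 \<le> r q \<le> r\<^sup>2\<close>\<close>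
  have "q \<le> r"
  proof (cases "q = 0")
    case False
    have "q * q \<le> r * q"
      using est zero_le_power2[of p] unfolding power2_eq_square by linarith
    then show ?thesis
      using False nonneg by simp
  qed (use nonneg in simp)
  moreover have "p \<le> r"
  proof (rule power2_le_imp_le)
    have "r * q \<le> r * r"
      using \<open>q \<le> r\<close> nonneg by (intro mult_left_mono)
    with est show "p\<^sup>2 \<le> r\<^sup>2"
      using zero_le_power2[of q] unfolding power2_eq_square by linarith
  qed (rule nonneg)
  ultimately show ?thesis
    using sol unique unfolding p_def q_def r_def by blast
qed

end

section \<open>The smallest eigenvalue of a symmetric matrix\<close>

text \<open>With \<open>(a - H) (d - H) = c\<^sup>2\<close>, the difference of the two sides is the square of
  \<open>\<surd>(a - H) p - \<surd>(d - H) q\<close>.\<close>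

lemma symmetric_matrix_lower_bound:
  fixes a d c :: real
  defines "H \<equiv> (a + d) / 2 - sqrt ((a - d)\<^sup>2 + 4 * c\<^sup>2) / 2"
  assumes "0 \<le> c" "0 < a + d" "c\<^sup>2 < a * d"
  shows "0 < H" "H * (p\<^sup>2 + q\<^sup>2) \<le> a * p\<^sup>2 - 2 * c * p * q + d * q\<^sup>2"
proof -
  define S where "S = sqrt ((a - d)\<^sup>2 + 4 * c\<^sup>2)"
  have H_eq: "H = (a + d) / 2 - S / 2"
    by (simp add: H_def S_def)
  have S2: "S\<^sup>2 = (a - d)\<^sup>2 + 4 * c\<^sup>2"
    by (simp add: S_def)
  have "S\<^sup>2 < (a + d)\<^sup>2"
    unfolding S2 using assms(4) by (simp add: power2_eq_square algebra_simps)
  then have "S < a + d"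
    by (rule power2_less_imp_less) (use assms(3) in simp)
  then show "0 < H"
    by (simp add: H_eq)
  have "\<bar>a - d\<bar> \<le> S"
    unfolding S_def by (rule real_le_rsqrt) simp
  then have nonneg: "0 \<le> a - H" "0 \<le> d - H"
    by (auto simp: H_eq abs_le_iff field_simps)
  have "(a - H) * (d - H) = (S\<^sup>2 - (a - d)\<^sup>2) / 4"
    by (simp add: H_eq power2_eq_square field_simps)
  then have prod: "(a - H) * (d - H) = c\<^sup>2"
    by (simp add: S2)
  have "sqrt (a - H) * sqrt (d - H) = c"
    using assms(2) by (simp add: prod flip: real_sqrt_mult)
  then have sq: "(sqrt (a - H) * p - sqrt (d - H) * q)\<^sup>2 = (a - H) * p\<^sup>2 - 2 * c * p * q + (d - H) * q\<^sup>2"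
    using nonneg by (simp add: power2_diff power_mult_distrib)
  have "0 \<le> (a - H) * p\<^sup>2 - 2 * c * p * q + (d - H) * q\<^sup>2"
    using zero_le_power2[of "sqrt (a - H) * p - sqrt (d - H) * q"] unfolding sq .
  then show "H * (p\<^sup>2 + q\<^sup>2) \<le> a * p\<^sup>2 - 2 * c * p * q + d * q\<^sup>2"
    by (simp add: algebra_simps)
qed

section \<open>The spherical Dirac operator with Robin boundary conditions\<close>

theorem theorem7p2:
  fixes \<Omega> :: "'n::{finite,linorder} rn set"
    and b :: "'n rn \<Rightarrow> real"
    and \<tau> :: "('n rn \<Rightarrow> real) \<Rightarrow> ('n rn \<Rightarrow> real)"
    and s :: "'n clifford"
    and f :: "'n rn \<Rightarrow> 'n clifford"
    and n m M s0 \<beta> T H :: real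
  assumes "n = real CARD('n)" and "n \<ge> 2"
    and "open \<Omega>" and "bounded \<Omega>" and "smooth_boundary \<Omega>"
    and "m = (INF x\<in>\<Omega>. norm x)" and "M = (SUP x\<in>\<Omega>. norm x)"
    and "0 \<le> m" and "m < M"
    and "b \<in> Linfty (surface_measure \<Omega>)"
    and "dirichlet_trace \<Omega> \<tau>"
    and "\<beta> = Linfty_norm (surface_measure \<Omega>) b" and "T = trace_norm \<Omega> \<tau>"
    and "s \<in> paravectors" and "s0 = Sc s"
    and "(norm s)\<^sup>2 + n\<^sup>2 - 2 * \<bar>s0\<bar> * n * M + (1 + m\<^sup>2)\<^sup>2 - 2 powr (n / 2 + 1) * \<beta> * T\<^sup>2 > 0"
    and "(norm s)\<^sup>2 * ((1 + m\<^sup>2)\<^sup>2 - 2 powr (n / 2) * \<beta> * T\<^sup>2) - n * (1 + M\<^sup>2)\<^sup>2 * s0\<^sup>2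
         - 2 * \<bar>s0\<bar> * n * M * ((1 + m\<^sup>2)\<^sup>2 + (3 + n) * (1 + M\<^sup>2)\<^sup>2 - 2 powr (n / 2) * \<beta> * T\<^sup>2)
       > n * (1 + M\<^sup>2)\<^sup>2 * (3 + n)\<^sup>2 * M\<^sup>2 + (1 + m\<^sup>2)\<^sup>2 * 2 powr (n / 2) * \<beta> * T\<^sup>2
         - n\<^sup>2 * ((1 + m\<^sup>2)\<^sup>2 - 2 powr (n / 2) * \<beta> * T\<^sup>2) - 2 powr n * \<beta>\<^sup>2 * T ^ 4"
    and "H = ((norm s)\<^sup>2 + n\<^sup>2 - 2 * \<bar>s0\<bar> * n * M) / 2 + (1 + m\<^sup>2)\<^sup>2 / 2 - 2 powr (n / 2) * \<beta> * T\<^sup>2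
         - sqrt (((norm s)\<^sup>2 + n\<^sup>2 - 2 * \<bar>s0\<bar> * n * M - (1 + m\<^sup>2)\<^sup>2)\<^sup>2
             + 4 * (sqrt n * (1 + M\<^sup>2) * ((3 + n) * M + \<bar>s0\<bar>))\<^sup>2) / 2"
    and "f \<in> L2_cl (lebesgue_on \<Omega>)"
  shows "\<exists>F. robin_solution \<Omega> b \<tau> s f F \<and>
      (\<forall>F'. robin_solution \<Omega> b \<tau> s f F' \<longrightarrow> (AE x in lebesgue_on \<Omega>. F' x = F x)) \<and>
      norm2_cl (lebesgue_on \<Omega>) F \<le> 1 / H * norm2_cl (lebesgue_on \<Omega>) f \<and>
      normD_cl \<Omega> F \<le> 1 / H * norm2_cl (lebesgue_on \<Omega>) f"
proof -
  interpret robin_problem \<Omega> b \<tau>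
    using assms(3,4,10,11) by unfold_locales
  define K where "K = 2 powr (n / 2) * \<beta> * T\<^sup>2"
  define a where "a = (1 + m\<^sup>2)\<^sup>2 - K"
  define d where "d = (norm s)\<^sup>2 + n\<^sup>2 - 2 * \<bar>s0\<bar> * n * M - K"
  define c where "c = sqrt n * (1 + M\<^sup>2) * ((3 + n) * M + \<bar>s0\<bar>)"
  have M0: "0 \<le> M"
    using assms(8,9) by simp
  have m_le: "m \<le> norm x" if "x \<in> \<Omega>" for x
    unfolding assms(6) using that by (intro cINF_lower) (auto intro: bdd_belowI[of _ 0])
  have le_M: "norm x \<le> M" if "x \<in> \<Omega>" for x
    unfolding assms(7) using that assms(4) by (intro cSUP_upper) (auto simp: bounded_iff bdd_above_def)
  have c0: "0 \<le> c"
    using assms(2) M0 by (simp add: c_def)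
  have pow1: "2 powr (n / 2 + 1) = 2 * 2 powr (n / 2)"
    by (simp add: powr_add)
  have pow2: "2 powr n = (2 powr (n / 2))\<^sup>2"
    by (simp add: power2_eq_square flip: powr_add)
  have sum_pos: "0 < a + d"
  proof -
    have "2 powr (n / 2 + 1) * \<beta> * T\<^sup>2 = 2 * K"
      by (simp add: K_def pow1)
    with assms(16) show ?thesis
      unfolding a_def d_def by linarith
  qed
  have "(sqrt n)\<^sup>2 = n"
    using assms(2) by simp
  then have c2: "c\<^sup>2 = n * (1 + M\<^sup>2)\<^sup>2 * ((3 + n) * M + \<bar>s0\<bar>)\<^sup>2"
    by (simp add: c_def power_mult_distrib)
  have det: "c\<^sup>2 < a * d"
  proof -
    define A where "A = (1 + m\<^sup>2)\<^sup>2"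
    define W where "W = (1 + M\<^sup>2)\<^sup>2"
    define u where "u = 2 * \<bar>s0\<bar> * n * M"
    have "c\<^sup>2 = n * W * (3 + n)\<^sup>2 * M\<^sup>2 + u * ((3 + n) * W) + n * W * \<bar>s0\<bar>\<^sup>2"
      unfolding c2 W_def[symmetric] u_def by (simp only: power2_eq_square) (simp add: algebra_simps)
    moreover have "(norm s)\<^sup>2 * (A - K) - n * W * s0\<^sup>2 - u * (A + (3 + n) * W - K)
       > n * W * (3 + n)\<^sup>2 * M\<^sup>2 + A * K - n\<^sup>2 * (A - K) - K\<^sup>2"
      using assms(17)
      by (simp add: K_def A_def W_def u_def pow2 power_mult_distrib mult.assoc flip: power_mult)
    moreover have "u * (A + (3 + n) * W - K) = u * (A - K) + u * ((3 + n) * W)"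
      by (simp add: algebra_simps)
    moreover have "a * d = (norm s)\<^sup>2 * (A - K) + n\<^sup>2 * (A - K) - u * (A - K) - A * K + K\<^sup>2"
      unfolding a_def d_def A_def[symmetric] u_def[symmetric]
      by (simp add: algebra_simps power2_eq_square[of K])
    ultimately show ?thesis
      by (simp only: power2_abs)
  qed
  have H_eq: "H = (a + d) / 2 - sqrt ((a - d)\<^sup>2 + 4 * c\<^sup>2) / 2"
  proof -
    have "(a - d)\<^sup>2 = ((norm s)\<^sup>2 + n\<^sup>2 - 2 * \<bar>s0\<bar> * n * M - (1 + m\<^sup>2)\<^sup>2)\<^sup>2"
      unfolding power2_commute[of a d] by (simp add: a_def d_def algebra_simps)
    then show ?thesis
      unfolding assms(18) c_def by (simp add: a_def d_def K_def field_simps)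
  qed
  note low = symmetric_matrix_lower_bound[OF c0 sum_pos det, folded H_eq]
  have coercive: "H * H1_inner \<Omega> F F
      \<le> robin_scalar_form \<Omega> b \<tau> (Sc s) ((norm s)\<^sup>2 + (real CARD('n))\<^sup>2) F F"
    if F: "F \<in> H1_cl \<Omega>" for F
  proof -
    define p where "p = normD_cl \<Omega> F"
    define q where "q = norm2_cl (lebesgue_on \<Omega>) F"
    \<comment> \<open>the trace inequality holds with constant \<open>\<beta> T\<^sup>2\<close>, which is at most \<open>K\<close>\<close>
    have "0 \<le> \<beta> * T\<^sup>2"
      using Linfty_norm_nonneg[OF b_Linfty] by (simp add: assms(12))
    moreover have "1 \<le> 2 powr (n / 2)"
      using assms(2) by (intro ge_one_powr_ge_zero) auto
    ultimately have "1 * (\<beta> * T\<^sup>2) \<le> 2 powr (n / 2) * (\<beta> * T\<^sup>2)"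
      by (intro mult_right_mono)
    then have "\<beta> * T\<^sup>2 * (p\<^sup>2 + q\<^sup>2) \<le> K * (p\<^sup>2 + q\<^sup>2)"
      by (intro mult_right_mono) (simp_all add: K_def mult.assoc)
    moreover have "(1 + m\<^sup>2)\<^sup>2 * p\<^sup>2 - 2 * c * p * q
        + ((norm s)\<^sup>2 + n\<^sup>2 - 2 * \<bar>s0\<bar> * n * M) * q\<^sup>2 - \<beta> * T\<^sup>2 * (p\<^sup>2 + q\<^sup>2)
      \<le> robin_scalar_form \<Omega> b \<tau> (Sc s) ((norm s)\<^sup>2 + (real CARD('n))\<^sup>2) F F"
      using robin_scalar_form_lower_bound[OF assms(8) m_le M0 le_M F, of "Sc s" "(norm s)\<^sup>2 + (real CARD('n))\<^sup>2"]
      unfolding p_def q_def c_def assms(1,12,13,15) .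
    moreover have "H * (p\<^sup>2 + q\<^sup>2) \<le> (1 + m\<^sup>2)\<^sup>2 * p\<^sup>2 - 2 * c * p * q
        + ((norm s)\<^sup>2 + n\<^sup>2 - 2 * \<bar>s0\<bar> * n * M) * q\<^sup>2 - K * (p\<^sup>2 + q\<^sup>2)"
      using low(2)[of p q] unfolding a_def d_def by (simp add: left_diff_distrib distrib_left)
    ultimately have "H * (p\<^sup>2 + q\<^sup>2)
        \<le> robin_scalar_form \<Omega> b \<tau> (Sc s) ((norm s)\<^sup>2 + (real CARD('n))\<^sup>2) F F"
      by linarith
    then show ?thesis
      by (simp add: H1_inner_same[OF F] p_def q_def add.commute)
  qed
  show ?thesis
    using le_M low(1) coercive assms(19) by (rule robin_solution_exists)
qed

end
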